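(* Let $\mathcal S$ be the support of a simple pseudoline arrangement, $\chi$ a cut of $\mathcal S$ given by a filter $F$, $v$ a minimal vertex of $\mathcal S$ for $\preceq_\chi$, and $\psi$ the cut given by the filter $F\setminus\{\bar v\}$ (where $\bar v$ is the preimage of $v$ in $F\setminus\tau(F)$), i.e. the cut obtained from $\chi$ by sweeping $v$. Let $V$ be a set of vertices of $\mathcal S$ such that $G(\mathcal S\mid V)$ is nonempty, and $W=V\cup\{v\}$. Then: (1) If $v$ is a contact point of $\Gamma_\chi(\mathcal S\mid V)$ which is not in $V$, then $\Gamma_\psi(\mathcal S\mid V)$ is obtained from $\Gamma_\chi(\mathcal S\mid V)$ by flipping $v$; otherwise $\Gamma_\psi(\mathcal S\mid V)=\Gamma_\chi(\mathcal S\mid V)$. (2) If $v$ is a contact point of $\Gamma_\chi(\mathcal S\mid V)$, then $\Gamma_\psi(\mathcal S\mid W)=\Gamma_\chi(\mathcal S\mid V)$; otherwise $G(\mathcal S\mid W)$ is empty.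
   Context: Möbius strip $\mathcal M=\mathbb R^2/\tau$, $\tau(x,y)=(x+\pi,-y)$, projection $\pi$. Pseudoline: image under $\pi$ of the graph of a continuous $f$ with $f(x+\pi)=-f(x)$. Pseudolines meet in finitely many crossing or contact (touching, non-crossing) points. A (simple) pseudoline arrangement with contact points is a finite set of pseudolines any two with exactly one crossing point and possibly contact points, no three through a point. Support = union, a graph with vertices the intersection points. Flipping a contact point $v$ of two pseudolines with crossing point $w$: the unique arrangement with the same support and contact set $(V\setminus\{v\})\cup\{w\}$. $\bar{\mathcal S}=\pi^{-1}(\mathcal S)$, edges oriented by increasing abscissa, $\preceq$ the path order on its vertices. A filter is a nonempty proper upward-closed set $F$ of vertices of $\bar{\mathcal S}$, determining a cut $\chi$; each vertex $v$ of $\mathcal S$ has a unique preimage $\bar v\in F\setminus\tau(F)$, and $v\preceq_\chi w$ iff $\bar v\preceq\bar w$. A flip of $v$ with crossing point $w$ is $\chi$-increasing if $v\prec_\chi w$. For a set $V$ of vertices of $\mathcal S$, $G(\mathcal S\mid V)$ is the graph whose vertices are the arrangements supported by $\mathcal S$ whose contact set contains $V$, with edges the flips between them; $G_\chi(\mathcal S\mid V)$ is its orientation by $\chi$-increasing flips. When $G(\mathcal S\mid V)$ is nonempty, $G_\chi(\mathcal S\mid V)$ has a unique source, denoted $\Gamma_\chi(\mathcal S\mid V)$ (the $\chi$-greedy constrained arrangement). *)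

theory Defs
  imports "HOL-Analysis.Analysis"
begin

definition tau :: "real \<times> real \<Rightarrow> real \<times> real" where
  "tau p = (fst p + pi, - snd p)"

definition same_orbit :: "real \<times> real \<Rightarrow> real \<times> real \<Rightarrow> bool" where
  "same_orbit p q \<longleftrightarrow> (\<exists>n. q = (tau ^^ n) p \<or> p = (tau ^^ n) q)"

lemma inj_tau: "inj tau"
  by (rule injI) (simp add: tau_def prod_eq_iff)

lemma same_orbit_iff: "same_orbit p q \<longleftrightarrow> (\<exists>m n. (tau ^^ m) p = (tau ^^ n) q)"
proof
  assume "same_orbit p q"
  then obtain n where "q = (tau ^^ n) p \<or> p = (tau ^^ n) q"
    unfolding same_orbit_def by blast
  then have "(tau ^^ n) p = (tau ^^ 0) q \<or> (tau ^^ 0) p = (tau ^^ n) q"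
    by auto
  then show "\<exists>m n. (tau ^^ m) p = (tau ^^ n) q" by blast
next
  assume "\<exists>m n. (tau ^^ m) p = (tau ^^ n) q"
  then obtain m n where eq: "(tau ^^ m) p = (tau ^^ n) q" by blast
  have inj: "inj (tau ^^ k)" for k
    by (simp add: inj_tau inj_fn)
  show "same_orbit p q"
  proof (cases "m \<le> n")
    case True
    then have "(tau ^^ n) q = (tau ^^ m) ((tau ^^ (n - m)) q)"
      using funpow_add[of m "n - m" tau] by simp
    with eq have "(tau ^^ m) p = (tau ^^ m) ((tau ^^ (n - m)) q)" by simp
    then have "p = (tau ^^ (n - m)) q" by (rule injD[OF inj])
    then show ?thesis unfolding same_orbit_def by blast
  next
    case False
    then have "(tau ^^ m) p = (tau ^^ n) ((tau ^^ (m - n)) p)"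
      using funpow_add[of n "m - n" tau] by simp
    with eq have "(tau ^^ n) q = (tau ^^ n) ((tau ^^ (m - n)) p)" by simp
    then have "q = (tau ^^ (m - n)) p" by (rule injD[OF inj])
    then show ?thesis unfolding same_orbit_def by blast
  qed
qed

lemma equivp_same_orbit: "equivp same_orbit"
proof (rule equivpI)
  show "reflp same_orbit"
    unfolding same_orbit_iff by (rule reflpI) blast
  show "symp same_orbit"
    unfolding same_orbit_def by (rule sympI) blast
  show "transp same_orbit"
  proof (rule transpI)
    fix p q r assume "same_orbit p q" "same_orbit q r"
    then obtain m n k l where "(tau ^^ m) p = (tau ^^ n) q" "(tau ^^ k) q = (tau ^^ l) r"
      unfolding same_orbit_iff by blast
    then have pq: "(tau ^^ m) p = (tau ^^ n) q" and qr: "(tau ^^ k) q = (tau ^^ l) r"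
      by auto
    have "(tau ^^ (k + m)) p = (tau ^^ (k + n)) q" by (simp add: funpow_add pq)
    also have "\<dots> = (tau ^^ (n + k)) q" by (simp add: add.commute)
    also have "\<dots> = (tau ^^ (n + l)) r" by (simp add: funpow_add qr)
    finally have "(tau ^^ (k + m)) p = (tau ^^ (n + l)) r" .
    then show "same_orbit p r" unfolding same_orbit_iff by blast
  qed
qed

quotient_type moebius = "real \<times> real" / same_orbit
  morphisms moebius_rep proj
  by (rule equivp_same_orbit)


definition antiperiodic :: "(real \<Rightarrow> real) \<Rightarrow> bool" where
  "antiperiodic f \<longleftrightarrow> continuous_on UNIV f \<and> (\<forall>x. f (x + pi) = - f x)"

definition represents :: "(real \<Rightarrow> real) \<Rightarrow> moebius set \<Rightarrow> bool" where
  "represents f l \<longleftrightarrow> antiperiodic f \<and> l = proj ` {(x, f x) | x. True}"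

definition pseudoline :: "moebius set \<Rightarrow> bool" where
  "pseudoline l \<longleftrightarrow> (\<exists>f. represents f l)"

definition changes_sign_at :: "(real \<Rightarrow> real) \<Rightarrow> real \<Rightarrow> bool" where
  "changes_sign_at h x \<longleftrightarrow>
     (\<exists>e>0. \<forall>s t. x - e < s \<and> s < x \<and> x < t \<and> t < x + e \<longrightarrow> h s * h t < 0)"

text \<open>The preimage of a pseudoline in the plane is exactly the graph of its representing
  function, so that function is unique; the choice of the lift \<open>(x, f x)\<close> of \<open>p\<close> is immaterial
  because \<open>f - g\<close> is antiperiodic.\<close>

definition crossing_point :: "moebius set \<Rightarrow> moebius set \<Rightarrow> moebius \<Rightarrow> bool" where
  "crossing_point l m p \<longleftrightarrow>
     (\<exists>f g x. represents f l \<and> represents g m \<and> f x = g x \<and> p = proj (x, f x) \<and>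
        changes_sign_at (\<lambda>t. f t - g t) x)"

definition contact_point :: "moebius set \<Rightarrow> moebius set \<Rightarrow> moebius \<Rightarrow> bool" where
  "contact_point l m p \<longleftrightarrow> p \<in> l \<inter> m \<and> \<not> crossing_point l m p"

definition simple_arrangement :: "moebius set set \<Rightarrow> bool" where
  "simple_arrangement L \<longleftrightarrow>
     finite L \<and> (\<forall>l\<in>L. pseudoline l) \<and>
     (\<forall>l\<in>L. \<forall>m\<in>L. l \<noteq> m \<longrightarrow> finite (l \<inter> m) \<and> (\<exists>!p. crossing_point l m p)) \<and>
     (\<forall>k\<in>L. \<forall>l\<in>L. \<forall>m\<in>L. k \<noteq> l \<and> l \<noteq> m \<and> k \<noteq> m \<longrightarrow> k \<inter> l \<inter> m = {})"

definition support :: "moebius set set \<Rightarrow> moebius set" where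
  "support L = \<Union> L"

definition contact_set :: "moebius set set \<Rightarrow> moebius set" where
  "contact_set L = {p. \<exists>l\<in>L. \<exists>m\<in>L. l \<noteq> m \<and> contact_point l m p}"

text \<open>All simple arrangements with the same support have the same intersection points (the points
  at which the support is locally not an arc), hence the vertices depend on the support only.\<close>

definition vertices :: "moebius set \<Rightarrow> moebius set" where
  "vertices S = {p. \<exists>L. simple_arrangement L \<and> support L = S \<and>
     (\<exists>l\<in>L. \<exists>m\<in>L. l \<noteq> m \<and> p \<in> l \<inter> m)}"


definition cover :: "moebius set \<Rightarrow> (real \<times> real) set" where
  "cover S = proj -` S"

definition cover_vertices :: "moebius set \<Rightarrow> (real \<times> real) set" where
  "cover_vertices S = proj -` vertices S"

definition cover_edge :: "moebius set \<Rightarrow> real \<times> real \<Rightarrow> real \<times> real \<Rightarrow> bool" where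
  "cover_edge S p q \<longleftrightarrow>
     p \<in> cover_vertices S \<and> q \<in> cover_vertices S \<and> fst p < fst q \<and>
     (\<exists>h. continuous_on {fst p..fst q} h \<and> h (fst p) = snd p \<and> h (fst q) = snd q \<and>
        (\<forall>x\<in>{fst p..fst q}. (x, h x) \<in> cover S) \<and>
        (\<forall>x\<in>{fst p<..<fst q}. (x, h x) \<notin> cover_vertices S))"

definition path_le :: "moebius set \<Rightarrow> real \<times> real \<Rightarrow> real \<times> real \<Rightarrow> bool" where
  "path_le S = (cover_edge S)\<^sup>*\<^sup>*"

text \<open>A cut is represented by the filter that determines it.\<close>

definition cut_filter :: "moebius set \<Rightarrow> (real \<times> real) set \<Rightarrow> bool" where
  "cut_filter S F \<longleftrightarrow> F \<noteq> {} \<and> F \<subset> cover_vertices S \<and>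
     (\<forall>p\<in>F. \<forall>q\<in>cover_vertices S. path_le S p q \<longrightarrow> q \<in> F)"

definition lift_pt :: "(real \<times> real) set \<Rightarrow> moebius \<Rightarrow> real \<times> real" where
  "lift_pt F v = (THE p. p \<in> F - tau ` F \<and> proj p = v)"

definition cut_le :: "moebius set \<Rightarrow> (real \<times> real) set \<Rightarrow> moebius \<Rightarrow> moebius \<Rightarrow> bool" where
  "cut_le S F v w \<longleftrightarrow> path_le S (lift_pt F v) (lift_pt F w)"

definition cut_less :: "moebius set \<Rightarrow> (real \<times> real) set \<Rightarrow> moebius \<Rightarrow> moebius \<Rightarrow> bool" where
  "cut_less S F v w \<longleftrightarrow> cut_le S F v w \<and> v \<noteq> w"

definition minimal_vertex :: "moebius set \<Rightarrow> (real \<times> real) set \<Rightarrow> moebius \<Rightarrow> bool" where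
  "minimal_vertex S F v \<longleftrightarrow> v \<in> vertices S \<and> \<not> (\<exists>w\<in>vertices S. cut_less S F w v)"


text \<open>A simple arrangement is determined by its support and its contact set, so \<open>L'\<close> is the unique
  arrangement with the stated properties.\<close>

definition flip ::
  "moebius \<Rightarrow> moebius \<Rightarrow> moebius set set \<Rightarrow> moebius set set \<Rightarrow> bool" where
  "flip v w L L' \<longleftrightarrow>
     simple_arrangement L \<and>
     (\<exists>l\<in>L. \<exists>m\<in>L. l \<noteq> m \<and> contact_point l m v \<and> crossing_point l m w) \<and>
     simple_arrangement L' \<and> support L' = support L \<and>
     contact_set L' = (contact_set L - {v}) \<union> {w}"

definition flip_graph_verts :: "moebius set \<Rightarrow> moebius set \<Rightarrow> moebius set set set" where
  "flip_graph_verts S V = {L. simple_arrangement L \<and> support L = S \<and> V \<subseteq> contact_set L}"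

definition flip_graph_arcs ::
  "moebius set \<Rightarrow> (real \<times> real) set \<Rightarrow> moebius set \<Rightarrow> (moebius set set \<times> moebius set set) set"
  where
  "flip_graph_arcs S F V =
     {(L, L'). L \<in> flip_graph_verts S V \<and> L' \<in> flip_graph_verts S V \<and>
        (\<exists>v w. flip v w L L' \<and> cut_less S F v w)}"

definition flip_graph_source ::
  "moebius set \<Rightarrow> (real \<times> real) set \<Rightarrow> moebius set \<Rightarrow> moebius set set \<Rightarrow> bool" where
  "flip_graph_source S F V L \<longleftrightarrow>
     L \<in> flip_graph_verts S V \<and> \<not> (\<exists>L'. (L', L) \<in> flip_graph_arcs S F V)"

definition greedy ::
  "moebius set \<Rightarrow> (real \<times> real) set \<Rightarrow> moebius set \<Rightarrow> moebius set set" where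
  "greedy S F V = (THE L. flip_graph_source S F V L)"

end

theory Submission
  imports Defs
begin

text \<open>A pseudoline lifts to the graph of one antiperiodic function, so an arrangement is a finite set
  of such functions. Flipping exchanges two of them between their contact point and their crossing;
  a third function meets neither point, so it crosses both or none of the two in between.

  Consequently an arrangement is a source of the flip graph iff every contact point outside
  \<open>V\<close> precedes, in the cut order, the crossing of its two pseudolines. On a common pseudoline this
  order is the order of abscissae of the lifts in \<open>F - tau F\<close>. Two arrangements with this property
  coincide: at the last vertex where they differ, the two pseudolines touching in the first one
  still have to cross later, and they would cross twice in the second one. A source exists because
  an increasing flip increases the sum of the abscissae of the contact points.

  Sweeping \<open>v\<close> replaces its lift \<open>(x, y)\<close> by \<open>(x + pi, - y)\<close>, which turns it from the first to the last
  vertex on its two pseudolines. So the characterisation of sources is affected only if \<open>v\<close> is a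
  contact point outside \<open>V\<close>, and flipping \<open>v\<close> restores it.\<close>

section \<open>Pseudolines as antiperiodic functions\<close>

text \<open>Arrangements with a common support have to be compared although the support is merely a
  set of points. The means is to follow a curve of one arrangement by a curve of the other: they do
  not separate between vertices, nor at a vertex that has the same type (crossing or contact) in
  both. Thus vertices, flips and the identity of an arrangement all reduce to local data.

  A source has no incoming arc, so a contact point that comes after its crossing is refuted by
  flipping it and reading the flip backwards. For this the crossing is replaced by its next
  translate, which lies less than \<open>pi\<close> after the contact; hence one construction,
  exchanging two functions on an interval from a contact to a crossing shorter than
  \<open>pi\<close>, serves all flips.

  For the second claim, suppose that an arrangement is greedy after the sweep with the swept vertex
  among its constrained contacts. Before the sweep this contact is first on its two pseudolines, so
  the constraint on it may be dropped there; uniqueness then identifies the arrangement with the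
  greedy one for \<open>V\<close>.\<close>

definition line :: "(real \<Rightarrow> real) \<Rightarrow> moebius set" where
  "line f = proj ` {(x, f x) | x. True}"

abbreviation crosses :: "(real \<Rightarrow> real) \<Rightarrow> (real \<Rightarrow> real) \<Rightarrow> real \<Rightarrow> bool" where
  "crosses f g x \<equiv> changes_sign_at (\<lambda>t. f t - g t) x"

lemma represents_iff: "represents f l \<longleftrightarrow> antiperiodic f \<and> l = line f"
  by (simp add: represents_def line_def)

lemma antiperiodic_shift:
  assumes "antiperiodic f"
  shows "f (x + of_int n * pi) = (if even n then f x else - f x)"
proof -
  have up: "f (y + pi) = - f y" for y
    using assms by (simp add: antiperiodic_def)
  have down: "f (y - pi) = - f y" for y
    using up[of "y - pi"] by simp
  show ?thesis
  proof (induction n rule: int_induct[where k = 0])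
    case base
    then show ?case by simp
  next
    case (step1 i)
    then show ?case using up[of "x + of_int i * pi"] by (simp add: algebra_simps)
  next
    case (step2 i)
    then show ?case using down[of "x + of_int i * pi"] by (simp add: algebra_simps)
  qed
qed

lemma funpow_tau: "(tau ^^ n) (x, y) = (x + real n * pi, if even n then y else - y)"
  by (induction n) (auto simp: tau_def algebra_simps)

lemma proj_eq_iff:
  "proj (x, y) = proj (x', y') \<longleftrightarrow>
    (\<exists>n::int. x' = x + of_int n * pi \<and> y' = (if even n then y else - y))" (is "_ \<longleftrightarrow> ?R")
proof -
  have "same_orbit (x, y) (x', y') \<longleftrightarrow> ?R"
  proof
    assume "same_orbit (x, y) (x', y')"
    then obtain n where "(x', y') = (tau ^^ n) (x, y) \<or> (x, y) = (tau ^^ n) (x', y')"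
      unfolding same_orbit_def by blast
    then show ?R
    proof
      assume "(x', y') = (tau ^^ n) (x, y)"
      then show ?R unfolding funpow_tau by (intro exI[of _ "int n"]) auto
    next
      assume "(x, y) = (tau ^^ n) (x', y')"
      then show ?R unfolding funpow_tau by (intro exI[of _ "- int n"]) auto
    qed
  next
    assume ?R
    then obtain n :: int where n: "x' = x + of_int n * pi" "y' = (if even n then y else - y)"
      by blast
    show "same_orbit (x, y) (x', y')"
    proof (cases "n \<ge> 0")
      case True
      then have "(x', y') = (tau ^^ nat n) (x, y)"
        unfolding funpow_tau using n by (auto simp: even_nat_iff)
      then show ?thesis unfolding same_orbit_def by blast
    next
      case False
      then have "(x, y) = (tau ^^ nat (- n)) (x', y')"
        unfolding funpow_tau using n by (auto simp: even_nat_iff)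
      then show ?thesis unfolding same_orbit_def by blast
    qed
  qed
  then show ?thesis by (simp add: moebius.abs_eq_iff)
qed

lemma proj_shift:
  assumes "antiperiodic f"
  shows "proj (x + of_int n * pi, f (x + of_int n * pi)) = proj (x, f x)"
  using antiperiodic_shift[OF assms, of x n] proj_eq_iff[of x "f x"] by metis

lemma proj_graph_eq_iff:
  assumes "antiperiodic f"
  shows "proj (x, f x) = proj (x', y') \<longleftrightarrow> (\<exists>n::int. x' = x + of_int n * pi \<and> y' = f x')"
  unfolding proj_eq_iff using antiperiodic_shift[OF assms, of x] by metis

lemma proj_cases: obtains x y where "p = proj (x, y)"
proof -
  have "\<exists>q. p = proj q" by (induction p rule: moebius.abs_induct) blast
  then show ?thesis using that by (metis surj_pair)
qed

lemma shift_into_period: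
  fixes x a :: real
  obtains n :: int where "a \<le> x + of_int n * pi" "x + of_int n * pi < a + pi"
proof -
  define m where "m = \<lfloor>(x - a) / pi\<rfloor>"
  have "of_int m \<le> (x - a) / pi" "(x - a) / pi < of_int m + 1" unfolding m_def by linarith+
  then have "of_int m * pi \<le> x - a" "x - a < (of_int m + 1) * pi"
    using pi_gt_zero by (auto simp: pos_le_divide_eq pos_divide_less_eq)
  then show ?thesis using that[of "- m"] by (simp add: algebra_simps)
qed

lemma proj_in_line_iff:
  assumes "antiperiodic f"
  shows "proj (x, y) \<in> line f \<longleftrightarrow> y = f x"
proof
  assume "proj (x, y) \<in> line f"
  then obtain x' where "proj (x', f x') = proj (x, y)" by (auto simp: line_def)
  then show "y = f x" using proj_graph_eq_iff[OF assms] by blast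
qed (auto simp: line_def)

lemma inj_on_line: "inj_on line (Collect antiperiodic)"
proof (rule inj_onI)
  fix f g assume fg: "f \<in> Collect antiperiodic" "g \<in> Collect antiperiodic" "line f = line g"
  show "f = g"
  proof
    fix x
    have "proj (x, f x) \<in> line g"
      using proj_in_line_iff[of f] fg by auto
    then show "f x = g x"
      using proj_in_line_iff[of g] fg by auto
  qed
qed

lemma line_eq_iff: "antiperiodic f \<Longrightarrow> antiperiodic g \<Longrightarrow> line f = line g \<longleftrightarrow> f = g"
  using inj_on_line by (auto simp: inj_on_def)

lemma changes_sign_at_uminus: "changes_sign_at (\<lambda>t. - h t) x \<longleftrightarrow> changes_sign_at h x"
  by (simp add: changes_sign_at_def)

lemma crosses_commute: "crosses f g x \<longleftrightarrow> crosses g f x"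
  using changes_sign_at_uminus[of "\<lambda>t. f t - g t" x] by simp

lemma changes_sign_at_local:
  assumes d: "0 < d" and eq: "\<And>u. \<bar>u - x\<bar> < d \<Longrightarrow> h u = k u" and h: "changes_sign_at h x"
  shows "changes_sign_at k x"
proof -
  from h obtain e where e: "e > 0"
    "\<And>s t. x - e < s \<and> s < x \<and> x < t \<and> t < x + e \<Longrightarrow> h s * h t < 0"
    unfolding changes_sign_at_def by blast
  show ?thesis unfolding changes_sign_at_def
  proof (intro exI[of _ "min d e"] conjI allI impI)
    show "0 < min d e" using d e by simp
    fix s t assume st: "x - min d e < s \<and> s < x \<and> x < t \<and> t < x + min d e"
    then have "h s * h t < 0" by (intro e(2)) auto
    moreover have "h s = k s" "h t = k t" using st by (auto intro!: eq)
    ultimately show "k s * k t < 0" by simp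
  qed
qed

lemma changes_sign_at_translate:
  "changes_sign_at h (x + c) \<longleftrightarrow> changes_sign_at (\<lambda>t. h (t + c)) x"
proof -
  have "changes_sign_at (\<lambda>t. h (t + c)) x" if "changes_sign_at h (x + c)" for h :: "real \<Rightarrow> real" and x c
  proof -
    from that obtain e where e: "e > 0"
      "\<And>s t. x + c - e < s \<and> s < x + c \<and> x + c < t \<and> t < x + c + e \<Longrightarrow> h s * h t < 0"
      unfolding changes_sign_at_def by blast
    show ?thesis unfolding changes_sign_at_def
      by (rule exI[of _ e]) (use e in auto)
  qed
  from this[of h x c] this[of "\<lambda>t. h (t + c)" "x + c" "- c"] show ?thesis by auto
qed

lemma crosses_shift:
  assumes "antiperiodic f" "antiperiodic g"
  shows "crosses f g (x + of_int n * pi) \<longleftrightarrow> crosses f g x"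
proof -
  have "(\<lambda>t. f (t + of_int n * pi) - g (t + of_int n * pi)) =
      (if even n then (\<lambda>t. f t - g t) else (\<lambda>t. - (f t - g t)))"
    using assms by (auto simp: antiperiodic_shift)
  then show ?thesis
    unfolding changes_sign_at_translate[of _ x] using changes_sign_at_uminus[of "\<lambda>t. f t - g t"]
    by simp
qed

lemma meet_shift:
  assumes "antiperiodic f" "antiperiodic g"
  shows "f (x + of_int n * pi) = g (x + of_int n * pi) \<longleftrightarrow> f x = g x"
  using assms by (simp add: antiperiodic_shift)

lemma crossing_point_iff:
  assumes "antiperiodic f" "antiperiodic g"
  shows "crossing_point (line f) (line g) (proj (x, y)) \<longleftrightarrow> y = f x \<and> f x = g x \<and> crosses f g x"
proof
  assume "crossing_point (line f) (line g) (proj (x, y))"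
  then obtain f' g' x' where *: "represents f' (line f)" "represents g' (line g)" "f' x' = g' x'"
    "proj (x, y) = proj (x', f' x')" "crosses f' g' x'"
    unfolding crossing_point_def by blast
  then have [simp]: "f' = f" "g' = g"
    using assms by (auto simp: represents_iff line_eq_iff)
  obtain n :: int where "x = x' + of_int n * pi" "y = f x"
    using proj_graph_eq_iff[OF assms(1), of x' x y] * by auto
  then show "y = f x \<and> f x = g x \<and> crosses f g x"
    using * meet_shift[OF assms] crosses_shift[OF assms] by auto
next
  assume "y = f x \<and> f x = g x \<and> crosses f g x"
  then show "crossing_point (line f) (line g) (proj (x, y))"
    unfolding crossing_point_def represents_iff using assms by blast
qed

lemma contact_point_iff:
  assumes "antiperiodic f" "antiperiodic g"
  shows "contact_point (line f) (line g) (proj (x, y)) \<longleftrightarrow> y = f x \<and> f x = g x \<and> \<not> crosses f g x"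
  unfolding contact_point_def crossing_point_iff[OF assms]
  by (auto simp: proj_in_line_iff assms)

text \<open>Read in the plane, an intersection point has infinitely many lifts. Finiteness on the
  strip therefore becomes finiteness on bounded intervals, and a unique crossing becomes one that is
  unique up to multiples of \<open>pi\<close>.\<close>

definition fun_arrangement :: "(real \<Rightarrow> real) set \<Rightarrow> bool" where
  "fun_arrangement A \<longleftrightarrow> finite A \<and> (\<forall>f\<in>A. antiperiodic f) \<and>
     (\<forall>f\<in>A. \<forall>g\<in>A. f \<noteq> g \<longrightarrow> (\<forall>a b. finite {x \<in> {a..b}. f x = g x}) \<and>
        (\<exists>x. f x = g x \<and> crosses f g x) \<and>
        (\<forall>x y. f x = g x \<and> crosses f g x \<and> f y = g y \<and> crosses f g y \<longrightarrow>
          (\<exists>n::int. y = x + of_int n * pi))) \<and>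
     (\<forall>f\<in>A. \<forall>g\<in>A. \<forall>h\<in>A. f \<noteq> g \<and> g \<noteq> h \<and> f \<noteq> h \<longrightarrow> (\<forall>x. \<not> (f x = g x \<and> g x = h x)))"

text \<open>An interval of length 1 is shorter than the period, so \<open>proj\<close> is injective
  on the graph above it, and finitely many such intervals cover a bounded one. Conversely, every
  intersection point has a lift above one period.\<close>

lemma finite_meet_iff:
  assumes "antiperiodic f" "antiperiodic g"
  shows "finite (line f \<inter> line g) \<longleftrightarrow> (\<forall>a b. finite {x \<in> {a..b}. f x = g x})"
proof
  assume fin: "finite (line f \<inter> line g)"
  have short: "finite {x \<in> {a..a+1}. f x = g x}" for a
  proof (rule finite_imageD)
    show "finite ((\<lambda>x. proj (x, f x)) ` {x \<in> {a..a+1}. f x = g x})"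
      by (rule finite_subset[OF _ fin]) (auto simp: proj_in_line_iff assms)
    show "inj_on (\<lambda>x. proj (x, f x)) {x \<in> {a..a+1}. f x = g x}"
    proof (rule inj_onI)
      fix x y assume xy: "x \<in> {x \<in> {a..a+1}. f x = g x}" "y \<in> {x \<in> {a..a+1}. f x = g x}"
        "proj (x, f x) = proj (y, f y)"
      then obtain n :: int where n: "y = x + of_int n * pi"
        using proj_graph_eq_iff[OF assms(1)] by blast
      have "n = 0"
      proof (rule ccontr)
        assume "n \<noteq> 0"
        then have "1 \<le> \<bar>real_of_int n\<bar>" by linarith
        then have "1 * pi \<le> \<bar>real_of_int n\<bar> * pi" by (intro mult_right_mono) auto
        then have "pi \<le> \<bar>y - x\<bar>" by (simp add: n abs_mult)
        then show False using xy pi_gt3 by auto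
      qed
      then show "x = y" using n by simp
    qed
  qed
  have "finite {x \<in> {a..a + real n}. f x = g x}" for a n
  proof (induction n)
    case 0
    then show ?case using finite_subset[of _ "{a}"] by auto
  next
    case (Suc n)
    have "{x \<in> {a..a + real (Suc n)}. f x = g x} \<subseteq>
      {x \<in> {a..a + real n}. f x = g x} \<union> {x \<in> {a+real n..a + real n + 1}. f x = g x}" by auto
    then show ?case using Suc short[of "a + real n"] finite_subset by blast
  qed
  moreover have "\<exists>n. {x \<in> {a..b}. f x = g x} \<subseteq> {x \<in> {a..a + real n}. f x = g x}" for a b
  proof -
    obtain n where "b - a \<le> real n" using real_arch_simple by blast
    then show ?thesis by (intro exI[of _ n]) auto
  qed
  ultimately show "\<forall>a b. finite {x \<in> {a..b}. f x = g x}" using finite_subset by metis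
next
  assume fin: "\<forall>a b. finite {x \<in> {a..b}. f x = g x}"
  have "line f \<inter> line g \<subseteq> (\<lambda>x. proj (x, f x)) ` {x \<in> {0..pi}. f x = g x}"
  proof
    fix p assume p: "p \<in> line f \<inter> line g"
    obtain x y where xy: "p = proj (x, y)" by (rule proj_cases)
    then have y: "y = f x" "f x = g x" using p proj_in_line_iff assms by auto
    obtain n :: int where "0 \<le> x + of_int n * pi" "x + of_int n * pi < 0 + pi"
      by (rule shift_into_period)
    then have "x + of_int n * pi \<in> {x \<in> {0..pi}. f x = g x}"
      using y meet_shift[OF assms] by auto
    moreover have "p = proj (x + of_int n * pi, f (x + of_int n * pi))"
      using proj_shift[OF assms(1), of x n] xy y by simp
    ultimately show "p \<in> (\<lambda>x. proj (x, f x)) ` {x \<in> {0..pi}. f x = g x}" by blast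
  qed
  then show "finite (line f \<inter> line g)" using fin finite_subset by blast
qed

lemma ex1_crossing_iff:
  assumes "antiperiodic f" "antiperiodic g"
  shows "(\<exists>!p. crossing_point (line f) (line g) p) \<longleftrightarrow>
    (\<exists>x. f x = g x \<and> crosses f g x) \<and>
    (\<forall>x y. f x = g x \<and> crosses f g x \<and> f y = g y \<and> crosses f g y \<longrightarrow>
          (\<exists>n::int. y = x + of_int n * pi))" (is "?L \<longleftrightarrow> ?R")
proof
  assume ?L
  then obtain p where p: "crossing_point (line f) (line g) p"
    and u: "\<And>q. crossing_point (line f) (line g) q \<Longrightarrow> q = p" by blast
  show ?R
  proof (intro conjI allI impI)
    show "\<exists>x. f x = g x \<and> crosses f g x"
      using p crossing_point_iff[OF assms] by (metis proj_cases)
    fix x y assume "f x = g x \<and> crosses f g x \<and> f y = g y \<and> crosses f g y"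
    then have "proj (x, f x) = p" "proj (y, f y) = p"
      using u crossing_point_iff[OF assms] by auto
    then have "proj (x, f x) = proj (y, f y)" by simp
    then show "\<exists>n::int. y = x + of_int n * pi" using proj_graph_eq_iff[OF assms(1)] by blast
  qed
next
  assume R: ?R
  then obtain x where x: "f x = g x \<and> crosses f g x" by blast
  show ?L
  proof (rule ex1I[of _ "proj (x, f x)"])
    show "crossing_point (line f) (line g) (proj (x, f x))"
      using x crossing_point_iff[OF assms] by auto
    fix q assume q: "crossing_point (line f) (line g) q"
    obtain x' y' where xy: "q = proj (x', y')" by (rule proj_cases)
    then have "y' = f x'" "f x' = g x'" "crosses f g x'" using q crossing_point_iff[OF assms] by auto
    then show "q = proj (x, f x)" using R x xy proj_graph_eq_iff[OF assms(1)] by metis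
  qed
qed

lemma simple_arrangement_line_iff:
  assumes anti: "\<And>f. f \<in> A \<Longrightarrow> antiperiodic f"
  shows "simple_arrangement (line ` A) \<longleftrightarrow> fun_arrangement A"
proof -
  have inj: "inj_on line A" using inj_on_line anti by (auto simp: inj_on_def)
  have "line f \<inter> line g \<inter> line h = {} \<longleftrightarrow> (\<forall>x. \<not> (f x = g x \<and> g x = h x))"
    if "f \<in> A" "g \<in> A" "h \<in> A" for f g h
  proof -
    have "line f \<inter> line g \<inter> line h = {} \<longleftrightarrow> (\<forall>x y. proj (x, y) \<notin> line f \<inter> line g \<inter> line h)"
      by (metis proj_cases ex_in_conv)
    also have "\<dots> \<longleftrightarrow> (\<forall>x. \<not> (f x = g x \<and> g x = h x))"
      using that anti by (simp add: proj_in_line_iff) metis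
    finally show ?thesis .
  qed
  moreover have "(\<forall>l\<in>line ` A. pseudoline l)"
    using anti by (auto simp: pseudoline_def represents_iff)
  moreover have "finite (line ` A) \<longleftrightarrow> finite A" using inj finite_image_iff by blast
  moreover have "line f = line g \<longleftrightarrow> f = g" if "f \<in> A" "g \<in> A" for f g
    using that line_eq_iff anti by blast
  ultimately show ?thesis
    unfolding simple_arrangement_def fun_arrangement_def
    using anti finite_meet_iff ex1_crossing_iff by auto
qed

lemma simple_arrangement_obtain:
  assumes "simple_arrangement L"
  obtains A where "L = line ` A" "fun_arrangement A"
proof -
  have "\<forall>l\<in>L. \<exists>f. antiperiodic f \<and> l = line f"
    using assms by (auto simp: simple_arrangement_def pseudoline_def represents_iff)
  then obtain r where r: "\<forall>l\<in>L. antiperiodic (r l) \<and> l = line (r l)" by metis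
  then have "L = line ` r ` L" by force
  moreover have "fun_arrangement (r ` L)"
    using simple_arrangement_line_iff[of "r ` L"] r assms calculation by auto
  ultimately show ?thesis using that by blast
qed

section \<open>Sign changes and local structure\<close>

lemma same_sign_if_no_zero:
  fixes h :: "real \<Rightarrow> real"
  assumes "continuous_on UNIV h" and nz: "\<And>t. min u u' \<le> t \<Longrightarrow> t \<le> max u u' \<Longrightarrow> h t \<noteq> 0"
  shows "h u * h u' > 0"
proof -
  have le: "h a * h b > 0" if "a \<le> b" "\<And>t. a \<le> t \<Longrightarrow> t \<le> b \<Longrightarrow> h t \<noteq> 0" for a b
  proof (rule ccontr)
    assume "\<not> h a * h b > 0"
    then have "(h a \<le> 0 \<and> 0 \<le> h b) \<or> (h b \<le> 0 \<and> 0 \<le> h a)"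
      by (smt (verit) mult_neg_neg mult_pos_pos)
    moreover have "continuous_on {a..b} h" using assms(1) continuous_on_subset by blast
    ultimately have "\<exists>t. a \<le> t \<and> t \<le> b \<and> h t = 0"
      using IVT'[of h a 0 b] IVT2'[of h b 0 a] that(1) by blast
    then show False using that(2) by blast
  qed
  show ?thesis
    using le[of u u'] le[of u' u] nz by (cases "u \<le> u'") (auto simp: min_def max_def mult.commute)
qed

text \<open>A continuous function that is nonzero at \<open>x\<close> keeps its sign nearby. For
  curves this says that crossing implies meeting.\<close>

lemma changes_sign_at_imp_zero:
  fixes h :: "real \<Rightarrow> real"
  assumes "continuous_on UNIV h" "changes_sign_at h x"
  shows "h x = 0"
proof (rule ccontr)
  assume nz: "h x \<noteq> 0"
  have "isCont h x" using assms(1) by (simp add: continuous_on_eq_continuous_at)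
  then have "eventually (\<lambda>u. h u * h x > 0) (at x)"
  proof -
    have "((\<lambda>u. h u * h x) \<longlongrightarrow> h x * h x) (at x)"
      using \<open>isCont h x\<close> by (auto intro!: tendsto_intros simp: isCont_def)
    moreover have "h x * h x > 0" using nz by (simp add: zero_less_mult_iff less_le)
    ultimately show ?thesis using order_tendstoD(1) by blast
  qed
  then obtain d where d: "d > 0" "\<And>u. u \<noteq> x \<Longrightarrow> dist u x < d \<Longrightarrow> h u * h x > 0"
    unfolding eventually_at by blast
  obtain e where e: "e > 0" "\<And>s t. x - e < s \<and> s < x \<and> x < t \<and> t < x + e \<Longrightarrow> h s * h t < 0"
    using assms(2) unfolding changes_sign_at_def by blast
  define r where "r = min d e / 2"
  have r: "0 < r" "r < d" "r < e" using d e by (auto simp: r_def)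
  have "h (x - r) * h (x + r) < 0" using e(2)[of "x - r" "x + r"] r by simp
  moreover have "h (x - r) * h x > 0" "h (x + r) * h x > 0"
    using d(2)[of "x - r"] d(2)[of "x + r"] r by (auto simp: dist_real_def)
  ultimately show False by (smt (verit) zero_less_mult_iff mult_neg_neg mult_pos_pos)
qed

text \<open>As \<open>x\<close> is the only possible zero nearby, the sign is constant on either
  side and one sample point per side decides. Comparing crossings thus becomes comparing signs of
  products.\<close>

lemma changes_sign_at_iff:
  fixes h :: "real \<Rightarrow> real"
  assumes "continuous_on UNIV h" and d: "0 < d"
    and nz: "\<And>u. u \<noteq> x \<Longrightarrow> \<bar>u - x\<bar> < d \<Longrightarrow> h u \<noteq> 0"
    and u: "x - d < s" "s < x" "x < t" "t < x + d"
  shows "changes_sign_at h x \<longleftrightarrow> h s * h t < 0"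
proof -
  have same: "h u * h u' > 0" if "(x - d < u \<and> u < x \<and> x - d < u' \<and> u' < x) \<or>
      (x < u \<and> u < x + d \<and> x < u' \<and> u' < x + d)" for u u'
    by (rule same_sign_if_no_zero[OF assms(1)], rule nz) (use that in auto)
  have swap: "h a * h b < 0" if "h s' * h t' < 0" "h s' * h a > 0" "h t' * h b > 0" for s' t' a b
    using that by (smt (verit) zero_less_mult_iff mult_less_0_iff)
  show ?thesis
  proof
    assume "changes_sign_at h x"
    then obtain e where e: "e > 0" "\<And>s t. x - e < s \<and> s < x \<and> x < t \<and> t < x + e \<Longrightarrow> h s * h t < 0"
      unfolding changes_sign_at_def by blast
    define r where "r = min d e / 2"
    have r: "0 < r" "r < d" "r < e" using d e by (auto simp: r_def)
    have "h (x - r) * h (x + r) < 0" using e(2)[of "x - r" "x + r"] r by simp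
    then show "h s * h t < 0"
      by (rule swap) (use r u same in auto)
  next
    assume "h s * h t < 0"
    then have "h a * h b < 0" if "x - d < a \<and> a < x \<and> x < b \<and> b < x + d" for a b
      by (rule swap) (use u same that in auto)
    then show "changes_sign_at h x" unfolding changes_sign_at_def using d by blast
  qed
qed

lemma finite_zeros_isolated:
  fixes h :: "real \<Rightarrow> real"
  assumes "\<And>a b. finite {t \<in> {a..b}. h t = 0}"
  obtains d where "d > 0" "\<And>u. u \<noteq> x \<Longrightarrow> \<bar>u - x\<bar> < d \<Longrightarrow> h u \<noteq> 0"
proof -
  obtain d where d: "d > 0" "\<forall>t\<in>{t \<in> {x - 1..x + 1}. h t = 0}. t \<noteq> x \<longrightarrow> d \<le> dist x t"
    using finite_set_avoid[OF assms] by blast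
  show ?thesis
  proof (rule that[of "min d 1"])
    show "min d 1 > 0" using d by simp
    fix u assume "u \<noteq> x" "\<bar>u - x\<bar> < min d 1"
    then show "h u \<noteq> 0" using d(2)[rule_format, of u] by (auto simp: dist_real_def abs_if split: if_splits)
  qed
qed

text \<open>A zero given by the intermediate value theorem might be a mere touching. The supremum
  \<open>c\<close> of the points where the function is positive (after normalising to a positive
  value at \<open>a\<close>) is a genuine change: zeros being isolated, the function is negative
  just after \<open>c\<close>, and there are positive values arbitrarily close to \<open>c\<close>
  from the left.\<close>

lemma sign_change_between:
  fixes h :: "real \<Rightarrow> real"
  assumes cont: "continuous_on UNIV h" and fin: "\<And>a b. finite {t \<in> {a..b}. h t = 0}"
    and ab: "a < b" "h a * h b < 0"
  obtains c where "a < c" "c < b" "changes_sign_at h c"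
proof -
  have main: "\<exists>c>a. c < b \<and> changes_sign_at h c"
    if cont: "continuous_on UNIV h" and fin: "\<And>a b. finite {t \<in> {a..b}. h t = 0}"
      and pos: "h a > 0" and neg: "h b < 0" for h :: "real \<Rightarrow> real"
  proof -
    define T where "T = {t \<in> {a..b}. h t > 0}"
    define c where "c = Sup T"
    have bdd: "bdd_above T" by (auto simp: T_def intro: bdd_aboveI[of _ b])
    have aT: "a \<in> T" using pos ab by (auto simp: T_def)
    have ac: "a \<le> c" unfolding c_def using aT bdd by (rule cSup_upper)
    have cb: "c \<le> b" unfolding c_def using aT by (intro cSup_least) (auto simp: T_def)
    have after: "h t \<le> 0" if "c < t" "t \<le> b" for t
    proof (rule ccontr)
      assume "\<not> h t \<le> 0"
      then have "t \<in> T" using that ac by (auto simp: T_def)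
      then show False using cSup_upper[OF _ bdd, of t] that by (simp add: c_def)
    qed
    obtain d where d: "d > 0" "\<And>u. u \<noteq> c \<Longrightarrow> \<bar>u - c\<bar> < d \<Longrightarrow> h u \<noteq> 0"
      using finite_zeros_isolated[OF fin] by blast
    have "\<exists>s\<in>T. c - d < s"
      using less_cSup_iff[of T "c - d"] aT bdd d(1) unfolding c_def by auto
    then obtain s where s: "s \<in> T" "c - d < s" by blast
    have sc: "s \<le> c" unfolding c_def using s bdd by (intro cSup_upper)
    have hs: "h s > 0" using s by (simp add: T_def)
    define t where "t = c + min d (b - c) / 2"
    have near: "h s * h c > 0" if "h c \<noteq> 0"
    proof (rule same_sign_if_no_zero[OF cont])
      fix t assume "min s c \<le> t" "t \<le> max s c"
      then have "\<bar>t - c\<bar> < d" using s(2) sc d(1) by auto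
      then show "h t \<noteq> 0" using d(2)[of t] that by (cases "t = c") auto
    qed
    have "c < b"
    proof (rule ccontr)
      assume "\<not> c < b"
      then have "c = b" using cb by simp
      then have "h c < 0" using neg by simp
      then show False using near hs by (simp add: zero_less_mult_iff)
    qed
    then have t: "c < t" "t < c + d" "t \<le> b" using d(1) by (auto simp: t_def min_def field_simps)
    have ht: "h t < 0" using after[OF t(1) t(3)] d(2)[of t] t by (simp add: less_le)
    have hc: "h c = 0"
    proof (rule ccontr)
      assume nz: "h c \<noteq> 0"
      have "h c * h t > 0"
      proof (rule same_sign_if_no_zero[OF cont])
        fix t' assume "min c t \<le> t'" "t' \<le> max c t"
        then have "\<bar>t' - c\<bar> < d" using t d(1) by auto
        then show "h t' \<noteq> 0" using d(2)[of t'] nz by (cases "t' = c") auto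
      qed
      then show False using near nz hs ht by (simp add: zero_less_mult_iff)
    qed
    have "s < c" using sc hs hc by (auto simp: less_le)
    have "h s * h t < 0" using hs ht by (simp add: mult_pos_neg)
    then have "changes_sign_at h c"
      using changes_sign_at_iff[OF cont d(1) d(2), where s = s and t = t] s t \<open>s < c\<close> by auto
    moreover have "a < c" using ac hc pos by (auto simp: less_le)
    moreover have "c < b" using cb hc neg by (auto simp: less_le)
    ultimately show ?thesis by blast
  qed
  have "(h a > 0 \<and> h b < 0) \<or> (- h a > 0 \<and> - h b < 0)"
    using ab(2) by (auto simp: mult_less_0_iff)
  then show ?thesis
  proof
    assume "h a > 0 \<and> h b < 0"
    then show ?thesis using main[OF cont fin] that by blast
  next
    assume *: "- h a > 0 \<and> - h b < 0"
    have "\<exists>c>a. c < b \<and> changes_sign_at (\<lambda>t. - h t) c"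
      by (rule main) (use cont fin * in \<open>auto intro: continuous_intros\<close>)
    then show ?thesis using that by (auto simp: changes_sign_at_uminus)
  qed
qed

text \<open>The sign can change only at \<open>c\<close>, so it is constant up to just before
  \<open>c\<close> and from just after \<open>c\<close> on. Whether the end values have opposite
  signs depends on \<open>c\<close> alone.\<close>

lemma unique_sign_change_iff:
  fixes h :: "real \<Rightarrow> real"
  assumes cont: "continuous_on UNIV h" and fin: "\<And>a b. finite {t \<in> {a..b}. h t = 0}"
    and ab: "a < b" "h a \<noteq> 0" "h b \<noteq> 0"
    and c: "\<And>t. a < t \<Longrightarrow> t < b \<Longrightarrow> changes_sign_at h t \<Longrightarrow> t = c"
  shows "h a * h b < 0 \<longleftrightarrow> a < c \<and> c < b \<and> changes_sign_at h c"
proof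
  assume "h a * h b < 0"
  then obtain t where "a < t" "t < b" "changes_sign_at h t"
    using sign_change_between[OF cont fin ab(1)] by blast
  then show "a < c \<and> c < b \<and> changes_sign_at h c" using c by blast
next
  assume *: "a < c \<and> c < b \<and> changes_sign_at h c"
  obtain d where d: "d > 0" "\<And>u. u \<noteq> c \<Longrightarrow> \<bar>u - c\<bar> < d \<Longrightarrow> h u \<noteq> 0"
    using finite_zeros_isolated[OF fin] by blast
  define r where "r = min d (min (c - a) (b - c)) / 2"
  have r: "0 < r" "r < d" "a < c - r" "c + r < b" using d * by (auto simp: r_def min_def field_simps)
  have "h (c - r) * h (c + r) < 0"
    using changes_sign_at_iff[OF cont d(1) d(2), where s = "c - r" and t = "c + r"] r * by auto
  moreover have "h (c - r) \<noteq> 0" "h (c + r) \<noteq> 0" using d(2) r by auto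
  moreover have "\<not> h a * h (c - r) < 0"
  proof
    assume "h a * h (c - r) < 0"
    then obtain t where "a < t" "t < c - r" "changes_sign_at h t"
      using sign_change_between[OF cont fin, of a "c - r"] r by blast
    then show False using c[of t] r * by simp
  qed
  moreover have "\<not> h (c + r) * h b < 0"
  proof
    assume "h (c + r) * h b < 0"
    then obtain t where "c + r < t" "t < b" "changes_sign_at h t"
      using sign_change_between[OF cont fin, of "c + r" b] r by blast
    then show False using c[of t] r * by simp
  qed
  ultimately show "h a * h b < 0" using ab(2,3) by (auto simp: mult_less_0_iff)
qed

section \<open>Curves of one arrangement: crossings within a period, isolated meetings\<close>

context
  fixes A :: "(real \<Rightarrow> real) set"
  assumes A: "fun_arrangement A"
begin

lemma arr_antiperiodic: "f \<in> A \<Longrightarrow> antiperiodic f"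
  using A by (simp add: fun_arrangement_def)

lemma arr_continuous: "f \<in> A \<Longrightarrow> continuous_on UNIV f"
  using arr_antiperiodic by (simp add: antiperiodic_def)

lemma arr_continuous_diff: "f \<in> A \<Longrightarrow> g \<in> A \<Longrightarrow> continuous_on UNIV (\<lambda>t. f t - g t)"
  by (intro continuous_intros arr_continuous)

lemma arr_finite: "finite A"
  using A by (simp add: fun_arrangement_def)

lemma arr_finite_meet: "f \<in> A \<Longrightarrow> g \<in> A \<Longrightarrow> f \<noteq> g \<Longrightarrow> finite {x \<in> {a..b}. f x = g x}"
  using A by (simp add: fun_arrangement_def)

lemma arr_crosses_meet: "f \<in> A \<Longrightarrow> g \<in> A \<Longrightarrow> crosses f g x \<Longrightarrow> f x = g x"
  using changes_sign_at_imp_zero[OF arr_continuous_diff] by fastforce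

lemma arr_crosses_ex: "f \<in> A \<Longrightarrow> g \<in> A \<Longrightarrow> f \<noteq> g \<Longrightarrow> \<exists>x. crosses f g x"
  using A unfolding fun_arrangement_def by blast

lemma arr_crosses_unique:
  assumes "f \<in> A" "g \<in> A" "f \<noteq> g" "crosses f g x" "crosses f g y"
  shows "\<exists>n::int. y = x + of_int n * pi"
proof -
  have "f x = g x" "f y = g y" using arr_crosses_meet assms by blast+
  then show ?thesis using A assms unfolding fun_arrangement_def by simp
qed

lemma arr_no_three:
  assumes "f \<in> A" "g \<in> A" "h \<in> A" "f x = g x" "f x = h x"
  shows "f = g \<or> g = h \<or> f = h"
proof (rule ccontr)
  assume "\<not> ?thesis"
  then have "\<not> (f x = g x \<and> g x = h x)"
    using A assms(1-3) unfolding fun_arrangement_def by simp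
  then show False using assms(4,5) by simp
qed

lemma arr_crosses_in_period:
  assumes "f \<in> A" "g \<in> A" "f \<noteq> g"
  obtains c where "a \<le> c" "c < a + pi" "crosses f g c"
proof -
  obtain x where x: "crosses f g x" using arr_crosses_ex assms by blast
  obtain n :: int where "a \<le> x + of_int n * pi" "x + of_int n * pi < a + pi"
    by (rule shift_into_period)
  moreover have "crosses f g (x + of_int n * pi)"
    using x crosses_shift[of f g x n] arr_antiperiodic assms by simp
  ultimately show ?thesis using that by blast
qed

lemma arr_crosses_unique_in_period:
  assumes "f \<in> A" "g \<in> A" "f \<noteq> g" "crosses f g x" "crosses f g y" "\<bar>y - x\<bar> < pi"
  shows "x = y"
proof -
  obtain n :: int where n: "y = x + of_int n * pi" using arr_crosses_unique assms by blast
  then have "\<bar>real_of_int n\<bar> * pi < 1 * pi" using assms(6) by (simp add: abs_mult)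
  then have "\<bar>real_of_int n\<bar> < 1" using pi_gt_zero mult_less_cancel_right_pos by blast
  then show ?thesis using n by simp
qed

lemma arr_distinct_near: "eventually (\<lambda>u. \<forall>f\<in>A. \<forall>g\<in>A. f \<noteq> g \<longrightarrow> f u \<noteq> g u) (at x)"
proof (intro eventually_ball_finite arr_finite ballI)
  fix f g assume fg: "f \<in> A" "g \<in> A"
  show "eventually (\<lambda>u. f \<noteq> g \<longrightarrow> f u \<noteq> g u) (at x)"
  proof (cases "f = g")
    case False
    have "finite {t \<in> {a..b}. f t - g t = 0}" for a b
      using arr_finite_meet[OF fg False] by simp
    then obtain d where "d > 0" "\<And>u. u \<noteq> x \<Longrightarrow> \<bar>u - x\<bar> < d \<Longrightarrow> f u - g u \<noteq> 0"
      using finite_zeros_isolated[of "\<lambda>t. f t - g t" x] by blast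
    then show ?thesis unfolding eventually_at by (intro exI[of _ d]) (auto simp: dist_real_def)
  qed simp
qed

end

section \<open>Two arrangements with the same support\<close>

definition same_cover :: "(real \<Rightarrow> real) set \<Rightarrow> (real \<Rightarrow> real) set \<Rightarrow> bool" where
  "same_cover A B \<longleftrightarrow> (\<forall>x. (\<lambda>f. f x) ` A = (\<lambda>f. f x) ` B)"

lemma same_cover_sym: "same_cover A B \<Longrightarrow> same_cover B A"
  by (simp add: same_cover_def)

lemma separated_near:
  assumes A: "fun_arrangement A" and B: "fun_arrangement B"
  shows "eventually (\<lambda>u. \<forall>f\<in>A. \<forall>g\<in>B. f x \<noteq> g x \<longrightarrow> f u \<noteq> g u) (at x)"
proof (intro eventually_ball_finite arr_finite[OF A] arr_finite[OF B] ballI)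
  fix f g assume fg: "f \<in> A" "g \<in> B"
  show "eventually (\<lambda>u. f x \<noteq> g x \<longrightarrow> f u \<noteq> g u) (at x)"
  proof (cases "f x = g x")
    case False
    have "((\<lambda>u. f u - g u) \<longlongrightarrow> f x - g x) (at x)"
      using arr_continuous[OF A fg(1)] arr_continuous[OF B fg(2)]
      by (intro tendsto_diff) (auto simp: continuous_on_def)
    then have "eventually (\<lambda>u. f u - g u \<noteq> 0) (at x)"
      using False by (intro tendsto_imp_eventually_ne) auto
    then show ?thesis by (rule eventually_mono) simp
  qed simp
qed

text \<open>Curves apart at \<open>x\<close> stay apart nearby, so the curve of \<open>B\<close>
  through the point of \<open>f\<close> at \<open>u\<close> must already meet \<open>f\<close> at
  \<open>x\<close>. There are finitely many curves, hence one radius for all. Which curve of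
  \<open>B\<close> is found may still depend on \<open>u\<close>.\<close>

lemma common_near:
  assumes A: "fun_arrangement A" and B: "fun_arrangement B" and AB: "same_cover A B"
  obtains d where "d > 0"
    "\<And>u f. u \<noteq> x \<Longrightarrow> \<bar>u - x\<bar> < d \<Longrightarrow> f \<in> A \<Longrightarrow> \<exists>g\<in>B. g u = f u \<and> g x = f x"
    "\<And>u f f'. u \<noteq> x \<Longrightarrow> \<bar>u - x\<bar> < d \<Longrightarrow> f \<in> A \<Longrightarrow> f' \<in> A \<Longrightarrow> f \<noteq> f' \<Longrightarrow> f u \<noteq> f' u"
    "\<And>u g g'. u \<noteq> x \<Longrightarrow> \<bar>u - x\<bar> < d \<Longrightarrow> g \<in> B \<Longrightarrow> g' \<in> B \<Longrightarrow> g \<noteq> g' \<Longrightarrow> g u \<noteq> g' u"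
proof -
  define Q where "Q u \<longleftrightarrow> (\<forall>f\<in>A. \<forall>g\<in>B. f x \<noteq> g x \<longrightarrow> f u \<noteq> g u) \<and>
      (\<forall>f\<in>A. \<forall>g\<in>A. f \<noteq> g \<longrightarrow> f u \<noteq> g u) \<and> (\<forall>f\<in>B. \<forall>g\<in>B. f \<noteq> g \<longrightarrow> f u \<noteq> g u)" for u
  have "eventually Q (at x)"
    unfolding Q_def by (intro eventually_conj separated_near arr_distinct_near A B)
  then obtain d where d: "d > 0" "\<And>u. u \<noteq> x \<Longrightarrow> \<bar>u - x\<bar> < d \<Longrightarrow> Q u"
    unfolding eventually_at dist_real_def by blast
  show ?thesis
  proof (rule that[OF d(1)])
    fix u f assume *: "u \<noteq> x" "\<bar>u - x\<bar> < d" "f \<in> A"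
    then have "f u \<in> (\<lambda>g. g u) ` B" using AB unfolding same_cover_def by blast
    then obtain g where g: "g \<in> B" "g u = f u" by auto
    moreover have "g x = f x"
      using d(2)[OF *(1,2)] *(3) g unfolding Q_def by fastforce
    ultimately show "\<exists>g\<in>B. g u = f u \<and> g x = f x" by blast
  next
    fix u f f' assume "u \<noteq> x" "\<bar>u - x\<bar> < d" "f \<in> A" "f' \<in> A" "f \<noteq> f'"
    then show "f u \<noteq> f' u" using d(2)[of u] unfolding Q_def by blast
  next
    fix u f f' assume "u \<noteq> x" "\<bar>u - x\<bar> < d" "f \<in> B" "f' \<in> B" "f \<noteq> f'"
    then show "f u \<noteq> f' u" using d(2)[of u] unfolding Q_def by blast
  qed
qed

text \<open>Two curves of \<open>A\<close> through a point have distinct values nearby, and these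
  values belong to two distinct curves of \<open>B\<close> through the same point. So being a vertex
  is a property of the support.\<close>

lemma vertex_transfer:
  assumes A: "fun_arrangement A" and B: "fun_arrangement B" and AB: "same_cover A B"
    and f: "f \<in> A" "f' \<in> A" "f \<noteq> f'" "f x = f' x" and g: "g \<in> B" "g x = f x"
  shows "\<exists>g'\<in>B. g' \<noteq> g \<and> g' x = g x"
proof -
  obtain d where d: "d > 0"
    "\<And>u f. u \<noteq> x \<Longrightarrow> \<bar>u - x\<bar> < d \<Longrightarrow> f \<in> A \<Longrightarrow> \<exists>g\<in>B. g u = f u \<and> g x = f x"
    "\<And>u f f'. u \<noteq> x \<Longrightarrow> \<bar>u - x\<bar> < d \<Longrightarrow> f \<in> A \<Longrightarrow> f' \<in> A \<Longrightarrow> f \<noteq> f' \<Longrightarrow> f u \<noteq> f' u"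
    "\<And>u g g'. u \<noteq> x \<Longrightarrow> \<bar>u - x\<bar> < d \<Longrightarrow> g \<in> B \<Longrightarrow> g' \<in> B \<Longrightarrow> g \<noteq> g' \<Longrightarrow> g u \<noteq> g' u"
    by (rule common_near[OF A B AB, of x]) blast
  define u where "u = x + d / 2"
  have u: "u \<noteq> x" "\<bar>u - x\<bar> < d" using d(1) by (auto simp: u_def)
  obtain g1 g2 where "g1 \<in> B" "g1 u = f u" "g1 x = f x" "g2 \<in> B" "g2 u = f' u" "g2 x = f' x"
    using d(2)[OF u f(1)] d(2)[OF u f(2)] by blast
  moreover have "f u \<noteq> f' u" using d(3)[OF u] f by blast
  ultimately have "g1 \<noteq> g2" by auto
  then have "g1 \<noteq> g \<or> g2 \<noteq> g" by blast
  then show ?thesis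
    using \<open>g1 \<in> B\<close> \<open>g2 \<in> B\<close> \<open>g1 x = f x\<close> \<open>g2 x = f' x\<close> f(4) g(2) by auto
qed

text \<open>By \<open>vertex_transfer\<close> in the other direction, \<open>g\<close> is the only
  curve of \<open>B\<close> through the point, so it has to carry all nearby points of
  \<open>f\<close>.\<close>

lemma agree_near_nonvertex:
  assumes A: "fun_arrangement A" and B: "fun_arrangement B" and AB: "same_cover A B"
    and f: "f \<in> A" and g: "g \<in> B" and meet: "f x = g x"
    and alone: "\<not> (\<exists>f'\<in>A. f' \<noteq> f \<and> f' x = f x)"
  shows "\<exists>d>0. \<forall>u. \<bar>u - x\<bar> < d \<longrightarrow> f u = g u"
proof -
  obtain d where d: "d > 0"
    "\<And>u f. u \<noteq> x \<Longrightarrow> \<bar>u - x\<bar> < d \<Longrightarrow> f \<in> A \<Longrightarrow> \<exists>g\<in>B. g u = f u \<and> g x = f x"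
    "\<And>u f f'. u \<noteq> x \<Longrightarrow> \<bar>u - x\<bar> < d \<Longrightarrow> f \<in> A \<Longrightarrow> f' \<in> A \<Longrightarrow> f \<noteq> f' \<Longrightarrow> f u \<noteq> f' u"
    "\<And>u g g'. u \<noteq> x \<Longrightarrow> \<bar>u - x\<bar> < d \<Longrightarrow> g \<in> B \<Longrightarrow> g' \<in> B \<Longrightarrow> g \<noteq> g' \<Longrightarrow> g u \<noteq> g' u"
    by (rule common_near[OF A B AB, of x]) blast
  have only: "g' = g" if "g' \<in> B" "g' x = f x" for g'
  proof (rule ccontr)
    assume "g' \<noteq> g"
    then have "\<exists>f'\<in>A. f' \<noteq> f \<and> f' x = f x"
      by (intro vertex_transfer[OF B A same_cover_sym[OF AB] g that(1) _ _ f]) (use that(2) meet in auto)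
    then show False using alone by blast
  qed
  have agree: "f u = g u" if u: "\<bar>u - x\<bar> < d" for u
  proof (cases "u = x")
    case False
    then obtain k where "k \<in> B" "k u = f u" "k x = f x" using d(2)[OF _ u f] by blast
    then show ?thesis using only[of k] by auto
  qed (use meet in simp)
  show ?thesis using d(1) agree by blast
qed

text \<open>At a vertex the pairs \<open>f, f'\<close> and \<open>g, g'\<close> occupy the same two
  branches on either side. Which branch is upper for \<open>f\<close> on one side, together with the
  type of the vertex, decides which it is on the other side; with equal types \<open>f\<close> and
  \<open>g\<close> therefore stay together. Agreement is assumed at some \<open>u\<close> other than
  \<open>x\<close>, because at the vertex itself it carries no information about the
  branches.\<close>

lemma agree_near:
  assumes A: "fun_arrangement A" and B: "fun_arrangement B" and AB: "same_cover A B"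
    and f: "f \<in> A" and g: "g \<in> B"
    and type: "\<And>f' g'. f' \<in> A \<Longrightarrow> g' \<in> B \<Longrightarrow> f' \<noteq> f \<Longrightarrow> g' \<noteq> g \<Longrightarrow> f' x = f x \<Longrightarrow> g' x = g x \<Longrightarrow>
      f x = g x \<Longrightarrow> crosses f f' x \<longleftrightarrow> crosses g g' x"
  obtains d where "d > 0"
    "\<And>u u'. u \<noteq> x \<Longrightarrow> \<bar>u - x\<bar> < d \<Longrightarrow> \<bar>u' - x\<bar> < d \<Longrightarrow> f u = g u \<Longrightarrow> f u' = g u'"
proof (cases "f x = g x")
  case False
  have "eventually (\<lambda>u. f u \<noteq> g u) (at x)"
    using separated_near[OF A B, of x] by (rule eventually_mono) (use f g False in blast)
  then obtain d where "d > 0" "\<And>u. u \<noteq> x \<Longrightarrow> \<bar>u - x\<bar> < d \<Longrightarrow> f u \<noteq> g u"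
    unfolding eventually_at dist_real_def by blast
  then show ?thesis by (intro that[of d]) auto
next
  case True
  obtain d where d: "d > 0"
    "\<And>u f. u \<noteq> x \<Longrightarrow> \<bar>u - x\<bar> < d \<Longrightarrow> f \<in> A \<Longrightarrow> \<exists>g\<in>B. g u = f u \<and> g x = f x"
    "\<And>u f f'. u \<noteq> x \<Longrightarrow> \<bar>u - x\<bar> < d \<Longrightarrow> f \<in> A \<Longrightarrow> f' \<in> A \<Longrightarrow> f \<noteq> f' \<Longrightarrow> f u \<noteq> f' u"
    "\<And>u g g'. u \<noteq> x \<Longrightarrow> \<bar>u - x\<bar> < d \<Longrightarrow> g \<in> B \<Longrightarrow> g' \<in> B \<Longrightarrow> g \<noteq> g' \<Longrightarrow> g u \<noteq> g' u"
    by (rule common_near[OF A B AB, of x]) blast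
  show ?thesis
  proof (cases "\<exists>f'\<in>A. f' \<noteq> f \<and> f' x = f x")
    case False
    then obtain d where d: "d > 0" "\<forall>u. \<bar>u - x\<bar> < d \<longrightarrow> f u = g u"
      using agree_near_nonvertex[OF A B AB f g True] by blast
    show ?thesis by (rule that[OF d(1)]) (use d(2) in blast)
  next
    case True2: True
    then obtain f' where f': "f' \<in> A" "f' \<noteq> f" "f' x = f x" by blast
    have "\<exists>g'\<in>B. g' \<noteq> g \<and> g' x = g x"
      by (rule vertex_transfer[OF A B AB f f'(1) _ _ g]) (use f' True in auto)
    then obtain g' where g': "g' \<in> B" "g' \<noteq> g" "g' x = g x" by blast
    have only: "k = g \<or> k = g'" if "k \<in> B" "k x = f x" for k
    proof -
      have "g x = g' x" "g x = k x" using g'(3) that(2) True by simp_all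
      then show ?thesis using arr_no_three[OF B g g'(1) that(1)] g'(2) by blast
    qed
    have dich: "(f u = g u \<and> f' u = g' u) \<or> (f u = g' u \<and> f' u = g u)" if u: "u \<noteq> x" "\<bar>u - x\<bar> < d" for u
    proof -
      obtain k k' where k: "k \<in> B" "k u = f u" "k x = f x" "k' \<in> B" "k' u = f' u" "k' x = f' x"
        using d(2)[OF u f] d(2)[OF u f'(1)] by blast
      then have "k = g \<or> k = g'" "k' = g \<or> k' = g'" using only[of k] only[of k'] f'(3) by simp_all
      moreover have "k \<noteq> k'" using d(3)[OF u f f'(1)] f'(2) k(2,5) by metis
      ultimately show ?thesis using k(2,5) by metis
    qed
    have nzf: "f u - f' u \<noteq> 0" "g u - g' u \<noteq> 0" if u: "u \<noteq> x" "\<bar>u - x\<bar> < d" for u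
      using d(3)[OF u f f'(1)] d(4)[OF u g g'(1)] f'(2) g'(2) by simp_all
    have contf: "continuous_on UNIV (\<lambda>t. f t - f' t)" "continuous_on UNIV (\<lambda>t. g t - g' t)"
      by (rule arr_continuous_diff[OF A f f'(1)], rule arr_continuous_diff[OF B g g'(1)])
    have ty: "crosses f f' x \<longleftrightarrow> crosses g g' x" by (rule type) (use f' g' True in simp_all)
    have sgn_lt: "(f u - f' u) * (f u' - f' u') < 0 \<longleftrightarrow> (g u - g' u) * (g u' - g' u') < 0"
      if u: "u \<noteq> x" "\<bar>u - x\<bar> < d" "u' \<noteq> x" "\<bar>u' - x\<bar> < d" "u \<le> u'" for u u'
    proof (cases "u < x \<and> x < u'")
      case True
      then show ?thesis
        using changes_sign_at_iff[OF contf(1) d(1) nzf(1), where s = u and t = u']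
          changes_sign_at_iff[OF contf(2) d(1) nzf(2), where s = u and t = u'] ty u by auto
    next
      case False
      have "(f u - f' u) * (f u' - f' u') > 0"
        by (rule same_sign_if_no_zero[OF contf(1)], rule nzf) (use u False in auto)
      moreover have "(g u - g' u) * (g u' - g' u') > 0"
        by (rule same_sign_if_no_zero[OF contf(2)], rule nzf) (use u False in auto)
      ultimately show ?thesis by simp
    qed
    have sgn: "(f u - f' u) * (f u' - f' u') < 0 \<longleftrightarrow> (g u - g' u) * (g u' - g' u') < 0"
      if u: "u \<noteq> x" "\<bar>u - x\<bar> < d" "u' \<noteq> x" "\<bar>u' - x\<bar> < d" for u u'
      using sgn_lt[of u u'] sgn_lt[of u' u] u by (cases "u \<le> u'") (auto simp: mult.commute)
    show ?thesis
    proof (rule that[OF d(1)])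
      fix u u' assume u: "u \<noteq> x" "\<bar>u - x\<bar> < d" "\<bar>u' - x\<bar> < d" "f u = g u"
      show "f u' = g u'"
      proof (cases "u' = x")
        case False
        show ?thesis
        proof (rule ccontr)
          assume ne: "f u' \<noteq> g u'"
          then have 1: "f u' = g' u'" "f' u' = g u'" using dich[OF False u(3)] by auto
          have 2: "f' u = g' u" using dich[OF u(1,2)] u(4) nzf(2)[OF u(1,2)] by auto
          \<comment> \<open>If \<open>f\<close> changed from \<open>g\<close> to \<open>g'\<close>
            between \<open>u\<close> and \<open>u'\<close>, the difference \<open>f - f'\<close>
            would equal \<open>g - g'\<close> at \<open>u\<close> and its negative at
            \<open>u'\<close>, so the two products would have opposite signs.\<close>
          have "f u' - f' u' = - (g u' - g' u')" "f u - f' u = g u - g' u" using 1 2 u(4) by simp_all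
          then have "(g u - g' u) * - (g u' - g' u') < 0 \<longleftrightarrow> (g u - g' u) * (g u' - g' u') < 0"
            using sgn[OF u(1,2) False u(3)] by metis
          then show False using nzf(2)[OF u(1,2)] nzf(2)[OF False u(3)]
            by (auto simp: mult_less_0_iff zero_less_mult_iff)
        qed
      qed (use True in simp)
    qed
  qed
qed

text \<open>Near each point of \<open>U\<close>, agreement at one other point spreads to a whole
  neighbourhood. So no point of \<open>U\<close> lies on the frontier of the interior of the
  agreement set, and connectedness leaves only one possibility. The start must not be a vertex, so
  that agreement there is agreement on a neighbourhood.\<close>

lemma agree_on_connected:
  assumes A: "fun_arrangement A" and B: "fun_arrangement B" and AB: "same_cover A B"
    and f: "f \<in> A" and g: "g \<in> B" and U: "connected U"
    and type: "\<And>x f' g'. x \<in> U \<Longrightarrow> f' \<in> A \<Longrightarrow> g' \<in> B \<Longrightarrow> f' \<noteq> f \<Longrightarrow> g' \<noteq> g \<Longrightarrow> f' x = f x \<Longrightarrow>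
      g' x = g x \<Longrightarrow> f x = g x \<Longrightarrow> crosses f f' x \<longleftrightarrow> crosses g g' x"
    and start: "u0 \<in> U" "f u0 = g u0" "\<And>f'. f' \<in> A \<Longrightarrow> f' u0 = f u0 \<Longrightarrow> f' = f"
    and x: "x \<in> U"
  shows "f x = g x"
proof (rule ccontr)
  assume ne: "f x \<noteq> g x"
  obtain e where e: "e > 0" "\<forall>u. \<bar>u - u0\<bar> < e \<longrightarrow> f u = g u"
    using agree_near_nonvertex[OF A B AB f g start(2)] start(3) by blast
  define Z where "Z = interior {u. f u = g u}"
  have "U \<subseteq> Z \<union> - closure Z"
  proof
    fix y assume y: "y \<in> U"
    obtain d where d: "d > 0"
      "\<And>u u'. u \<noteq> y \<Longrightarrow> \<bar>u - y\<bar> < d \<Longrightarrow> \<bar>u' - y\<bar> < d \<Longrightarrow> f u = g u \<Longrightarrow> f u' = g u'"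
      by (rule agree_near[OF A B AB f g, of y]) (rule type[OF y], assumption+, blast)
    show "y \<in> Z \<union> - closure Z"
    proof (cases "\<exists>u. u \<noteq> y \<and> \<bar>u - y\<bar> < d \<and> f u = g u")
      case True
      then obtain u where u: "u \<noteq> y" "\<bar>u - y\<bar> < d" "f u = g u" by blast
      have "ball y d \<subseteq> {u. f u = g u}"
      proof
        fix u' assume "u' \<in> ball y d"
        then have "\<bar>u' - y\<bar> < d" by (simp add: dist_real_def)
        then show "u' \<in> {u. f u = g u}" using d(2)[OF u(1,2) _ u(3)] by simp
      qed
      then have "y \<in> Z" unfolding Z_def using d(1) by (auto simp: mem_interior)
      then show ?thesis by simp
    next
      case False
      \<comment> \<open>Agreement is excluded only off \<open>y\<close>; a nonempty open set of
        reals is infinite and so contains a point other than \<open>y\<close>.\<close>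
      have "ball y d \<inter> Z = {}"
      proof (rule ccontr)
        assume "ball y d \<inter> Z \<noteq> {}"
        then have "open (ball y d \<inter> Z)" "ball y d \<inter> Z \<noteq> {}" by (auto simp: Z_def)
        then have "infinite (ball y d \<inter> Z)" using finite_imp_not_open by blast
        then obtain u where "u \<in> ball y d \<inter> Z" "u \<noteq> y"
          using finite_subset[of "ball y d \<inter> Z" "{y}"] by blast
        moreover have "u \<in> {u. f u = g u}"
          using calculation interior_subset[of "{u. f u = g u}"] unfolding Z_def by blast
        ultimately show False using False by (auto simp: dist_real_def abs_minus_commute)
      qed
      then have "ball y d \<inter> closure Z = {}" using open_Int_closure_eq_empty[of "ball y d" Z] by simp
      then show ?thesis using d(1) by (metis Compl_iff Int_iff UnI2 centre_in_ball empty_iff)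
    qed
  qed
  moreover have "open Z" "open (- closure Z)" by (auto simp: Z_def)
  moreover have "Z \<inter> - closure Z \<inter> U = {}" using closure_subset[of Z] by blast
  ultimately have "Z \<inter> U = {} \<or> - closure Z \<inter> U = {}" using connectedD[OF U] by blast
  moreover have "ball u0 e \<subseteq> {u. f u = g u}"
  proof
    fix u assume "u \<in> ball u0 e"
    then have "\<bar>u - u0\<bar> < e" by (simp add: dist_real_def)
    then show "u \<in> {u. f u = g u}" using e(2) by simp
  qed
  then have "u0 \<in> Z" unfolding Z_def using e(1) by (auto simp: mem_interior)
  moreover have "x \<notin> Z" using ne interior_subset by (auto simp: Z_def)
  ultimately show False using \<open>U \<subseteq> Z \<union> - closure Z\<close> x start(1) by blast
qed

section \<open>Flips\<close>

lemma int_eq_if_mult_pi_near: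
  fixes j k :: int
  assumes "of_int j * pi < of_int k * pi + pi" "of_int k * pi < of_int j * pi + pi"
  shows "j = k"
proof -
  have "of_int j * pi < of_int (k + 1) * pi" "of_int k * pi < of_int (j + 1) * pi"
    using assms by (simp_all add: distrib_right)
  then have "real_of_int j < of_int (k + 1)" "real_of_int k < of_int (j + 1)"
    using pi_gt_zero mult_less_cancel_right_pos by blast+
  then show ?thesis by linarith
qed

text \<open>The lift to the plane of the part of the strip above \<open>[x0, x1]\<close>. Taking all
  translates is what keeps the exchanged functions antiperiodic.\<close>

definition zone :: "real \<Rightarrow> real \<Rightarrow> real \<Rightarrow> bool" where
  "zone x0 x1 x \<longleftrightarrow> (\<exists>k::int. x0 + of_int k * pi \<le> x \<and> x \<le> x1 + of_int k * pi)"

definition swap_on_zone :: "real \<Rightarrow> real \<Rightarrow> (real \<Rightarrow> real) \<Rightarrow> (real \<Rightarrow> real) \<Rightarrow> real \<Rightarrow> real" where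
  "swap_on_zone x0 x1 f g x = (if zone x0 x1 x then g x else f x)"

definition flip_funs ::
  "(real \<Rightarrow> real) set \<Rightarrow> (real \<Rightarrow> real) \<Rightarrow> (real \<Rightarrow> real) \<Rightarrow> real \<Rightarrow> real \<Rightarrow> (real \<Rightarrow> real) set" where
  "flip_funs A f g x0 x1 = (A - {f, g}) \<union> {swap_on_zone x0 x1 f g, swap_on_zone x0 x1 g f}"

definition contacts :: "(real \<Rightarrow> real) set \<Rightarrow> (real \<times> real) set" where
  "contacts A = {(x, y). \<exists>a\<in>A. \<exists>b\<in>A. a \<noteq> b \<and> a x = y \<and> b x = y \<and> \<not> crosses a b x}"

lemma zone_shift: "zone x0 x1 (x + of_int n * pi) \<longleftrightarrow> zone x0 x1 x"
proof -
  have shift: "zone x0 x1 (x + of_int n * pi)" if z: "zone x0 x1 x" for x and n :: int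
  proof -
    obtain k :: int where "x0 + of_int k * pi \<le> x \<and> x \<le> x1 + of_int k * pi"
      using z unfolding zone_def by blast
    then show ?thesis unfolding zone_def by (intro exI[of _ "k + n"]) (simp add: algebra_simps)
  qed
  show ?thesis
  proof
    assume "zone x0 x1 (x + of_int n * pi)"
    from shift[OF this, of "- n"] show "zone x0 x1 x" by simp
  qed (rule shift)
qed

lemma crosses_local:
  assumes "0 < d" "\<And>u. \<bar>u - x\<bar> < d \<Longrightarrow> f u = f' u" "\<And>u. \<bar>u - x\<bar> < d \<Longrightarrow> g u = g' u"
  shows "crosses f g x \<longleftrightarrow> crosses f' g' x"
  using changes_sign_at_local[OF assms(1), of x "\<lambda>t. f t - g t" "\<lambda>t. f' t - g' t"]
    changes_sign_at_local[OF assms(1), of x "\<lambda>t. f' t - g' t" "\<lambda>t. f t - g t"] assms by auto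

context
  fixes x0 x1 :: real
  assumes x01: "x0 < x1" "x1 < x0 + pi"
begin

lemma zone_period:
  assumes "x0 \<le> x" "x < x0 + pi"
  shows "zone x0 x1 x \<longleftrightarrow> x \<le> x1"
proof
  assume "zone x0 x1 x"
  then obtain k :: int where k: "x0 + of_int k * pi \<le> x" "x \<le> x1 + of_int k * pi"
    unfolding zone_def by blast
  have "k = 0" by (rule int_eq_if_mult_pi_near, unfold of_int_0 mult_zero_left) (use k assms x01 in linarith)+
  then show "x \<le> x1" using k by simp
next
  assume "x \<le> x1"
  then show "zone x0 x1 x" unfolding zone_def using assms by (intro exI[of _ 0]) simp
qed

lemma zone_locally_constant:
  assumes "\<And>n::int. x \<noteq> x0 + of_int n * pi" "\<And>n::int. x \<noteq> x1 + of_int n * pi"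
  shows "\<exists>d>0. \<forall>u. \<bar>u - x\<bar> < d \<longrightarrow> (zone x0 x1 u \<longleftrightarrow> zone x0 x1 x)"
proof -
  obtain n :: int where n: "x0 \<le> x + of_int n * pi" "x + of_int n * pi < x0 + pi"
    by (rule shift_into_period)
  define y where "y = x + of_int n * pi"
  have "x = y + of_int (- n) * pi" by (simp add: y_def)
  then have ne: "y \<noteq> x0" "y \<noteq> x1" using assms(1)[of "- n"] assms(2)[of "- n"] by auto
  then have y: "x0 < y" "y < x0 + pi" using n by (auto simp: y_def)
  define d where "d = min (y - x0) (min (x0 + pi - y) \<bar>y - x1\<bar>)"
  show ?thesis
  proof (intro exI[of _ d] conjI allI impI)
    show "0 < d" using y ne by (simp add: d_def)
    fix u assume "\<bar>u - x\<bar> < d"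
    then have "\<bar>(u + of_int n * pi) - y\<bar> < d" by (simp add: y_def)
    then have "x0 \<le> u + of_int n * pi" "u + of_int n * pi < x0 + pi"
      "u + of_int n * pi \<le> x1 \<longleftrightarrow> y \<le> x1"
      unfolding d_def by (auto simp: abs_if split: if_splits)
    then have "zone x0 x1 (u + of_int n * pi) \<longleftrightarrow> zone x0 x1 y"
      using zone_period y by simp
    then show "zone x0 x1 u \<longleftrightarrow> zone x0 x1 x" by (simp add: y_def zone_shift)
  qed
qed

lemma zone_near_start:
  assumes "\<bar>u - x0\<bar> < min (x1 - x0) (x0 + pi - x1)"
  shows "zone x0 x1 u \<longleftrightarrow> x0 \<le> u"
proof (cases "x0 \<le> u")
  case True
  then show ?thesis using assms zone_period[of u] x01 by auto
next
  case False
  then have "\<not> zone x0 x1 (u + of_int 1 * pi)"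
    using assms zone_period[of "u + pi"] x01 by (auto simp: abs_if split: if_splits)
  then show ?thesis unfolding zone_shift using False by simp
qed

lemma zone_near_end:
  assumes "\<bar>u - x1\<bar> < min (x1 - x0) (x0 + pi - x1)"
  shows "zone x0 x1 u \<longleftrightarrow> u \<le> x1"
  using assms zone_period[of u] by (auto simp: abs_if split: if_splits)

text \<open>Where \<open>f\<close> and \<open>g\<close> agree, both tend to the common value and it
  does not matter which one is chosen; this includes the ends of the zone. Elsewhere the choice is
  locally constant.\<close>

lemma antiperiodic_swap:
  assumes f: "antiperiodic f" and g: "antiperiodic g" and eq: "f x0 = g x0" "f x1 = g x1"
  shows "antiperiodic (swap_on_zone x0 x1 f g)" (is "antiperiodic ?s")
proof -
  have "isCont ?s x" for x
  proof (cases "f x = g x")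
    case True
    have "isCont f x" "isCont g x"
      using f g by (simp_all add: antiperiodic_def continuous_on_eq_continuous_at)
    then have "((\<lambda>u. \<bar>f u - f x\<bar> + \<bar>g u - g x\<bar>) \<longlongrightarrow> \<bar>f x - f x\<bar> + \<bar>g x - g x\<bar>) (at x)"
      unfolding isCont_def by (intro tendsto_intros)
    then have lim: "((\<lambda>u. \<bar>f u - f x\<bar> + \<bar>g u - g x\<bar>) \<longlongrightarrow> 0) (at x)" by simp
    have "((\<lambda>u. ?s u - ?s x) \<longlongrightarrow> 0) (at x)"
    proof (rule Lim_null_comparison[OF _ lim])
      show "eventually (\<lambda>u. norm (?s u - ?s x) \<le> \<bar>f u - f x\<bar> + \<bar>g u - g x\<bar>) (at x)"
        using True by (intro always_eventually) (simp add: swap_on_zone_def)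
    qed
    then show ?thesis unfolding isCont_def by (simp add: LIM_zero_iff)
  next
    case False
    have 1: "x \<noteq> x0 + of_int n * pi" for n using False eq meet_shift[OF f g, of x0 n] by auto
    have 2: "x \<noteq> x1 + of_int n * pi" for n using False eq meet_shift[OF f g, of x1 n] by auto
    obtain d where d: "d > 0" "\<And>u. \<bar>u - x\<bar> < d \<Longrightarrow> zone x0 x1 u \<longleftrightarrow> zone x0 x1 x"
      using zone_locally_constant[OF 1 2] by blast
    define k where "k = (if zone x0 x1 x then g else f)"
    have "isCont f x" "isCont g x"
      using f g by (simp_all add: antiperiodic_def continuous_on_eq_continuous_at)
    then have "isCont k x" by (simp add: k_def)
    moreover have "k u = ?s u" if "\<bar>u - x\<bar> < d" for u
      using d(2)[OF that] by (simp add: k_def swap_on_zone_def)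
    then have "eventually (\<lambda>u. k u = ?s u) (nhds x)"
      unfolding eventually_nhds_metric dist_real_def using d(1) by blast
    ultimately show ?thesis using isCont_cong[of k ?s x] by simp
  qed
  moreover have "?s (x + pi) = - ?s x" for x
    using f g zone_shift[of x0 x1 x 1] by (simp add: swap_on_zone_def antiperiodic_def)
  ultimately show ?thesis by (simp add: antiperiodic_def continuous_on_eq_continuous_at)
qed

context
  fixes A :: "(real \<Rightarrow> real) set" and f g :: "real \<Rightarrow> real"
  assumes A: "fun_arrangement A" and f: "f \<in> A" and g: "g \<in> A" and fg: "f \<noteq> g"
    and eq: "f x0 = g x0" "f x1 = g x1" and cr: "\<not> crosses f g x0" "crosses f g x1"
begin

lemma zone_boundary_meet: "x = x0 + of_int n * pi \<or> x = x1 + of_int n * pi \<Longrightarrow> f x = g x"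
  using eq meet_shift[OF arr_antiperiodic[OF A f] arr_antiperiodic[OF A g]] by auto

lemma antiperiodic_swaps:
  "antiperiodic (swap_on_zone x0 x1 f g)" "antiperiodic (swap_on_zone x0 x1 g f)"
  using antiperiodic_swap arr_antiperiodic[OF A f] arr_antiperiodic[OF A g] eq by auto

lemma third_avoids:
  assumes "k \<in> A" "k \<noteq> f" "k \<noteq> g" "f x = g x"
  shows "f x \<noteq> k x"
  using arr_no_three[OF A f g assms(1) assms(4)] assms fg by blast

text \<open>Away from the ends of the zone this is locality. At the ends \<open>f\<close> and
  \<open>g\<close> meet, so \<open>k\<close> passes through neither and both sides are
  false.\<close>

lemma crosses_swap_iff:
  assumes k: "k \<in> A" "k \<noteq> f" "k \<noteq> g"
  shows "crosses (swap_on_zone x0 x1 f g) k x \<longleftrightarrow> (if zone x0 x1 x then crosses g k x else crosses f k x)"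
    (is "crosses ?s k x \<longleftrightarrow> _")
proof (cases "\<exists>n::int. x = x0 + of_int n * pi \<or> x = x1 + of_int n * pi")
  case True
  then have *: "f x = g x" using zone_boundary_meet by blast
  then have "f x \<noteq> k x" "g x \<noteq> k x" "?s x \<noteq> k x"
    using third_avoids[OF k] by (auto simp: swap_on_zone_def)
  moreover have "continuous_on UNIV (\<lambda>t. ?s t - k t)"
    using antiperiodic_swaps(1) arr_continuous[OF A k(1)]
    by (intro continuous_intros) (auto simp: antiperiodic_def)
  ultimately show ?thesis
    using changes_sign_at_imp_zero[of "\<lambda>t. ?s t - k t" x] arr_crosses_meet[OF A f k(1)]
      arr_crosses_meet[OF A g k(1)] by auto
next
  case False
  then have 1: "x \<noteq> x0 + of_int n * pi" and 2: "x \<noteq> x1 + of_int n * pi" for n by blast+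
  obtain d where d: "d > 0" "\<And>u. \<bar>u - x\<bar> < d \<Longrightarrow> zone x0 x1 u \<longleftrightarrow> zone x0 x1 x"
    using zone_locally_constant[OF 1 2] by blast
  have "?s u = (if zone x0 x1 x then g else f) u" if "\<bar>u - x\<bar> < d" for u
    using d(2)[OF that] by (simp add: swap_on_zone_def)
  then have "crosses ?s k x \<longleftrightarrow> crosses (if zone x0 x1 x then g else f) k x"
    by (rule crosses_local[OF d(1)]) simp_all
  then show ?thesis by auto
qed

text \<open>\<open>f\<close> and \<open>g\<close> have equal values at \<open>x0\<close> and at
  \<open>x1\<close>. So \<open>f - k\<close> changes sign between these abscissae iff
  \<open>g - k\<close> does, and by uniqueness of crossings this tells whether the crossing with
  \<open>k\<close> lies in between.\<close>

lemma third_crosses_same_side: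
  assumes k: "k \<in> A" "k \<noteq> f" "k \<noteq> g"
    and c: "x0 \<le> c" "c < x0 + pi" "crosses f k c" "x0 \<le> c'" "c' < x0 + pi" "crosses g k c'"
  shows "x0 < c \<and> x0 < c' \<and> c \<noteq> x1 \<and> c' \<noteq> x1 \<and> (c < x1 \<longleftrightarrow> c' < x1)"
proof -
  have nz: "f x0 \<noteq> k x0" "f x1 \<noteq> k x1" "g x0 \<noteq> k x0" "g x1 \<noteq> k x1"
    using third_avoids[OF k eq(1)] third_avoids[OF k eq(2)] eq by simp_all
  have m: "f c = k c" "g c' = k c'" using arr_crosses_meet[OF A] f g k c by blast+
  have aux: "(h x0 - k x0) * (h x1 - k x1) < 0 \<longleftrightarrow> x0 < c \<and> c < x1 \<and> crosses h k c"
    if h: "h \<in> A" "h \<noteq> k" "h x0 \<noteq> k x0" "h x1 \<noteq> k x1" "x0 \<le> c" "c < x0 + pi" "crosses h k c" for h c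
  proof (rule unique_sign_change_iff)
    show "continuous_on UNIV (\<lambda>t. h t - k t)" using arr_continuous_diff[OF A h(1) k(1)] .
    show "finite {t \<in> {a..b}. h t - k t = 0}" for a b
      using arr_finite_meet[OF A h(1) k(1) h(2)] by simp
    fix t assume "x0 < t" "t < x1" "crosses h k t"
    then show "t = c" using arr_crosses_unique_in_period[OF A h(1) k(1) h(2), of t c] h x01 by auto
  qed (use h x01 in auto)
  have "x0 < c \<and> c < x1 \<longleftrightarrow> x0 < c' \<and> c' < x1"
    using aux[of f c] aux[of g c'] f g k c nz eq by auto
  moreover have "c \<noteq> x0" "c' \<noteq> x0" "c \<noteq> x1" "c' \<noteq> x1" using m nz by auto
  ultimately show ?thesis using c by auto
qed

lemma swap_crosses_once:
  assumes k: "k \<in> A" "k \<noteq> f" "k \<noteq> g"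
  shows "\<exists>c. crosses (swap_on_zone x0 x1 f g) k c \<and>
    (\<forall>x. crosses (swap_on_zone x0 x1 f g) k x \<longrightarrow> (\<exists>n::int. x = c + of_int n * pi))"
proof -
  obtain c where c: "x0 \<le> c" "c < x0 + pi" "crosses f k c"
    using arr_crosses_in_period[OF A f k(1), of x0] k by blast
  obtain c' where c': "x0 \<le> c'" "c' < x0 + pi" "crosses g k c'"
    using arr_crosses_in_period[OF A g k(1), of x0] k by blast
  have side: "x0 < c" "x0 < c'" "c \<noteq> x1" "c' \<noteq> x1" "c < x1 \<longleftrightarrow> c' < x1"
    using third_crosses_same_side[OF k c c'] by auto
  have z: "zone x0 x1 (c + of_int n * pi) \<longleftrightarrow> c < x1" "zone x0 x1 (c' + of_int n * pi) \<longleftrightarrow> c' < x1" for n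
    using zone_period[OF c(1,2)] zone_period[OF c'(1,2)] side by (auto simp: zone_shift)
  \<comment> \<open>The exchanged function is \<open>g\<close> on the zone and \<open>f\<close> off
    it. Both crossings lie on the same side, so exactly one of them survives: that of
    \<open>g\<close> if they are in the zone, that of \<open>f\<close> otherwise.\<close>
  define e where "e = (if c < x1 then c' else c)"
  show ?thesis
  proof (intro exI[of _ e] conjI allI impI)
    show "crosses (swap_on_zone x0 x1 f g) k e"
      unfolding crosses_swap_iff[OF k] e_def using z[of 0] c c' side by auto
    fix x assume "crosses (swap_on_zone x0 x1 f g) k x"
    then have "if zone x0 x1 x then crosses g k x else crosses f k x"
      unfolding crosses_swap_iff[OF k] .
    then show "\<exists>n::int. x = e + of_int n * pi"
      using arr_crosses_unique[OF A f k(1) _ c(3), of x] arr_crosses_unique[OF A g k(1) _ c'(3), of x]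
        k z side by (auto simp: e_def split: if_splits)
  qed
qed

end

context
  fixes A :: "(real \<Rightarrow> real) set" and f g :: "real \<Rightarrow> real"
  assumes A: "fun_arrangement A" and f: "f \<in> A" and g: "g \<in> A" and fg: "f \<noteq> g"
    and eq: "f x0 = g x0" "f x1 = g x1" and cr: "\<not> crosses f g x0" "crosses f g x1"
begin

text \<open>The exchange reverses the sign of \<open>f - g\<close> on the zone only. This turns the
  contact at \<open>x0\<close> into a crossing and the crossing at \<open>x1\<close> into a contact,
  and preserves the type of every other meeting, up to translates.\<close>

lemma crosses_swaps_iff:
  "crosses (swap_on_zone x0 x1 f g) (swap_on_zone x0 x1 g f) x \<longleftrightarrow> (\<exists>n::int. x = x0 + of_int n * pi)"
  (is "crosses ?f' ?g' x \<longleftrightarrow> _")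
proof -
  note anti = arr_antiperiodic[OF A f] arr_antiperiodic[OF A g]
  note anti' = antiperiodic_swaps[OF A f g fg eq cr]
  define r where "r = min (x1 - x0) (x0 + pi - x1)"
  have r: "r > 0" using x01 by (simp add: r_def)
  have cont: "continuous_on UNIV (\<lambda>t. f t - g t)" using arr_continuous_diff[OF A f g] .
  have cont': "continuous_on UNIV (\<lambda>t. ?f' t - ?g' t)"
    using anti' by (intro continuous_intros) (auto simp: antiperiodic_def)
  \<comment> \<open>An abscissa where exactly one side is in the zone has the sign reversed on one
    side only, which negates the product of the sample values.\<close>
  have toggled: "crosses ?f' ?g' y \<longleftrightarrow> \<not> crosses f g y"
    if z: "(\<forall>u. \<bar>u - y\<bar> < r \<longrightarrow> (zone x0 x1 u \<longleftrightarrow> y \<le> u)) \<or> (\<forall>u. \<bar>u - y\<bar> < r \<longrightarrow> (zone x0 x1 u \<longleftrightarrow> u \<le> y))"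
    for y
  proof -
    have "finite {t \<in> {a..b}. f t - g t = 0}" for a b using arr_finite_meet[OF A f g fg] by simp
    then obtain d where d: "d > 0" "\<And>u. u \<noteq> y \<Longrightarrow> \<bar>u - y\<bar> < d \<Longrightarrow> f u - g u \<noteq> 0"
      using finite_zeros_isolated[of "\<lambda>t. f t - g t" y] by blast
    define e where "e = min d r"
    have e: "e > 0" using d r by (simp add: e_def)
    have nz: "f u - g u \<noteq> 0" if "u \<noteq> y" "\<bar>u - y\<bar> < e" for u using d(2) that by (simp add: e_def)
    have nz': "?f' u - ?g' u \<noteq> 0" if "u \<noteq> y" "\<bar>u - y\<bar> < e" for u
      using nz[OF that] by (simp add: swap_on_zone_def)
    define s t where "s = y - e / 2" and "t = y + e / 2"
    have st: "y - e < s" "s < y" "y < t" "t < y + e" "\<bar>s - y\<bar> < r" "\<bar>t - y\<bar> < r"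
      using e by (auto simp: s_def t_def e_def)
    have "(?f' s - ?g' s) * (?f' t - ?g' t) = - ((f s - g s) * (f t - g t))"
      using z
    proof
      assume "\<forall>u. \<bar>u - y\<bar> < r \<longrightarrow> (zone x0 x1 u \<longleftrightarrow> y \<le> u)"
      then have "\<not> zone x0 x1 s" "zone x0 x1 t" using st by auto
      then show ?thesis by (simp add: swap_on_zone_def algebra_simps)
    next
      assume "\<forall>u. \<bar>u - y\<bar> < r \<longrightarrow> (zone x0 x1 u \<longleftrightarrow> u \<le> y)"
      then have "zone x0 x1 s" "\<not> zone x0 x1 t" using st by auto
      then show ?thesis by (simp add: swap_on_zone_def algebra_simps)
    qed
    moreover have "(f s - g s) * (f t - g t) \<noteq> 0" using nz[of s] nz[of t] st by simp
    ultimately show ?thesis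
      using changes_sign_at_iff[OF cont e nz st(1-4)] changes_sign_at_iff[OF cont' e nz' st(1-4)]
      by auto
  qed
  have start: "crosses ?f' ?g' x0"
    using toggled[of x0] zone_near_start cr(1) by (simp add: r_def)
  have end_: "\<not> crosses ?f' ?g' x1"
    using toggled[of x1] zone_near_end cr(2) by (simp add: r_def)
  show ?thesis
  proof (cases "\<exists>n::int. x = x0 + of_int n * pi \<or> x = x1 + of_int n * pi")
    case True
    then obtain n :: int where "x = x0 + of_int n * pi \<or> x = x1 + of_int n * pi" by blast
    moreover have "x1 + of_int n * pi \<noteq> x0 + of_int m * pi" for m
    proof
      assume *: "x1 + of_int n * pi = x0 + of_int m * pi"
      have "n = m" by (rule int_eq_if_mult_pi_near) (use * x01 in linarith)+
      then show False using * x01 by simp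
    qed
    ultimately show ?thesis
      using start end_ crosses_shift[OF anti', of x0 n] crosses_shift[OF anti', of x1 n] by auto
  next
    case False
    then have 1: "x \<noteq> x0 + of_int n * pi" and 2: "x \<noteq> x1 + of_int n * pi" for n by blast+
    obtain d where d: "d > 0" "\<And>u. \<bar>u - x\<bar> < d \<Longrightarrow> zone x0 x1 u \<longleftrightarrow> zone x0 x1 x"
      using zone_locally_constant[OF 1 2] by blast
    have "?f' u = (if zone x0 x1 x then g else f) u" "?g' u = (if zone x0 x1 x then f else g) u"
      if "\<bar>u - x\<bar> < d" for u using d(2)[OF that] by (simp_all add: swap_on_zone_def)
    then have "crosses ?f' ?g' x \<longleftrightarrow>
        crosses (if zone x0 x1 x then g else f) (if zone x0 x1 x then f else g) x"
      by (rule crosses_local[OF d(1)])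
    then have "crosses ?f' ?g' x \<longleftrightarrow> crosses f g x" using crosses_commute[of f g x] by auto
    moreover have "\<not> crosses f g x" using arr_crosses_unique[OF A f g fg cr(2), of x] 2 by blast
    ultimately show ?thesis using 1 by blast
  qed
qed

text \<open>The facts about a third curve are needed for \<open>f, g\<close> and for
  \<open>g, f\<close>. They were proved in a context that is closed by now, so that both instances
  are available.\<close>

lemma swap_third:
  assumes k: "k \<in> A" "k \<noteq> f" "k \<noteq> g"
    and s: "s \<in> {swap_on_zone x0 x1 f g, swap_on_zone x0 x1 g f}"
  shows "\<exists>c. crosses s k c \<and> (\<forall>x. crosses s k x \<longrightarrow> (\<exists>n::int. x = c + of_int n * pi))"
    and "finite {x \<in> {a..b}. s x = k x}"
proof -
  have cr': "\<not> crosses g f x0" "crosses g f x1" using cr crosses_commute by blast+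
  show "\<exists>c. crosses s k c \<and> (\<forall>x. crosses s k x \<longrightarrow> (\<exists>n::int. x = c + of_int n * pi))"
    using swap_crosses_once[OF A f g fg eq cr k]
      swap_crosses_once[OF A g f fg[symmetric] eq[symmetric] cr' k(1,3,2)] s by auto
  have "{x \<in> {a..b}. s x = k x} \<subseteq> {x \<in> {a..b}. f x = k x} \<union> {x \<in> {a..b}. g x = k x}"
    using s by (auto simp: swap_on_zone_def split: if_splits)
  then show "finite {x \<in> {a..b}. s x = k x}"
    using arr_finite_meet[OF A f k(1), of a b] arr_finite_meet[OF A g k(1), of a b] k finite_subset by blast
qed

lemma fun_arrangement_flip: "fun_arrangement (flip_funs A f g x0 x1)"
proof -
  let ?B = "flip_funs A f g x0 x1"
  let ?f' = "swap_on_zone x0 x1 f g" and ?g' = "swap_on_zone x0 x1 g f"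
  define pair where "pair p q \<longleftrightarrow> (\<forall>a b. finite {x \<in> {a..b}. p x = q x}) \<and>
    (\<exists>x. p x = q x \<and> crosses p q x) \<and>
    (\<forall>x y. p x = q x \<and> crosses p q x \<and> q y = p y \<and> crosses p q y \<longrightarrow> (\<exists>n::int. y = x + of_int n * pi))"
    for p q :: "real \<Rightarrow> real"
  have anti: "antiperiodic p" if "p \<in> ?B" for p
    using that antiperiodic_swaps[OF A f g fg eq cr] arr_antiperiodic[OF A] by (auto simp: flip_funs_def)
  have pairI: "pair p q" if anti_pq: "antiperiodic p" "antiperiodic q"
    and fin: "\<And>a b. finite {x \<in> {a..b}. p x = q x}"
    and once: "\<exists>c. crosses p q c \<and> (\<forall>x. crosses p q x \<longrightarrow> (\<exists>n::int. x = c + of_int n * pi))" for p q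
  proof -
    obtain c where c: "crosses p q c" "\<And>x. crosses p q x \<Longrightarrow> \<exists>n::int. x = c + of_int n * pi"
      using once by blast
    have "continuous_on UNIV (\<lambda>t. p t - q t)"
      using anti_pq by (intro continuous_intros) (auto simp: antiperiodic_def)
    then have "p c = q c" using changes_sign_at_imp_zero[OF _ c(1)] by simp
    moreover have "\<exists>n::int. y = x + of_int n * pi" if xy: "crosses p q x" "crosses p q y" for x y
    proof -
      obtain n m :: int where "x = c + of_int n * pi" "y = c + of_int m * pi"
        using c(2)[OF xy(1)] c(2)[OF xy(2)] by blast
      then show ?thesis by (intro exI[of _ "m - n"]) (simp add: algebra_simps)
    qed
    ultimately show ?thesis unfolding pair_def using fin c(1) by blast
  qed
  have pair_sym: "pair p q" if "pair q p" for p q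
    using that crosses_commute[of p q] unfolding pair_def by (simp add: eq_commute[of "p _"] conj_ac)
  have third: "pair s k" if "k \<in> A" "k \<noteq> f" "k \<noteq> g" "s \<in> {?f', ?g'}" for k s
    by (rule pairI) (use that swap_third anti in \<open>auto simp: flip_funs_def\<close>)
  have swaps: "pair ?f' ?g'"
  proof (rule pairI)
    show "antiperiodic ?f'" "antiperiodic ?g'" by (auto intro!: anti simp: flip_funs_def)
    have "{x \<in> {a..b}. ?f' x = ?g' x} = {x \<in> {a..b}. f x = g x}" for a b
      by (auto simp: swap_on_zone_def)
    then show "finite {x \<in> {a..b}. ?f' x = ?g' x}" for a b using arr_finite_meet[OF A f g fg] by simp
    have "crosses ?f' ?g' (x0 + of_int 0 * pi)" unfolding crosses_swaps_iff by blast
    then show "\<exists>c. crosses ?f' ?g' c \<and> (\<forall>x. crosses ?f' ?g' x \<longrightarrow> (\<exists>n::int. x = c + of_int n * pi))"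
      by (intro exI[of _ x0]) (simp add: crosses_swaps_iff)
  qed
  have old: "pair p q" if "p \<in> A" "q \<in> A" "p \<noteq> q" for p q
    using A that unfolding fun_arrangement_def pair_def by (simp add: eq_commute[of "q _"])
  have pairs: "pair p q" if "p \<in> ?B" "q \<in> ?B" "p \<noteq> q" for p q
  proof -
    have "(p \<in> A \<and> p \<noteq> f \<and> p \<noteq> g) \<or> p \<in> {?f', ?g'}" "(q \<in> A \<and> q \<noteq> f \<and> q \<noteq> g) \<or> q \<in> {?f', ?g'}"
      using that by (auto simp: flip_funs_def)
    then show ?thesis
      using old[of p q] third[of q p] pair_sym[OF third[of p q]] swaps pair_sym[OF swaps] that(3)
      by auto
  qed
  have "finite ?B" using arr_finite[OF A] by (simp add: flip_funs_def)
  moreover have "\<not> (p x = q x \<and> q x = h x)"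
    if pqh: "p \<in> ?B" "q \<in> ?B" "h \<in> ?B" "p \<noteq> q \<and> q \<noteq> h \<and> p \<noteq> h" for p q h x
  proof
    assume *: "p x = q x \<and> q x = h x"
    \<comment> \<open>At the fixed abscissa, \<open>c\<close> sends each new curve to an old one
      with the same value, injectively. Three new curves through a point would thus yield three old
      ones.\<close>
    define c where "c k = (if k = ?f' then (if zone x0 x1 x then g else f)
      else if k = ?g' then (if zone x0 x1 x then f else g) else k)" for k
    have "?f' \<noteq> ?g'"
    proof
      assume "?f' = ?g'"
      then have "f = g" by (metis swap_on_zone_def ext)
      then show False using fg by simp
    qed
    then have "c k \<in> A" "c k x = k x" if "k \<in> ?B" for k
      using that f g by (auto simp: c_def flip_funs_def swap_on_zone_def)
    moreover have "inj_on c ?B"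
      using fg \<open>?f' \<noteq> ?g'\<close> by (auto simp: inj_on_def c_def flip_funs_def)
    ultimately show False
      using arr_no_three[OF A, of "c p" "c q" "c h" x] pqh * by (metis inj_on_def)
  qed
  ultimately show ?thesis
    unfolding fun_arrangement_def using anti pairs unfolding pair_def
    by (simp add: eq_commute)
qed

lemma same_cover_flip: "same_cover A (flip_funs A f g x0 x1)"
  unfolding same_cover_def
proof
  fix x
  let ?f' = "swap_on_zone x0 x1 f g" and ?g' = "swap_on_zone x0 x1 g f"
  have "(\<lambda>h. h x) ` A = (\<lambda>h. h x) ` (A - {f, g}) \<union> {f x, g x}" using f g by auto
  moreover have "{f x, g x} = {?f' x, ?g' x}" by (auto simp: swap_on_zone_def)
  ultimately show "(\<lambda>h. h x) ` A = (\<lambda>h. h x) ` flip_funs A f g x0 x1"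
    by (simp add: flip_funs_def image_Un)
qed

end

end

section \<open>Contact points before and after a flip\<close>

lemma contacts_local:
  assumes B: "fun_arrangement B"
    and loc: "\<And>a. a \<in> B \<Longrightarrow> \<exists>c\<in>A. \<exists>d>0. \<forall>u. \<bar>u - x\<bar> < d \<longrightarrow> a u = c u"
    and c: "(x, y) \<in> contacts B"
  shows "(x, y) \<in> contacts A"
proof -
  obtain a b where ab: "a \<in> B" "b \<in> B" "a \<noteq> b" "a x = y" "b x = y" "\<not> crosses a b x"
    using c by (auto simp: contacts_def)
  obtain p d where p: "p \<in> A" "d > 0" "\<forall>u. \<bar>u - x\<bar> < d \<longrightarrow> a u = p u" using loc[OF ab(1)] by blast
  obtain q e where q: "q \<in> A" "e > 0" "\<forall>u. \<bar>u - x\<bar> < e \<longrightarrow> b u = q u" using loc[OF ab(2)] by blast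
  define r where "r = min d e"
  have r: "r > 0" "\<And>u. \<bar>u - x\<bar> < r \<Longrightarrow> a u = p u" "\<And>u. \<bar>u - x\<bar> < r \<Longrightarrow> b u = q u"
    using p q by (auto simp: r_def)
  have "crosses a b x \<longleftrightarrow> crosses p q x" by (rule crosses_local[OF r])
  \<comment> \<open>Curves represented locally by the same function would coincide on an interval,
    against the finiteness of their meetings.\<close>
  moreover have "p \<noteq> q"
  proof
    assume "p = q"
    then have eq: "a u = b u" if "\<bar>u - x\<bar> < r" for u using r that by simp
    have "{x - r / 2..x + r / 2} \<subseteq> {u \<in> {x - r / 2..x + r / 2}. a u = b u}"
      using eq r(1) by (auto simp: abs_le_iff field_simps)
    then have "finite {x - r / 2..x + r / 2}"
      using arr_finite_meet[OF B ab(1-3)] finite_subset by blast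
    then show False using r(1) infinite_Icc[of "x - r / 2" "x + r / 2"] by simp
  qed
  ultimately show ?thesis
    using ab p q r(2)[of x] r(3)[of x] r(1) by (auto simp: contacts_def)
qed

text \<open>No third curve passes through the point, so its type is that of the one pair meeting
  there. This makes crossing or contact a property of the vertex, which can be compared between
  arrangements.\<close>

lemma contacts_pair_iff:
  assumes A: "fun_arrangement A" and "f \<in> A" "g \<in> A" "f \<noteq> g" "f x = g x"
  shows "(x, f x) \<in> contacts A \<longleftrightarrow> \<not> crosses f g x"
proof
  assume "(x, f x) \<in> contacts A"
  then obtain a b where ab: "a \<in> A" "b \<in> A" "a \<noteq> b" "a x = f x" "b x = f x" "\<not> crosses a b x"
    by (auto simp: contacts_def)
  then have "a = f \<or> a = g" "b = f \<or> b = g"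
    using arr_no_three[OF A assms(2,3) ab(1) assms(5)] arr_no_three[OF A assms(2,3) ab(2) assms(5)] assms(4)
    by auto
  then show "\<not> crosses f g x" using ab crosses_commute[of f g x] by auto
qed (use assms in \<open>auto simp: contacts_def\<close>)

text \<open>Off the ends of the zone both families have the same local curves. Above an end, points
  not on \<open>f\<close> see only unchanged curves, and the point on \<open>f\<close> is the
  meeting of the two exchanged curves.\<close>

lemma contacts_flip:
  assumes x01: "x0 < x1" "x1 < x0 + pi"
    and A: "fun_arrangement A" and f: "f \<in> A" and g: "g \<in> A" and fg: "f \<noteq> g"
    and eq: "f x0 = g x0" "f x1 = g x1" and cr: "\<not> crosses f g x0" "crosses f g x1"
  shows "(x, y) \<in> contacts (flip_funs A f g x0 x1) \<longleftrightarrow>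
    ((x, y) \<in> contacts A \<and> \<not> (y = f x \<and> (\<exists>n::int. x = x0 + of_int n * pi))) \<or>
    (y = f x \<and> (\<exists>n::int. x = x1 + of_int n * pi))"
proof -
  let ?B = "flip_funs A f g x0 x1"
  let ?f' = "swap_on_zone x0 x1 f g" and ?g' = "swap_on_zone x0 x1 g f"
  note B = fun_arrangement_flip[OF x01 A f g fg eq cr]
  note crs = crosses_swaps_iff[OF x01 A f g fg eq cr]
  have fin: "?f' \<in> ?B" "?g' \<in> ?B" by (auto simp: flip_funs_def)
  have ne: "?f' \<noteq> ?g'"
  proof
    assume "?f' = ?g'"
    then have "f = g" by (metis swap_on_zone_def ext)
    then show False using fg by simp
  qed
  have disj: "x1 + of_int n * pi \<noteq> x0 + of_int m * pi" for n m :: int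
  proof
    assume *: "x1 + of_int n * pi = x0 + of_int m * pi"
    have "n = m" by (rule int_eq_if_mult_pi_near) (use * x01 in linarith)+
    then show False using * x01 by simp
  qed
  show ?thesis
  proof (cases "\<exists>n::int. x = x0 + of_int n * pi \<or> x = x1 + of_int n * pi")
    case False
    then have 1: "x \<noteq> x0 + of_int n * pi" and 2: "x \<noteq> x1 + of_int n * pi" for n by blast+
    obtain d where d: "d > 0" "\<And>u. \<bar>u - x\<bar> < d \<Longrightarrow> zone x0 x1 u \<longleftrightarrow> zone x0 x1 x"
      using zone_locally_constant[OF x01 1 2] by blast
    have f'u: "?f' u = (if zone x0 x1 x then g else f) u" "?g' u = (if zone x0 x1 x then f else g) u"
      if "\<bar>u - x\<bar> < d" for u using d(2)[OF that] by (auto simp: swap_on_zone_def)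
    have BA: "\<exists>c\<in>A. \<exists>d>0. \<forall>u. \<bar>u - x\<bar> < d \<longrightarrow> a u = c u" if a: "a \<in> ?B" for a
    proof -
      consider "a \<in> A" | "a = ?f'" | "a = ?g'" using a by (auto simp: flip_funs_def)
      then show ?thesis
      proof cases
        case 1 then show ?thesis using d(1) by blast
      next
        case 2 then show ?thesis
          using f'u(1) d(1) f g by (intro bexI[of _ "if zone x0 x1 x then g else f"] exI[of _ d]) auto
      next
        case 3 then show ?thesis
          using f'u(2) d(1) f g by (intro bexI[of _ "if zone x0 x1 x then f else g"] exI[of _ d]) auto
      qed
    qed
    have AB: "\<exists>c\<in>?B. \<exists>d>0. \<forall>u. \<bar>u - x\<bar> < d \<longrightarrow> a u = c u" if a: "a \<in> A" for a
    proof -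
      consider "a \<in> ?B" | "a = f" | "a = g" using a by (auto simp: flip_funs_def)
      then show ?thesis
      proof cases
        case 1 then show ?thesis using d(1) by blast
      next
        case 2 then show ?thesis
          using f'u d(1) fin by (intro bexI[of _ "if zone x0 x1 x then ?g' else ?f'"] exI[of _ d]) auto
      next
        case 3 then show ?thesis
          using f'u d(1) fin by (intro bexI[of _ "if zone x0 x1 x then ?f' else ?g'"] exI[of _ d]) auto
      qed
    qed
    show ?thesis using contacts_local[OF B BA] contacts_local[OF A AB] 1 2 by blast
  next
    case True
    then have fgx: "f x = g x" using zone_boundary_meet[OF x01 A f g fg eq cr] by blast
    then have sw: "?f' x = f x" "?g' x = f x" by (simp_all add: swap_on_zone_def)
    show ?thesis
    proof (cases "y = f x")
      case False
      have inA: "k \<in> A \<and> k \<noteq> f \<and> k \<noteq> g" if "k \<in> ?B" "k x = y" for k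
        using that False sw by (auto simp: flip_funs_def)
      have inB: "k \<in> ?B" if "k \<in> A" "k x = y" for k
        using that False fgx by (auto simp: flip_funs_def)
      have "(x, y) \<in> contacts ?B \<longleftrightarrow> (x, y) \<in> contacts A"
        unfolding contacts_def using inA inB by blast
      then show ?thesis using False by simp
    next
      case y: True
      have "(x, y) \<in> contacts ?B \<longleftrightarrow> \<not> crosses ?f' ?g' x"
        using contacts_pair_iff[OF B fin ne, of x] sw y by simp
      then show ?thesis using crs[of x] True disj y by blast
    qed
  qed
qed

section \<open>Vertices, paths and lifts\<close>

definition verts :: "(real \<Rightarrow> real) set \<Rightarrow> (real \<times> real) set" where
  "verts A = {(x, y). \<exists>a\<in>A. \<exists>b\<in>A. a \<noteq> b \<and> a x = y \<and> b x = y}"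

lemma proj_in_support_iff:
  assumes "fun_arrangement A"
  shows "proj (x, y) \<in> support (line ` A) \<longleftrightarrow> (\<exists>f\<in>A. f x = y)"
  using arr_antiperiodic[OF assms] by (auto simp: support_def proj_in_line_iff)

lemma same_cover_iff:
  assumes A: "fun_arrangement A" and B: "fun_arrangement B"
  shows "support (line ` A) = support (line ` B) \<longleftrightarrow> same_cover A B"
proof
  assume eq: "support (line ` A) = support (line ` B)"
  show "same_cover A B" unfolding same_cover_def
  proof
    fix x
    have "y \<in> (\<lambda>f. f x) ` A \<longleftrightarrow> y \<in> (\<lambda>f. f x) ` B" for y
      using proj_in_support_iff[OF A, of x y] proj_in_support_iff[OF B, of x y] eq
      by (simp add: image_iff eq_commute[of y])
    then show "(\<lambda>f. f x) ` A = (\<lambda>f. f x) ` B" by blast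
  qed
next
  assume AB: "same_cover A B"
  have "proj (x, y) \<in> support (line ` A) \<longleftrightarrow> proj (x, y) \<in> support (line ` B)" for x y
  proof -
    have "y \<in> (\<lambda>f. f x) ` A \<longleftrightarrow> y \<in> (\<lambda>f. f x) ` B" using AB by (simp add: same_cover_def)
    then show ?thesis unfolding proj_in_support_iff[OF A] proj_in_support_iff[OF B] by auto
  qed
  then show "support (line ` A) = support (line ` B)" by (metis proj_cases subsetI subset_antisym)
qed

lemma simple_arrangement_line: "fun_arrangement A \<Longrightarrow> simple_arrangement (line ` A)"
  using simple_arrangement_line_iff[of A] arr_antiperiodic[of A] by blast

lemma verts_subset_if_same_cover:
  assumes A: "fun_arrangement A" and B: "fun_arrangement B" and AB: "same_cover A B"
  shows "verts A \<subseteq> verts B"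
proof
  fix p assume "p \<in> verts A"
  then obtain x y a b where p: "p = (x, y)" and ab: "a \<in> A" "b \<in> A" "a \<noteq> b" "a x = y" "b x = y"
    by (auto simp: verts_def)
  have "a x \<in> (\<lambda>f. f x) ` B" using AB ab(1) unfolding same_cover_def by blast
  then obtain g where g: "g \<in> B" "g x = a x" by auto
  have "\<exists>g'\<in>B. g' \<noteq> g \<and> g' x = g x"
    by (rule vertex_transfer[OF A B AB ab(1-3) _ g]) (use ab in simp)
  then show "p \<in> verts B" using g ab p by (auto simp: verts_def)
qed

text \<open>\<open>vertices\<close> admits any arrangement with the given support as a witness. By
  transfer of vertices the fixed family \<open>A\<close> already sees all of them.\<close>

lemma proj_in_vertices_iff:
  assumes A: "fun_arrangement A"
  shows "proj (x, y) \<in> vertices (support (line ` A)) \<longleftrightarrow> (x, y) \<in> verts A"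
proof
  assume "proj (x, y) \<in> vertices (support (line ` A))"
  then obtain L l m where L: "simple_arrangement L" "support L = support (line ` A)"
    "l \<in> L" "m \<in> L" "l \<noteq> m" "proj (x, y) \<in> l \<inter> m" unfolding vertices_def by blast
  obtain B where B: "L = line ` B" "fun_arrangement B" using simple_arrangement_obtain[OF L(1)] .
  have BA: "same_cover B A" using same_cover_iff[OF B(2) A] L(2) B(1) by simp
  obtain f g where fg: "f \<in> B" "g \<in> B" "l = line f" "m = line g" using L(3,4) B(1) by blast
  have "y = f x" "y = g x" "f \<noteq> g"
    using fg L(5,6) arr_antiperiodic[OF B(2)] by (auto simp: proj_in_line_iff)
  then have "(x, y) \<in> verts B" using fg(1,2) by (auto simp: verts_def)
  then show "(x, y) \<in> verts A" using verts_subset_if_same_cover[OF B(2) A BA] by blast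
next
  assume "(x, y) \<in> verts A"
  then obtain a b where ab: "a \<in> A" "b \<in> A" "a \<noteq> b" "a x = y" "b x = y" by (auto simp: verts_def)
  have "proj (x, y) \<in> line a \<inter> line b" "line a \<noteq> line b"
    using ab arr_antiperiodic[OF A] by (auto simp: proj_in_line_iff line_eq_iff)
  then show "proj (x, y) \<in> vertices (support (line ` A))"
    unfolding vertices_def using simple_arrangement_line[OF A] ab by blast
qed

lemma cover_vertices_eq: "fun_arrangement A \<Longrightarrow> cover_vertices (support (line ` A)) = verts A"
  using proj_in_vertices_iff by (auto simp: cover_vertices_def)

lemma proj_in_contact_set_iff:
  assumes A: "fun_arrangement A"
  shows "proj (x, y) \<in> contact_set (line ` A) \<longleftrightarrow> (x, y) \<in> contacts A"
proof -
  have "proj (x, y) \<in> contact_set (line ` A) \<longleftrightarrow>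
      (\<exists>f\<in>A. \<exists>g\<in>A. line f \<noteq> line g \<and> contact_point (line f) (line g) (proj (x, y)))"
    by (auto simp: contact_set_def)
  also have "\<dots> \<longleftrightarrow> (\<exists>f\<in>A. \<exists>g\<in>A. f \<noteq> g \<and> f x = y \<and> g x = y \<and> \<not> crosses f g x)"
    using arr_antiperiodic[OF A] by (intro bex_cong refl) (auto simp: line_eq_iff contact_point_iff)
  finally show ?thesis by (simp add: contacts_def)
qed

lemma contacts_subset_verts: "contacts A \<subseteq> verts A"
  by (auto simp: contacts_def verts_def)

lemma contact_set_subset_vertices:
  assumes "fun_arrangement A"
  shows "contact_set (line ` A) \<subseteq> vertices (support (line ` A))"
proof
  fix p assume p: "p \<in> contact_set (line ` A)"
  obtain x y where "p = proj (x, y)" by (rule proj_cases)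
  then show "p \<in> vertices (support (line ` A))"
    using p contacts_subset_verts proj_in_contact_set_iff[OF assms] proj_in_vertices_iff[OF assms] by blast
qed

lemma finite_vertices:
  assumes A: "fun_arrangement A"
  shows "finite (vertices (support (line ` A)))"
proof (rule finite_subset)
  show "vertices (support (line ` A)) \<subseteq> (\<Union>a\<in>A. \<Union>b\<in>A - {a}. line a \<inter> line b)"
  proof
    fix p assume p: "p \<in> vertices (support (line ` A))"
    obtain x y where xy: "p = proj (x, y)" by (rule proj_cases)
    then have "(x, y) \<in> verts A" using p proj_in_vertices_iff[OF A] by simp
    then obtain a b where "a \<in> A" "b \<in> A" "a \<noteq> b" "a x = y" "b x = y" by (auto simp: verts_def)
    moreover have "p \<in> line a" "p \<in> line b"
      using xy calculation proj_in_line_iff arr_antiperiodic[OF A] by auto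
    ultimately show "p \<in> (\<Union>a\<in>A. \<Union>b\<in>A - {a}. line a \<inter> line b)" by blast
  qed
  show "finite (\<Union>a\<in>A. \<Union>b\<in>A - {a}. line a \<inter> line b)"
    using arr_finite[OF A] arr_antiperiodic[OF A] arr_finite_meet[OF A]
    by (intro finite_UN_I) (auto simp: finite_meet_iff)
qed

lemma verts_shift:
  assumes A: "fun_arrangement A" and "a \<in> A"
  shows "(x + of_int n * pi, a (x + of_int n * pi)) \<in> verts A \<longleftrightarrow> (x, a x) \<in> verts A"
  unfolding proj_in_vertices_iff[OF A, symmetric] proj_shift[OF arr_antiperiodic[OF A assms(2)]] ..

lemma verts_obtain:
  assumes "p \<in> verts A"
  obtains x a where "p = (x, a x)" "a \<in> A"
  using assms by (auto simp: verts_def)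

lemma path_le_imp_fst_le: "path_le S p q \<Longrightarrow> p = q \<or> fst p < fst q"
  unfolding path_le_def by (induction rule: rtranclp_induct) (auto simp: cover_edge_def)

text \<open>Induction on the number of vertices strictly between: with none, the arc of
  \<open>a\<close> is an edge; otherwise the path is split at one of them.\<close>

lemma path_le_along:
  assumes A: "fun_arrangement A" and a: "a \<in> A" and "x \<le> y"
    and "(x, a x) \<in> verts A" "(y, a y) \<in> verts A"
  shows "path_le (support (line ` A)) (x, a x) (y, a y)"
proof -
  define T where "T x y = {t \<in> {x<..<y}. (t, a t) \<in> verts A}" for x y
  have fin: "finite (T x y)" for x y
  proof (rule finite_subset)
    show "T x y \<subseteq> (\<Union>b\<in>A - {a}. {t \<in> {x..y}. a t = b t})"
    proof
      fix t assume t: "t \<in> T x y"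
      then obtain b c where "b \<in> A" "c \<in> A" "b \<noteq> c" "b t = a t" "c t = a t"
        by (auto simp: T_def verts_def)
      then have "\<exists>b\<in>A - {a}. a t = b t" by (metis DiffI singletonD)
      then show "t \<in> (\<Union>b\<in>A - {a}. {t \<in> {x..y}. a t = b t})" using t by (auto simp: T_def)
    qed
    show "finite (\<Union>b\<in>A - {a}. {t \<in> {x..y}. a t = b t})"
      using arr_finite[OF A] arr_finite_meet[OF A a] by (intro finite_UN_I) auto
  qed
  show ?thesis using assms(3-)
  proof (induction "card (T x y)" arbitrary: x y rule: less_induct)
    case less
    show ?case
    proof (cases "x = y")
      case True
      then show ?thesis by (simp add: path_le_def)
    next
      case False
      then have xy: "x < y" using less.prems by simp
      show ?thesis
      proof (cases "T x y = {}")
        case True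
        have "continuous_on {x..y} a" using arr_continuous[OF A a] continuous_on_subset by blast
        then have "cover_edge (support (line ` A)) (x, a x) (y, a y)"
          unfolding cover_edge_def cover_vertices_eq[OF A] cover_def
          using less.prems xy True a proj_in_support_iff[OF A]
          by (auto simp: T_def intro!: exI[of _ a])
        then show ?thesis by (simp add: path_le_def)
      next
        case False
        then obtain t where t: "t \<in> T x y" by blast
        then have tb: "x < t" "t < y" "(t, a t) \<in> verts A" by (auto simp: T_def)
        have "T x t \<subset> T x y" "T t y \<subset> T x y" using t tb by (auto simp: T_def)
        then have "card (T x t) < card (T x y)" "card (T t y) < card (T x y)"
          using fin psubset_card_mono by blast+
        then have "path_le (support (line ` A)) (x, a x) (t, a t)"
          "path_le (support (line ` A)) (t, a t) (y, a y)"
          using less tb by auto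
        then show ?thesis unfolding path_le_def by (rule rtranclp_trans)
      qed
    qed
  qed
qed

text \<open>Follow \<open>a\<close> to a later meeting with \<open>b\<close>, then continue along
  \<open>b\<close>. Everything is invariant under translation, so the threshold depends only on the
  difference of the two shifts. It is the source of both ends of the search in
  \<open>lift_ex\<close>.\<close>

lemma path_le_reach:
  assumes A: "fun_arrangement A" and a: "a \<in> A" and b: "b \<in> A"
    and xv: "(x, a x) \<in> verts A" and yv: "(y, b y) \<in> verts A"
  shows "\<exists>m::int. \<forall>j k. k - j \<ge> m \<longrightarrow> path_le (support (line ` A))
    (x + of_int j * pi, a (x + of_int j * pi)) (y + of_int k * pi, b (y + of_int k * pi))"
proof -
  have "\<exists>c\<ge>x. (c, a c) \<in> verts A \<and> a c = b c"
  proof (cases "a = b")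
    case True
    then show ?thesis using xv by auto
  next
    case False
    obtain c where c: "x \<le> c" "crosses a b c"
      using arr_crosses_in_period[OF A a b False, of x] by blast
    then have "a c = b c" using arr_crosses_meet[OF A a b] by blast
    moreover have "(c, a c) \<in> verts A" using calculation a b False unfolding verts_def by force
    ultimately show ?thesis using c by blast
  qed
  then obtain c where c: "x \<le> c" "(c, a c) \<in> verts A" "a c = b c" by blast
  \<comment> \<open>The least shift that moves \<open>y\<close> to or beyond the meeting abscissa
    \<open>c\<close>.\<close>
  define m where "m = \<lceil>(c - y) / pi\<rceil>"
  show ?thesis
  proof (intro exI[of _ m] allI impI)
    fix j k :: int assume "m \<le> k - j"
    then have "(c - y) / pi \<le> of_int (k - j)" unfolding m_def by (simp only: ceiling_le_iff)
    then have "c - y \<le> of_int (k - j) * pi" using pi_gt_zero by (simp only: pos_divide_le_eq)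
    then have le: "c + of_int j * pi \<le> y + of_int k * pi" by (simp add: algebra_simps)
    let ?c = "c + of_int j * pi"
    have meet: "a ?c = b ?c"
      using meet_shift[OF arr_antiperiodic[OF A a] arr_antiperiodic[OF A b], of c j] c(3) by simp
    have cv: "(?c, a ?c) \<in> verts A" using verts_shift[OF A a] c(2) by simp
    have "path_le (support (line ` A)) (x + of_int j * pi, a (x + of_int j * pi)) (?c, a ?c)"
      by (rule path_le_along[OF A a]) (use c verts_shift[OF A a] xv in simp_all)
    moreover have "path_le (support (line ` A)) (?c, b ?c) (y + of_int k * pi, b (y + of_int k * pi))"
      by (rule path_le_along[OF A b le]) (use cv meet verts_shift[OF A b] yv in simp_all)
    ultimately show "path_le (support (line ` A))
      (x + of_int j * pi, a (x + of_int j * pi)) (y + of_int k * pi, b (y + of_int k * pi))"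
      unfolding path_le_def meet by (rule rtranclp_trans)
  qed
qed

section \<open>Lifts of vertices with respect to a cut\<close>

locale cut =
  fixes A :: "(real \<Rightarrow> real) set" and S :: "moebius set" and F :: "(real \<times> real) set"
  assumes A: "fun_arrangement A" and S: "S = support (line ` A)" and F: "cut_filter S F"
begin

lemma F_verts: "p \<in> F \<Longrightarrow> p \<in> verts A"
  using F unfolding cut_filter_def S cover_vertices_eq[OF A] by blast

lemma F_up: "p \<in> F \<Longrightarrow> q \<in> verts A \<Longrightarrow> path_le S p q \<Longrightarrow> q \<in> F"
  using F unfolding cut_filter_def S cover_vertices_eq[OF A] by blast

lemma F_up_along: "(x, a x) \<in> F \<Longrightarrow> a \<in> A \<Longrightarrow> x \<le> y \<Longrightarrow> (y, a y) \<in> verts A \<Longrightarrow> (y, a y) \<in> F"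
  using F_up path_le_along[OF A, of a x y] F_verts unfolding S by blast

lemma in_tau_image_iff:
  assumes "a \<in> A"
  shows "(x, a x) \<in> tau ` F \<longleftrightarrow> (x - pi, a (x - pi)) \<in> F"
proof -
  have e: "a (x - pi) = - a x"
    using antiperiodic_shift[OF arr_antiperiodic[OF A assms], of x "-1"] by simp
  have "(x, a x) = tau p \<longleftrightarrow> p = (x - pi, a (x - pi))" for p
    unfolding e by (cases p) (auto simp: tau_def)
  then show ?thesis unfolding image_iff by simp
qed

lemma lift_ex:
  assumes a: "a \<in> A" and v: "(x, a x) \<in> verts A"
  shows "\<exists>n::int. (x + of_int n * pi, a (x + of_int n * pi)) \<in> F - tau ` F"
proof -
  define P where "P n \<longleftrightarrow> (x + of_int n * pi, a (x + of_int n * pi)) \<in> F" for n :: int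
  have vs: "(x + of_int n * pi, a (x + of_int n * pi)) \<in> verts A" for n
    using verts_shift[OF A a] v by simp
  obtain p where p: "p \<in> F" using F by (auto simp: cut_filter_def)
  obtain y b where yb: "p = (y, b y)" "b \<in> A" using verts_obtain[OF F_verts[OF p]] .
  have pv: "(y, b y) \<in> verts A" using F_verts[OF p] yb by simp
  obtain m :: int where "\<forall>j k. k - j \<ge> m \<longrightarrow> path_le S
      (y + of_int j * pi, b (y + of_int j * pi)) (x + of_int k * pi, a (x + of_int k * pi))"
    using path_le_reach[OF A yb(2) a pv v] unfolding S by blast
  from this[rule_format, where j = 0 and k = m] have m: "path_le S (y + of_int 0 * pi, b (y + of_int 0 * pi))
      (x + of_int m * pi, a (x + of_int m * pi))" by simp
  have "P m" unfolding P_def using F_up[OF p vs] m yb(1) by simp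
  obtain q where q: "q \<in> verts A" "q \<notin> F"
    using F unfolding cut_filter_def S cover_vertices_eq[OF A] by blast
  obtain z c where zc: "q = (z, c z)" "c \<in> A" using verts_obtain[OF q(1)] .
  have qv: "(z, c z) \<in> verts A" using q zc by simp
  obtain k :: int where "\<forall>j l. l - j \<ge> k \<longrightarrow> path_le S
      (x + of_int j * pi, a (x + of_int j * pi)) (z + of_int l * pi, c (z + of_int l * pi))"
    using path_le_reach[OF A a zc(2) v qv] unfolding S by blast
  from this[rule_format, where j = "- k" and l = 0]
  have k: "path_le S (x + of_int (- k) * pi, a (x + of_int (- k) * pi)) (z, c z)" by simp
  have "\<not> P (- k)" using F_up[OF _ qv k] q(2) zc(1) unfolding P_def by blast
  have up: "P n \<Longrightarrow> P (n + int i)" for n i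
    unfolding P_def by (erule F_up_along[OF _ a _ vs]) (simp add: distrib_right)
  \<comment> \<open>Descending from \<open>m\<close>, where \<open>P\<close> holds, a failure must
    occur: otherwise upward closure would give \<open>P\<close> at \<open>- k\<close> too.\<close>
  have "\<not> P (m - int 0) \<or> (\<exists>i. P (m - int i) \<and> \<not> P (m - int (Suc i)))"
  proof (rule ccontr)
    assume "\<not> ?thesis"
    then have all: "P (m - int i)" for i by (induction i) auto
    have "P (- k)"
    proof (cases "- k \<le> m")
      case True
      then show ?thesis using all[of "nat (m + k)"] by simp
    next
      case False
      then show ?thesis using up[OF all[of 0], of "nat (- k - m)"] by simp
    qed
    then show False using \<open>\<not> P (- k)\<close> by simp
  qed
  then obtain i where i: "P (m - int i)" "\<not> P (m - int (Suc i))" using \<open>P m\<close> by auto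
  have e: "x + of_int (m - int i) * pi - pi = x + of_int (m - int (Suc i)) * pi"
    by (simp add: algebra_simps)
  show ?thesis
    using i in_tau_image_iff[OF a, of "x + of_int (m - int i) * pi"] unfolding P_def e by blast
qed

text \<open>A lift at least \<open>pi\<close> after a vertex of \<open>F\<close> on the same curve
  would have its predecessor under \<open>tau\<close> in \<open>F\<close>. So the lifts on one curve
  span less than a period; this is where the bound on the zone of a flip comes from.\<close>

lemma window:
  assumes "a \<in> A" "(x, a x) \<in> F" "(y, a y) \<in> F - tau ` F"
  shows "y < x + pi"
proof (rule ccontr)
  assume "\<not> y < x + pi"
  then have "x \<le> y - pi" by simp
  moreover have "(y - pi, a (y - pi)) \<in> verts A"
    using verts_shift[OF A assms(1), of y "-1"] F_verts assms(3) by auto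
  ultimately have "(y - pi, a (y - pi)) \<in> F" using F_up_along assms by blast
  then show False using in_tau_image_iff assms by blast
qed

lemma between:
  assumes "a \<in> A" "(x, a x) \<in> F" "(y, a y) \<in> F - tau ` F" "x \<le> t" "t \<le> y" "(t, a t) \<in> verts A"
  shows "(t, a t) \<in> F - tau ` F"
proof -
  have "(t, a t) \<in> F" using F_up_along assms by blast
  moreover have "(y - pi, a (y - pi)) \<in> verts A"
    using verts_shift[OF A assms(1), of y "-1"] F_verts assms(3) by auto
  then have "(t - pi, a (t - pi)) \<notin> F"
    using F_up_along[of "t - pi" a "y - pi"] assms in_tau_image_iff by auto
  ultimately show ?thesis using in_tau_image_iff assms(1) by blast
qed

lemma lift_unique:
  assumes p: "p \<in> F - tau ` F" and q: "q \<in> F - tau ` F" and eq: "proj p = proj q"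
  shows "p = q"
proof -
  obtain x a where xa: "p = (x, a x)" "a \<in> A" using verts_obtain[OF F_verts] p by blast
  obtain y z where yz: "q = (y, z)" by (cases q)
  obtain n :: int where n: "y = x + of_int n * pi" "z = a y"
    using eq proj_graph_eq_iff[OF arr_antiperiodic[OF A xa(2)]] xa yz by auto
  have "y < x + pi" "x < y + pi" using window[OF xa(2)] p q xa yz n(2) by blast+
  then have "n = 0" using int_eq_if_mult_pi_near[of n 0] n(1) by simp
  then show ?thesis using n xa yz by simp
qed

lemma lift_pt_eq: "p \<in> F - tau ` F \<Longrightarrow> lift_pt F (proj p) = p"
  unfolding lift_pt_def by (rule the_equality) (use lift_unique in auto)

lemma lift_pt_obtain:
  assumes "v \<in> vertices S"
  shows "lift_pt F v \<in> F - tau ` F" "proj (lift_pt F v) = v"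
proof -
  obtain x y where v: "v = proj (x, y)" by (rule proj_cases)
  then have xy: "(x, y) \<in> verts A" using assms proj_in_vertices_iff[OF A] S by simp
  then obtain a where a: "a \<in> A" "y = a x" by (auto simp: verts_def)
  obtain n :: int where n: "(x + of_int n * pi, a (x + of_int n * pi)) \<in> F - tau ` F"
    using lift_ex a xy by blast
  have "proj (x + of_int n * pi, a (x + of_int n * pi)) = v"
    using proj_shift[OF arr_antiperiodic[OF A a(1)]] v a by simp
  then show "lift_pt F v \<in> F - tau ` F" "proj (lift_pt F v) = v" using lift_pt_eq[OF n] n by auto
qed

text \<open>On a common curve the path order is total, because one can move along the curve, and
  every path increases the abscissa.\<close>

lemma cut_less_iff:
  assumes a: "a \<in> A" and x: "(x, a x) \<in> F - tau ` F" and y: "(y, a y) \<in> F - tau ` F"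
  shows "cut_less S F (proj (x, a x)) (proj (y, a y)) \<longleftrightarrow> x < y"
proof -
  have "cut_less S F (proj (x, a x)) (proj (y, a y)) \<longleftrightarrow> path_le S (x, a x) (y, a y) \<and> x \<noteq> y"
    unfolding cut_less_def cut_le_def lift_pt_eq[OF x] lift_pt_eq[OF y]
    using lift_unique[OF x y] by auto
  also have "\<dots> \<longleftrightarrow> x < y"
    using path_le_imp_fst_le[of S "(x, a x)" "(y, a y)"] path_le_along[OF A a, of x y] F_verts x y S
    by auto
  finally show ?thesis .
qed

section \<open>Sweeping a minimal vertex\<close>

context
  fixes v assumes v: "minimal_vertex S F v"
begin

lemma minimal_in_vertices: "v \<in> vertices S"
  using v by (simp add: minimal_vertex_def)

lemmas swept = lift_pt_obtain[OF minimal_in_vertices]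

text \<open>Minimality of \<open>v\<close> compares only lifts, whereas here \<open>p\<close> is any
  element of \<open>F\<close>. The lift of the same vertex does not come after \<open>p\<close>, so
  it also precedes the lift of \<open>v\<close>; by minimality it is that lift, and \<open>p\<close>
  is squeezed between equal ends.\<close>

lemma swept_least:
  assumes "p \<in> F" "path_le S p (lift_pt F v)"
  shows "p = lift_pt F v"
proof -
  obtain x a where xa: "p = (x, a x)" "a \<in> A" using verts_obtain[OF F_verts[OF assms(1)]] .
  have pv: "(x, a x) \<in> verts A" using F_verts assms(1) xa by blast
  obtain n :: int where n: "(x + of_int n * pi, a (x + of_int n * pi)) \<in> F - tau ` F" (is "?q \<in> _")
    using lift_ex[OF xa(2) pv] by blast
  \<comment> \<open>A positive shift would put the lift at least \<open>pi\<close> beyond a point of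
    \<open>F\<close> on its curve.\<close>
  have le: "x + of_int n * pi \<le> x"
  proof (rule ccontr)
    assume "\<not> x + of_int n * pi \<le> x"
    then have "0 < of_int n * pi" by simp
    then have "n > 0" using pi_gt_zero by (auto simp: zero_less_mult_iff)
    then have "1 * pi \<le> of_int n * pi" by (intro mult_right_mono) auto
    then show False using window[OF xa(2), of x "x + of_int n * pi"] assms(1) xa n by simp
  qed
  have qv: "?q \<in> verts A" using F_verts n by blast
  have "path_le S ?q p" using path_le_along[OF A xa(2) le qv pv] S xa by simp
  then have path: "path_le S ?q (lift_pt F v)"
    using assms(2) unfolding path_le_def by (rule rtranclp_trans)
  have "proj ?q \<in> vertices S" using proj_in_vertices_iff[OF A] qv S by simp
  then have "\<not> cut_less S F (proj ?q) v" using v by (auto simp: minimal_vertex_def)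
  then have "proj ?q = v" unfolding cut_less_def cut_le_def lift_pt_eq[OF n] using path by blast
  then have q: "lift_pt F v = ?q" using lift_pt_eq[OF n] by simp
  have "fst (lift_pt F v) \<le> fst p" using le unfolding q xa(1) by simp
  then show ?thesis using path_le_imp_fst_le[OF assms(2)] by auto
qed

lemma tau_swept: "tau (lift_pt F v) \<in> F" "tau (lift_pt F v) \<noteq> lift_pt F v"
proof -
  obtain x a where xa: "lift_pt F v = (x, a x)" "a \<in> A" using verts_obtain[OF F_verts] swept(1) by blast
  have xF: "(x, a x) \<in> F" using swept(1) xa(1) by simp
  have "(x + of_int 1 * pi, a (x + of_int 1 * pi)) \<in> verts A"
    using verts_shift[OF A xa(2), of x 1] F_verts[OF xF] by blast
  then have "(x + of_int 1 * pi, a (x + of_int 1 * pi)) \<in> F"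
    by (rule F_up_along[OF xF xa(2), rotated]) simp
  moreover have "tau (lift_pt F v) = (x + of_int 1 * pi, a (x + of_int 1 * pi))"
    using antiperiodic_shift[OF arr_antiperiodic[OF A xa(2)], of x 1] xa(1) by (simp add: tau_def)
  ultimately show "tau (lift_pt F v) \<in> F" by simp
  show "tau (lift_pt F v) \<noteq> lift_pt F v" by (simp add: tau_def prod_eq_iff)
qed

lemma sweep_cut_filter: "cut_filter S (F - {lift_pt F v})"
proof -
  have "F - {lift_pt F v} \<noteq> {}" using tau_swept by blast
  moreover have "F - {lift_pt F v} \<subset> verts A"
    using F_verts swept(1) by blast
  moreover have "q \<in> F - {lift_pt F v}"
    if "p \<in> F - {lift_pt F v}" "q \<in> verts A" "path_le S p q" for p q
    using F_up[of p q] swept_least[of p] that by blast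
  ultimately show ?thesis unfolding cut_filter_def S cover_vertices_eq[OF A] by blast
qed

lemma sweep_lifts:
  "(F - {lift_pt F v}) - tau ` (F - {lift_pt F v}) =
    ((F - tau ` F) - {lift_pt F v}) \<union> {tau (lift_pt F v)}"
proof -
  have "tau ` (F - {lift_pt F v}) = tau ` F - {tau (lift_pt F v)}"
    by (simp add: image_set_diff[OF inj_tau])
  then show ?thesis using tau_swept swept(1) by blast
qed

end

end

section \<open>Sources of the flip graph\<close>

text \<open>Above a generic abscissa the curves are separated, so each curve of \<open>A\<close>
  starts together with one of \<open>B\<close>. Equal contacts mean equal types at all vertices, and
  the two never separate.\<close>

lemma contacts_determine_arrangement:
  assumes A: "fun_arrangement A" and B: "fun_arrangement B" and AB: "same_cover A B"
    and eq: "contacts A = contacts B"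
  shows "A = B"
proof -
  have sub: "A \<subseteq> B" if A: "fun_arrangement A" and B: "fun_arrangement B" and AB: "same_cover A B"
    and eq: "contacts A = contacts B" for A B
  proof
    fix f assume f: "f \<in> A"
    obtain u :: real where u: "\<forall>f\<in>A. \<forall>g\<in>A. f \<noteq> g \<longrightarrow> f u \<noteq> g u"
      using eventually_happens'[OF at_neq_bot arr_distinct_near[OF A, of 0]] by blast
    have "f u \<in> (\<lambda>f. f u) ` B" using AB f unfolding same_cover_def by blast
    then obtain g where g: "g \<in> B" "f u = g u" by auto
    have "f x = g x" for x
    proof (rule agree_on_connected[OF A B AB f g(1) connected_UNIV _ _ g(2)])
      fix x f' g' assume *: "f' \<in> A" "g' \<in> B" "f' \<noteq> f" "g' \<noteq> g" "f' x = f x" "g' x = g x" "f x = g x"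
      show "crosses f f' x \<longleftrightarrow> crosses g g' x"
        using contacts_pair_iff[OF A f *(1), of x] contacts_pair_iff[OF B g(1) *(2), of x] * eq by auto
    next
      fix f' assume "f' \<in> A" "f' u = f u"
      then show "f' = f" using u f by blast
    qed auto
    then have "f = g" by blast
    then show "f \<in> B" using g by simp
  qed
  show ?thesis using sub[OF A B AB eq] sub[OF B A same_cover_sym[OF AB] eq[symmetric]] by blast
qed

lemma contact_sets_eq_iff:
  assumes A: "fun_arrangement A" and B: "fun_arrangement B"
  shows "contact_set (line ` A) = contact_set (line ` B) \<longleftrightarrow> contacts A = contacts B"
proof
  assume eq: "contact_set (line ` A) = contact_set (line ` B)"
  have "(x, y) \<in> contacts A \<longleftrightarrow> (x, y) \<in> contacts B" for x y
    unfolding proj_in_contact_set_iff[OF A, symmetric] proj_in_contact_set_iff[OF B, symmetric] eq ..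
  then show "contacts A = contacts B" by auto
next
  assume eq: "contacts A = contacts B"
  have "proj (x, y) \<in> contact_set (line ` A) \<longleftrightarrow> proj (x, y) \<in> contact_set (line ` B)" for x y
    unfolding proj_in_contact_set_iff[OF A] proj_in_contact_set_iff[OF B] eq ..
  then show "contact_set (line ` A) = contact_set (line ` B)" by (metis proj_cases subsetI subset_antisym)
qed

text \<open>The flip is also recorded in reverse, since being a source concerns incoming
  arcs.\<close>

lemma flip_funs_flip:
  assumes x01: "x0 < x1" "x1 < x0 + pi"
    and A: "fun_arrangement A" and f: "f \<in> A" and g: "g \<in> A" and fg: "f \<noteq> g"
    and eq: "f x0 = g x0" "f x1 = g x1" and cr: "\<not> crosses f g x0" "crosses f g x1"
  defines "B \<equiv> flip_funs A f g x0 x1"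
  shows "contact_set (line ` B) = (contact_set (line ` A) - {proj (x0, f x0)}) \<union> {proj (x1, f x1)}"
    and "support (line ` B) = support (line ` A)"
    and "flip (proj (x0, f x0)) (proj (x1, f x1)) (line ` A) (line ` B)"
    and "flip (proj (x1, f x1)) (proj (x0, f x0)) (line ` B) (line ` A)"
proof -
  let ?f' = "swap_on_zone x0 x1 f g" and ?g' = "swap_on_zone x0 x1 g f"
  let ?v = "proj (x0, f x0)" and ?w = "proj (x1, f x1)"
  note fa = arr_antiperiodic[OF A f] and ga = arr_antiperiodic[OF A g]
  have B: "fun_arrangement B" unfolding B_def by (rule fun_arrangement_flip[OF x01 A f g fg eq cr])
  have "proj (x, y) \<in> contact_set (line ` B) \<longleftrightarrow> proj (x, y) \<in> (contact_set (line ` A) - {?v}) \<union> {?w}" for x y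
  proof -
    have v: "proj (x, y) = ?v \<longleftrightarrow> y = f x \<and> (\<exists>n::int. x = x0 + of_int n * pi)"
      using proj_graph_eq_iff[OF fa, of x0 x y] by (auto simp: eq_commute)
    have w: "proj (x, y) = ?w \<longleftrightarrow> y = f x \<and> (\<exists>n::int. x = x1 + of_int n * pi)"
      using proj_graph_eq_iff[OF fa, of x1 x y] by (auto simp: eq_commute)
    show ?thesis
      unfolding Un_iff Diff_iff singleton_iff v w proj_in_contact_set_iff[OF A]
        proj_in_contact_set_iff[OF B] unfolding B_def contacts_flip[OF x01 A f g fg eq cr] ..
  qed
  then show cs: "contact_set (line ` B) = (contact_set (line ` A) - {?v}) \<union> {?w}"
    by (metis proj_cases subsetI subset_antisym)
  have "same_cover A B" unfolding B_def by (rule same_cover_flip[OF x01 A f g fg eq cr])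
  then show supp: "support (line ` B) = support (line ` A)" using same_cover_iff[OF A B] by simp
  have fin: "?f' \<in> B" "?g' \<in> B" by (auto simp: B_def flip_funs_def)
  have ne: "?f' \<noteq> ?g'"
  proof
    assume "?f' = ?g'"
    then have "f = g" by (metis swap_on_zone_def ext)
    then show False using fg by simp
  qed
  have v_in: "?v \<in> contact_set (line ` A)"
    using proj_in_contact_set_iff[OF A] contacts_pair_iff[OF A f g fg eq(1)] cr by simp
  have w_notin: "?w \<notin> contact_set (line ` A)"
    using proj_in_contact_set_iff[OF A] contacts_pair_iff[OF A f g fg eq(2)] cr by simp
  have "contact_point (line f) (line g) ?v" "crossing_point (line f) (line g) ?w" "line f \<noteq> line g"
    using contact_point_iff[OF fa ga] crossing_point_iff[OF fa ga] line_eq_iff[OF fa ga] eq cr fg by auto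
  then show "flip ?v ?w (line ` A) (line ` B)"
    unfolding flip_def using simple_arrangement_line[OF A] simple_arrangement_line[OF B] cs supp f g by blast
  have x1: "x1 \<noteq> x0 + of_int n * pi" for n :: int
  proof
    assume *: "x1 = x0 + of_int n * pi"
    have "n = 0" by (rule int_eq_if_mult_pi_near, unfold of_int_0 mult_zero_left) (use * x01 in linarith)+
    then show False using * x01 by simp
  qed
  note f'a = arr_antiperiodic[OF B fin(1)] and g'a = arr_antiperiodic[OF B fin(2)]
  have "crosses ?f' ?g' x0" "\<not> crosses ?f' ?g' x1"
    using crosses_swaps_iff[OF x01 A f g fg eq cr] x1 by (auto intro: exI[of _ 0])
  moreover have "?f' x0 = f x0" "?g' x0 = f x0" "?f' x1 = f x1" "?g' x1 = f x1"
    using eq by (auto simp: swap_on_zone_def)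
  ultimately have "contact_point (line ?f') (line ?g') ?w" "crossing_point (line ?f') (line ?g') ?v"
    "line ?f' \<noteq> line ?g'"
    using contact_point_iff[OF f'a g'a] crossing_point_iff[OF f'a g'a] line_eq_iff[OF f'a g'a] ne by auto
  moreover have "contact_set (line ` A) = (contact_set (line ` B) - {?w}) \<union> {?v}"
    using cs v_in w_notin by auto
  ultimately show "flip ?w ?v (line ` B) (line ` A)"
    unfolding flip_def using simple_arrangement_line[OF A] simple_arrangement_line[OF B] supp fin by blast
qed

definition greedy_funs :: "(real \<Rightarrow> real) set \<Rightarrow> moebius set \<Rightarrow> (real \<times> real) set \<Rightarrow> bool" where
  "greedy_funs A V F \<longleftrightarrow> (\<forall>f\<in>A. \<forall>g\<in>A. \<forall>x y. f \<noteq> g \<longrightarrow> f x = g x \<longrightarrow> \<not> crosses f g x \<longrightarrow> crosses f g y \<longrightarrow>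
     (x, f x) \<in> F - tau ` F \<longrightarrow> (y, f y) \<in> F - tau ` F \<longrightarrow> proj (x, f x) \<notin> V \<longrightarrow> x < y)"

lemma greedy_funsD:
  "greedy_funs A V F \<Longrightarrow> f \<in> A \<Longrightarrow> g \<in> A \<Longrightarrow> f \<noteq> g \<Longrightarrow> f x = g x \<Longrightarrow> \<not> crosses f g x \<Longrightarrow> crosses f g y \<Longrightarrow>
    (x, f x) \<in> F - tau ` F \<Longrightarrow> (y, f y) \<in> F - tau ` F \<Longrightarrow> proj (x, f x) \<notin> V \<Longrightarrow> x < y"
  unfolding greedy_funs_def by blast

context cut
begin

text \<open>Contact and crossing are moved to their lifts, generally by different translates, along
  the common curve \<open>f\<close>. Their order in the cut is then the order of two
  abscissae.\<close>

lemma flip_obtain: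
  assumes "flip v w (line ` A) L"
  obtains f g x y where "f \<in> A" "g \<in> A" "f \<noteq> g" "f x = g x" "f y = g y" "\<not> crosses f g x" "crosses f g y"
    "(x, f x) \<in> F - tau ` F" "(y, f y) \<in> F - tau ` F" "v = proj (x, f x)" "w = proj (y, f y)"
    "v \<in> contact_set (line ` A)" "w \<notin> contact_set (line ` A)"
proof -
  obtain f g where fg: "f \<in> A" "g \<in> A" "line f \<noteq> line g"
    "contact_point (line f) (line g) v" "crossing_point (line f) (line g) w"
    using assms unfolding flip_def by blast
  note fa = arr_antiperiodic[OF A fg(1)] and ga = arr_antiperiodic[OF A fg(2)]
  have ne: "f \<noteq> g" using fg by auto
  obtain x' y' where v: "v = proj (x', y')" by (rule proj_cases)
  obtain x'' y'' where w: "w = proj (x'', y'')" by (rule proj_cases)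
  have 1: "y' = f x'" "f x' = g x'" "\<not> crosses f g x'"
    using fg(4) contact_point_iff[OF fa ga] v by auto
  have 2: "y'' = f x''" "f x'' = g x''" "crosses f g x''"
    using fg(5) crossing_point_iff[OF fa ga] w by auto
  have "(x', f x') \<in> verts A" "(x'', f x'') \<in> verts A"
    using 1 2 fg ne unfolding verts_def by (simp, metis)+
  then obtain n m :: int where
    n: "(x' + of_int n * pi, f (x' + of_int n * pi)) \<in> F - tau ` F" and
    m: "(x'' + of_int m * pi, f (x'' + of_int m * pi)) \<in> F - tau ` F"
    using lift_ex fg(1) by blast
  show ?thesis
  proof (rule that[OF fg(1,2) ne _ _ _ _ n m])
    show "v \<in> contact_set (line ` A)"
      using v 1 proj_in_contact_set_iff[OF A] contacts_pair_iff[OF A fg(1,2) ne 1(2)] by simp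
    show "w \<notin> contact_set (line ` A)"
      using w 2 proj_in_contact_set_iff[OF A] contacts_pair_iff[OF A fg(1,2) ne 2(2)] by simp
  qed (use 1 2 v w meet_shift[OF fa ga] crosses_shift[OF fa ga] proj_shift[OF fa] in simp_all)
qed

end

text \<open>The cut is carried by \<open>S\<close> and \<open>F\<close>; the family only supplies
  curves to compute with and may be replaced. This allows two arrangements to be compared over one
  cut.\<close>

lemma cut_same_support:
  assumes "cut A S F" "fun_arrangement B" "support (line ` B) = S"
  shows "cut B S F"
  using assms unfolding cut_def by blast

text \<open>A contact outside \<open>V\<close> lying after its crossing can be flipped, and the
  reverse flip is an increasing arc into \<open>A\<close>. Conversely, an increasing arc into
  \<open>A\<close> leaves behind a contact, its old crossing, that lies after the new
  crossing.\<close>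

lemma source_iff:
  assumes C: "cut A S F"
  shows "flip_graph_source S F V (line ` A) \<longleftrightarrow> V \<subseteq> contact_set (line ` A) \<and> greedy_funs A V F"
proof -
  interpret cut A S F by fact
  have mem: "line ` A \<in> flip_graph_verts S V \<longleftrightarrow> V \<subseteq> contact_set (line ` A)"
    using simple_arrangement_line[OF A] S by (auto simp: flip_graph_verts_def)
  show ?thesis
  proof
    assume src: "flip_graph_source S F V (line ` A)"
    then have V: "V \<subseteq> contact_set (line ` A)" using mem by (simp add: flip_graph_source_def)
    moreover have "greedy_funs A V F" unfolding greedy_funs_def
    proof (intro ballI allI impI, rule ccontr)
      fix f g x y
      assume fg: "f \<in> A" "g \<in> A" "f \<noteq> g" "f x = g x" "\<not> crosses f g x" "crosses f g y"
        "(x, f x) \<in> F - tau ` F" "(y, f y) \<in> F - tau ` F" "proj (x, f x) \<notin> V" "\<not> x < y"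
      then have "x \<noteq> y" by auto
      then have yx: "y < x" using fg(10) by simp
      \<comment> \<open>The crossing at \<open>y\<close> comes too early to be the right end of a
        zone starting at \<open>x\<close>; its next translate lies in the period after
        \<open>x\<close>.\<close>
      have x1: "x < y + of_int 1 * pi" "y + of_int 1 * pi < x + pi"
        using window[OF fg(1) _ fg(7), of y] fg(8) yx by simp_all
      note fa = arr_antiperiodic[OF A fg(1)] and ga = arr_antiperiodic[OF A fg(2)]
      have "f y = g y" using arr_crosses_meet[OF A fg(1,2,6)] .
      then have eq: "f (y + of_int 1 * pi) = g (y + of_int 1 * pi)" "crosses f g (y + of_int 1 * pi)"
        unfolding meet_shift[OF fa ga] crosses_shift[OF fa ga] using fg(6) by simp_all
      define B where "B = flip_funs A f g x (y + of_int 1 * pi)"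
      have w: "proj (y + of_int 1 * pi, f (y + of_int 1 * pi)) = proj (y, f y)" by (rule proj_shift[OF fa])
      note fl = flip_funs_flip[OF x1 A fg(1-4) eq(1) fg(5) eq(2), folded B_def, unfolded w]
      \<comment> \<open>The only contact lost is that at \<open>x\<close>, which is not in
        \<open>V\<close>.\<close>
      have "line ` B \<in> flip_graph_verts S V"
        using fl(1,2) fl(4)[unfolded flip_def] V fg(9) S unfolding flip_graph_verts_def by blast
      moreover have "cut_less S F (proj (y, f y)) (proj (x, f x))"
        using cut_less_iff[OF fg(1,8,7)] yx by simp
      ultimately have "(line ` B, line ` A) \<in> flip_graph_arcs S F V"
        unfolding flip_graph_arcs_def using mem V fl(4) by blast
      then show False using src unfolding flip_graph_source_def by blast
    qed
    ultimately show "V \<subseteq> contact_set (line ` A) \<and> greedy_funs A V F" ..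
  next
    assume V: "V \<subseteq> contact_set (line ` A) \<and> greedy_funs A V F"
    have "(L, line ` A) \<notin> flip_graph_arcs S F V" for L
    proof
      assume "(L, line ` A) \<in> flip_graph_arcs S F V"
      then obtain v w where L: "L \<in> flip_graph_verts S V" "flip v w L (line ` A)" "cut_less S F v w"
        unfolding flip_graph_arcs_def by blast
      obtain B where B: "L = line ` B" "fun_arrangement B"
        using L(1) simple_arrangement_obtain[of L] unfolding flip_graph_verts_def by blast
      have LS: "support (line ` B) = S" "V \<subseteq> contact_set (line ` B)"
        using L(1) B unfolding flip_graph_verts_def by auto
      interpret B: cut B S F by (rule cut_same_support[OF C B(2) LS(1)])
      obtain f g x y where fg: "f \<in> B" "g \<in> B" "f \<noteq> g" "f x = g x" "f y = g y"
        "\<not> crosses f g x" "crosses f g y" "(x, f x) \<in> F - tau ` F" "(y, f y) \<in> F - tau ` F"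
        "v = proj (x, f x)" "w = proj (y, f y)" "v \<in> contact_set (line ` B)" "w \<notin> contact_set (line ` B)"
        by (rule B.flip_obtain[OF L(2)[unfolded B(1)]])
      have xy: "x < y" using B.cut_less_iff[OF fg(1,8,9)] L(3) fg by simp
      have xy': "y < x + pi" using B.window[OF fg(1)] fg by blast
      define D where "D = flip_funs B f g x y"
      note fl = flip_funs_flip[OF xy xy' B(2) fg(1-7), folded D_def]
      have D: "fun_arrangement D" unfolding D_def by (rule fun_arrangement_flip[OF xy xy' B(2) fg(1-7)])
      have "contact_set (line ` A) = contact_set (line ` D)"
        using L(2) fl(1) fg(10,11) B(1) unfolding flip_def by simp
      moreover have "same_cover A D" using same_cover_iff[OF A D] fl(2) LS(1) S by simp
      \<comment> \<open>\<open>flip\<close> describes its result only by support and contact set.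
        Since these determine an arrangement, it is the explicit exchange \<open>D\<close>, whose
        reverse flip is known.\<close>
      ultimately have AD: "A = D"
        using contacts_determine_arrangement[OF A D] contact_sets_eq_iff[OF A D] by blast
      obtain f' g' x' y' where fg': "f' \<in> A" "g' \<in> A" "f' \<noteq> g'" "f' x' = g' x'" "f' y' = g' y'"
        "\<not> crosses f' g' x'" "crosses f' g' y'" "(x', f' x') \<in> F - tau ` F" "(y', f' y') \<in> F - tau ` F"
        "w = proj (x', f' x')" "v = proj (y', f' y')" "w \<in> contact_set (line ` A)" "v \<notin> contact_set (line ` A)"
        by (rule flip_obtain[OF fl(4)[folded AD fg(10,11)]])
      have "proj (x', f' x') \<notin> V" using fg(13) fg'(10) LS(2) by blast
      then have "x' < y'" using greedy_funsD[of A V F f' g' x' y'] V fg' by blast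
      moreover have "(x', f' x') = (y, f y)" "(y', f' y') = (x, f x)"
        by (rule lift_unique[OF fg'(8) fg(9)], use fg(11) fg'(10) in simp,
          rule lift_unique[OF fg'(9) fg(8)], use fg(10) fg'(11) in simp)
      ultimately show False using xy by simp
    qed
    then show "flip_graph_source S F V (line ` A)" using V mem unfolding flip_graph_source_def by blast
  qed
qed

text \<open>The two curves of \<open>A\<close> touching at \<open>v\<close> meet again at their
  crossing \<open>x1\<close>. Up to there all types agree, so two curves of \<open>B\<close>
  accompany them; these cross at \<open>v\<close> and again at \<open>x1\<close>, less than a period
  later.\<close>

lemma no_last_difference:
  assumes CA: "cut A S F" and CB: "cut B S F" and gr: "greedy_funs A V F"
    and V: "V \<subseteq> contact_set (line ` B)"
    and v: "v \<in> contact_set (line ` A)" "v \<notin> contact_set (line ` B)"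
    and last: "\<And>u. u \<in> vertices S \<Longrightarrow> fst (lift_pt F v) < fst (lift_pt F u) \<Longrightarrow>
      u \<in> contact_set (line ` A) \<longleftrightarrow> u \<in> contact_set (line ` B)"
  shows False
proof -
  interpret A: cut A S F by fact
  interpret B: cut B S F by fact
  note A = A.A and B = B.A
  have AB: "same_cover A B" using same_cover_iff[OF A B] A.S B.S by simp
  have vS: "v \<in> vertices S" using v contact_set_subset_vertices[OF A] A.S by auto
  obtain x0 y0 where p: "lift_pt F v = (x0, y0)" by (cases "lift_pt F v")
  have pF: "(x0, y0) \<in> F - tau ` F" "proj (x0, y0) = v"
    using A.lift_pt_obtain[OF vS] p by simp_all
  have "(x0, y0) \<in> contacts A" using proj_in_contact_set_iff[OF A, of x0 y0] v(1) pF(2) by simp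
  then obtain f1 f2 where f: "f1 \<in> A" "f2 \<in> A" "f1 \<noteq> f2" "f1 x0 = y0" "f2 x0 = y0" "\<not> crosses f1 f2 x0"
    by (auto simp: contacts_def)
  obtain c where c: "crosses f1 f2 c" using arr_crosses_ex[OF A f(1-3)] by blast
  then have fc: "f1 c = f2 c" using arr_crosses_meet[OF A f(1,2)] by blast
  have "(c, f1 c) \<in> verts A" using f fc unfolding verts_def by force
  then obtain n :: int where n: "(c + of_int n * pi, f1 (c + of_int n * pi)) \<in> F - tau ` F"
    using A.lift_ex[OF f(1)] by blast
  define x1 where "x1 = c + of_int n * pi"
  note f1a = arr_antiperiodic[OF A f(1)] and f2a = arr_antiperiodic[OF A f(2)]
  have x1: "(x1, f1 x1) \<in> F - tau ` F" "crosses f1 f2 x1" "f1 x1 = f2 x1"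
    using n c fc crosses_shift[OF f1a f2a] meet_shift[OF f1a f2a] unfolding x1_def by simp_all
  have "v \<notin> V" using V v(2) by blast
  then have x01: "x0 < x1"
    using greedy_funsD[OF gr f(1-3), of x0 x1] f pF x1 by simp
  have x01': "x1 < x0 + pi" using A.window[OF f(1), of x0 x1] pF f x1 by simp
  obtain d where d: "d > 0"
    "\<And>u f. u \<noteq> x0 \<Longrightarrow> \<bar>u - x0\<bar> < d \<Longrightarrow> f \<in> A \<Longrightarrow> \<exists>g\<in>B. g u = f u \<and> g x0 = f x0"
    "\<And>u f f'. u \<noteq> x0 \<Longrightarrow> \<bar>u - x0\<bar> < d \<Longrightarrow> f \<in> A \<Longrightarrow> f' \<in> A \<Longrightarrow> f \<noteq> f' \<Longrightarrow> f u \<noteq> f' u"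
    "\<And>u g g'. u \<noteq> x0 \<Longrightarrow> \<bar>u - x0\<bar> < d \<Longrightarrow> g \<in> B \<Longrightarrow> g' \<in> B \<Longrightarrow> g \<noteq> g' \<Longrightarrow> g u \<noteq> g' u"
    by (rule common_near[OF A B AB, of x0]) blast
  \<comment> \<open>Just to the right of \<open>v\<close> the two touching curves are separated,
    which singles out one companion in \<open>B\<close> for each of them.\<close>
  define u where "u = x0 + min d (x1 - x0) / 2"
  have u: "u \<noteq> x0" "\<bar>u - x0\<bar> < d" "x0 < u" "u \<le> x1" using d(1) x01 by (auto simp: u_def min_def field_simps)
  have follow: "\<exists>g\<in>B. g u = f u \<and> g x0 = f x0 \<and> f x1 = g x1"
    if f: "f \<in> A" "f x0 = y0" "(x1, f x1) \<in> F - tau ` F" for f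
  proof -
    obtain g where g: "g \<in> B" "g u = f u" "g x0 = f x0" using d(2)[OF u(1,2) f(1)] by blast
    have "f x1 = g x1"
    proof (rule agree_on_connected[OF A B AB f(1) g(1)])
      \<comment> \<open>The interval excludes \<open>x0\<close>, the vertex where the types differ.
        All other vertices met are lifts by \<open>A.between\<close>, so the assumption
        \<open>last\<close> covers them, including the one at \<open>x1\<close>.\<close>
      show "connected {x0<..x1}" by (rule connected_Ioc)
      fix x f' g' assume *: "x \<in> {x0<..x1}" "f' \<in> A" "g' \<in> B" "f' \<noteq> f" "g' \<noteq> g" "f' x = f x"
        "g' x = g x" "f x = g x"
      have vx: "(x, f x) \<in> verts A" using f(1) *(2,4,6) unfolding verts_def by force
      have "(x, f x) \<in> F - tau ` F" using A.between[OF f(1) _ f(3) _ _ vx, of x0] pF f(2) *(1) by simp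
      then have "lift_pt F (proj (x, f x)) = (x, f x)" by (rule A.lift_pt_eq)
      moreover have "proj (x, f x) \<in> vertices S" using proj_in_vertices_iff[OF A] vx A.S by simp
      ultimately have "proj (x, f x) \<in> contact_set (line ` A) \<longleftrightarrow> proj (x, f x) \<in> contact_set (line ` B)"
        using last[of "proj (x, f x)"] p *(1) by simp
      then have "(x, f x) \<in> contacts A \<longleftrightarrow> (x, g x) \<in> contacts B"
        using proj_in_contact_set_iff[OF A] proj_in_contact_set_iff[OF B] *(8) by simp
      then show "crosses f f' x \<longleftrightarrow> crosses g g' x"
        using contacts_pair_iff[OF A f(1) *(2), of x] contacts_pair_iff[OF B g(1) *(3), of x] *(4-7) by auto
    next
      fix f' assume "f' \<in> A" "f' u = f u"
      then show "f' = f" using d(3)[OF u(1,2) _ f(1)] by blast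
    qed (use u x01 g in auto)
    then show ?thesis using g by blast
  qed
  obtain g1 where g1: "g1 \<in> B" "g1 u = f1 u" "g1 x0 = y0" "f1 x1 = g1 x1"
    using follow[of f1] f x1 by auto
  obtain g2 where g2: "g2 \<in> B" "g2 u = f2 u" "g2 x0 = y0" "f2 x1 = g2 x1"
    using follow[of f2] f x1 by auto
  have ne: "g1 \<noteq> g2" using d(3)[OF u(1,2) f(1,2,3)] g1(2) g2(2) by metis
  have "(x0, y0) \<notin> contacts B" using proj_in_contact_set_iff[OF B, of x0 y0] v(2) pF(2) by simp
  then have c0: "crosses g1 g2 x0" using contacts_pair_iff[OF B g1(1) g2(1) ne, of x0] g1(3) g2(3) by simp
  have "(x1, f1 x1) \<notin> contacts A" using contacts_pair_iff[OF A f(1-3), of x1] x1 by simp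
  moreover have "proj (x1, f1 x1) \<in> vertices S"
    using A.F_verts x1(1) proj_in_vertices_iff[OF A] A.S by simp
  moreover have "lift_pt F (proj (x1, f1 x1)) = (x1, f1 x1)" using x1(1) by (rule A.lift_pt_eq)
  ultimately have "(x1, f1 x1) \<notin> contacts B"
    using last[of "proj (x1, f1 x1)"] p x01 proj_in_contact_set_iff[OF A] proj_in_contact_set_iff[OF B] by simp
  then have "crosses g1 g2 x1"
    using contacts_pair_iff[OF B g1(1) g2(1) ne, of x1] g1(4) g2(4) x1(3) by simp
  then show False using arr_crosses_unique_in_period[OF B g1(1) g2(1) ne c0, of x1] x01 x01' by simp
qed

lemma greedy_funs_unique:
  assumes CA: "cut A S F" and CB: "cut B S F" and gA: "greedy_funs A V F" and gB: "greedy_funs B V F"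
    and VA: "V \<subseteq> contact_set (line ` A)" and VB: "V \<subseteq> contact_set (line ` B)"
  shows "A = B"
proof -
  interpret A: cut A S F by fact
  interpret B: cut B S F by fact
  note A = A.A and B = B.A
  have AB: "same_cover A B" using same_cover_iff[OF A B] A.S B.S by simp
  let ?CA = "contact_set (line ` A)" and ?CB = "contact_set (line ` B)"
  define D where "D = (?CA - ?CB) \<union> (?CB - ?CA)"
  have DS: "D \<subseteq> vertices S"
    using contact_set_subset_vertices[OF A] contact_set_subset_vertices[OF B] A.S B.S by (auto simp: D_def)
  then have finD: "finite D" using finite_vertices[OF A] A.S finite_subset by blast
  have "D = {}"
  proof (rule ccontr)
    assume "D \<noteq> {}"
    then obtain v where v: "v \<in> D" "\<forall>u\<in>D. fst (lift_pt F u) \<le> fst (lift_pt F v)"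
    proof -
      let ?k = "\<lambda>u. fst (lift_pt F u)"
      have "Max (?k ` D) \<in> ?k ` D" using finD \<open>D \<noteq> {}\<close> by (intro Max_in) auto
      then obtain v where "v \<in> D" "Max (?k ` D) = ?k v" by blast
      then show ?thesis using that[of v] Max_ge[of "?k ` D"] finD by (metis finite_imageI imageI)
    qed
    have "u \<in> ?CA \<longleftrightarrow> u \<in> ?CB" if "fst (lift_pt F v) < fst (lift_pt F u)" for u
      using v(2) that by (force simp: D_def)
    then show False
      \<comment> \<open>The extremal vertex is a contact in exactly one of the two arrangements,
        which then plays the first role; hence the lemma is used in both directions.\<close>
      using no_last_difference[OF CA CB gA VB, of v] no_last_difference[OF CB CA gB VA, of v] v(1)
      unfolding D_def by blast
  qed
  then have "?CA = ?CB" by (auto simp: D_def)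
  then show ?thesis using contacts_determine_arrangement[OF A B AB] contact_sets_eq_iff[OF A B] by blast
qed

text \<open>An arrangement minimising the sum over its contacts has no incoming increasing arc,
  since the tail of such an arc would have a smaller sum.\<close>

lemma source_exists:
  assumes C: "cut A S F" and ne: "flip_graph_verts S V \<noteq> {}"
  shows "\<exists>L. flip_graph_source S F V L"
proof -
  interpret cut A S F by fact
  have finS: "finite (vertices S)" using finite_vertices[OF A] S by simp
  have sub: "contact_set L \<subseteq> vertices S" if L: "L \<in> flip_graph_verts S V" for L
  proof -
    obtain B where "L = line ` B" "fun_arrangement B"
      using L simple_arrangement_obtain[of L] unfolding flip_graph_verts_def by blast
    then show ?thesis using contact_set_subset_vertices[of B] L unfolding flip_graph_verts_def by auto
  qed
  define h where "h T = (\<Sum>u\<in>T. fst (lift_pt F u))" for T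
  \<comment> \<open>The sum depends only on the contact set, a subset of the finitely many vertices.
    So it has finitely many values without counting the arrangements.\<close>
  have "finite (contact_set ` flip_graph_verts S V)"
    by (rule finite_subset[of _ "Pow (vertices S)"]) (use sub finS in auto)
  then have finh: "finite ((\<lambda>L. h (contact_set L)) ` flip_graph_verts S V)"
    using finite_imageI[of "contact_set ` flip_graph_verts S V" h] by (simp add: image_image)
  then have "Min ((\<lambda>L. h (contact_set L)) ` flip_graph_verts S V) \<in> (\<lambda>L. h (contact_set L)) ` flip_graph_verts S V"
    using ne by (intro Min_in) auto
  then obtain L where L: "L \<in> flip_graph_verts S V"
    "Min ((\<lambda>L. h (contact_set L)) ` flip_graph_verts S V) = h (contact_set L)" by blast
  have least: "h (contact_set L) \<le> h (contact_set L')" if "L' \<in> flip_graph_verts S V" for L'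
    unfolding L(2)[symmetric] by (rule Min_le[OF finh]) (use that in blast)
  have "(L', L) \<notin> flip_graph_arcs S F V" for L'
  proof
    assume "(L', L) \<in> flip_graph_arcs S F V"
    then obtain v w where L': "L' \<in> flip_graph_verts S V" "flip v w L' L" "cut_less S F v w"
      unfolding flip_graph_arcs_def by blast
    obtain B where B: "L' = line ` B" "fun_arrangement B"
      using L'(1) simple_arrangement_obtain[of L'] unfolding flip_graph_verts_def by blast
    interpret B: cut B S F
      by (rule cut_same_support[OF C B(2)]) (use L'(1) B(1) in \<open>simp add: flip_graph_verts_def\<close>)
    obtain f g x y where fg: "f \<in> B" "g \<in> B" "f \<noteq> g" "f x = g x" "f y = g y"
        "\<not> crosses f g x" "crosses f g y" "(x, f x) \<in> F - tau ` F" "(y, f y) \<in> F - tau ` F"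
        "v = proj (x, f x)" "w = proj (y, f y)" "v \<in> contact_set (line ` B)" "w \<notin> contact_set (line ` B)"
      by (rule B.flip_obtain[OF L'(2)[unfolded B(1)]])
    have xy: "x < y" using B.cut_less_iff[OF fg(1,8,9)] L'(3) fg by simp
    have lifts: "fst (lift_pt F v) = x" "fst (lift_pt F w) = y"
      using B.lift_pt_eq[OF fg(8)] B.lift_pt_eq[OF fg(9)] fg(10,11) by simp_all
    have fin: "finite (contact_set L')" using sub[OF L'(1)] finS finite_subset by blast
    have "contact_set L = insert w (contact_set L' - {v})"
      using L'(2) unfolding flip_def by simp
    then have "h (contact_set L) = y + h (contact_set L' - {v})"
      using fin fg(13) B(1) lifts by (simp add: h_def)
    moreover have "h (contact_set L') = x + h (contact_set L' - {v})"
      using sum.remove[OF fin, of v "\<lambda>u. fst (lift_pt F u)"] fg(12) B(1) lifts by (simp add: h_def)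
    ultimately have "h (contact_set L') < h (contact_set L)" using xy by simp
    then show False using least[OF L'(1)] by simp
  qed
  then show ?thesis using L(1) unfolding flip_graph_source_def by blast
qed

text \<open>Sources are greedy families and these are unique, so the definite description in
  \<open>greedy\<close> is meaningful.\<close>

lemma greedy_eqI:
  assumes C: "cut A S F" and "V \<subseteq> contact_set (line ` A)" "greedy_funs A V F"
  shows "greedy S F V = line ` A"
  unfolding greedy_def
proof (rule the_equality)
  show "flip_graph_source S F V (line ` A)" using source_iff[OF C] assms by blast
  fix L assume L: "flip_graph_source S F V L"
  then have "L \<in> flip_graph_verts S V" by (simp add: flip_graph_source_def)
  then obtain B where B: "L = line ` B" "fun_arrangement B" "support (line ` B) = S"
    using simple_arrangement_obtain[of L] unfolding flip_graph_verts_def by blast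
  have CB: "cut B S F" by (rule cut_same_support[OF C B(2,3)])
  have "B = A"
    using greedy_funs_unique[OF CB C] source_iff[OF CB] L B(1) assms by blast
  then show "L = line ` A" using B by simp
qed

lemma greedy_obtain:
  assumes C: "cut A S F" and ne: "flip_graph_verts S V \<noteq> {}"
  obtains B where "greedy S F V = line ` B" "cut B S F" "V \<subseteq> contact_set (line ` B)" "greedy_funs B V F"
proof -
  obtain L where L: "flip_graph_source S F V L" using source_exists[OF C ne] by blast
  then have "L \<in> flip_graph_verts S V" by (simp add: flip_graph_source_def)
  then obtain B where B: "L = line ` B" "fun_arrangement B" "support (line ` B) = S"
    using simple_arrangement_obtain[of L] unfolding flip_graph_verts_def by blast
  have CB: "cut B S F" by (rule cut_same_support[OF C B(2,3)])
  have "V \<subseteq> contact_set (line ` B)" "greedy_funs B V F" using source_iff[OF CB] L B(1) by blast+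
  then show ?thesis using that greedy_eqI[OF CB] CB by blast
qed

section \<open>Sweeping a vertex\<close>

locale sweep = cut +
  fixes v :: moebius and F' :: "(real \<times> real) set" and x0 y0 :: real
  assumes v: "minimal_vertex S F v" and p: "lift_pt F v = (x0, y0)" and F': "F' = F - {lift_pt F v}"
begin

lemma p_lift: "(x0, y0) \<in> F - tau ` F" and proj_p: "proj (x0, y0) = v"
  using swept[OF v] p by simp_all

lemma cut_F': "cut A S F'"
  using cut_axioms sweep_cut_filter[OF v] unfolding cut_def F' by blast

lemma lifts_F': "F' - tau ` F' = ((F - tau ` F) - {(x0, y0)}) \<union> {(x0 + pi, - y0)}"
  using sweep_lifts[OF v] unfolding F' p tau_def by simp

lemma proj_tau_p: "proj (x0 + pi, - y0) = v"
  using proj_eq_iff[of x0 y0 "x0 + pi" "- y0"] proj_p by (auto intro: exI[of _ 1])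

lemma least_on_line:
  assumes "a \<in> A" "a x0 = y0" "(x, a x) \<in> F" "x \<noteq> x0"
  shows "x0 < x"
proof (rule ccontr)
  assume "\<not> x0 < x"
  then have "path_le S (x, a x) (x0, a x0)"
    unfolding S using path_le_along[OF A assms(1), of x x0] F_verts assms p_lift by auto
  then have "(x, a x) = (x0, y0)" using swept_least[OF v assms(3)] p assms(2) by simp
  then show False using assms(4) by simp
qed

lemma lift_F'_cases:
  assumes "(x, z) \<in> F' - tau ` F'"
  shows "(x, z) \<in> F - tau ` F \<and> (x, z) \<noteq> (x0, y0) \<or> x = x0 + pi \<and> z = - y0 \<and> proj (x, z) = v"
  using assms proj_tau_p unfolding lifts_F' by auto

lemma on_line_after_pi:
  assumes "a \<in> A"
  shows "a (x0 + pi) = - y0 \<longleftrightarrow> a x0 = y0"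
  using arr_antiperiodic[OF A assms] by (simp add: antiperiodic_def)

text \<open>The contacts to be tested differ from \<open>v\<close> and keep their lifts. If the
  crossing is \<open>v\<close>, its new lift at \<open>x0 + pi\<close> comes after every old lift on
  that curve by \<open>window\<close>.\<close>

lemma greedy_funs_keep:
  assumes gr: "greedy_funs A V F" and keep: "v \<in> V \<or> v \<notin> contact_set (line ` A)"
  shows "greedy_funs A V F'"
  unfolding greedy_funs_def
proof (intro ballI allI impI)
  fix f g x y
  assume fg: "f \<in> A" "g \<in> A" "f \<noteq> g" "f x = g x" "\<not> crosses f g x" "crosses f g y"
    "(x, f x) \<in> F' - tau ` F'" "(y, f y) \<in> F' - tau ` F'" "proj (x, f x) \<notin> V"
  have "proj (x, f x) \<in> contact_set (line ` A)"
    using proj_in_contact_set_iff[OF A] contacts_pair_iff[OF A fg(1-4)] fg(5) by simp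
  then have "proj (x, f x) \<noteq> v" using keep fg(9) by auto
  then have x: "(x, f x) \<in> F - tau ` F" using lift_F'_cases[OF fg(7)] by blast
  show "x < y"
  proof (cases "(y, f y) \<in> F - tau ` F")
    case True
    then show ?thesis using greedy_funsD[OF gr fg(1-6) x] fg(9) by blast
  next
    case False
    then have y: "y = x0 + pi" "f y = - y0" using lift_F'_cases[OF fg(8)] by blast+
    then have "f x0 = y0" using on_line_after_pi[OF fg(1)] by simp
    then show ?thesis using window[OF fg(1) _ x, of x0] p_lift y by simp
  qed
qed

text \<open>Before the sweep \<open>v\<close> is first on its curves, so as a contact it precedes
  its crossing without any constraint. Other contacts and all crossings have the same lifts for both
  cuts.\<close>

lemma greedy_funs_unsweep:
  assumes gr: "greedy_funs A W F'" and vW: "v \<in> W" "W \<subseteq> contact_set (line ` A)" and W: "W \<subseteq> V \<union> {v}"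
  shows "greedy_funs A V F"
  unfolding greedy_funs_def
proof (intro ballI allI impI)
  fix f g x y
  assume fg: "f \<in> A" "g \<in> A" "f \<noteq> g" "f x = g x" "\<not> crosses f g x" "crosses f g y"
    "(x, f x) \<in> F - tau ` F" "(y, f y) \<in> F - tau ` F" "proj (x, f x) \<notin> V"
  have fy: "f y = g y" using arr_crosses_meet[OF A fg(1,2,6)] .
  show "x < y"
  proof (cases "(x, f x) = (x0, y0)")
    case True
    then have x: "x = x0" and fx: "f x0 = y0" by auto
    have "y \<noteq> x0" using fg(5,6) x by metis
    then show ?thesis unfolding x by (rule least_on_line[OF fg(1) fx DiffD1[OF fg(8)]])
  next
    case False
    have "proj (x, f x) \<noteq> v"
    proof
      assume "proj (x, f x) = v"
      then have "proj (x, f x) = proj (x0, y0)" by (simp only: proj_p)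
      from lift_unique[OF fg(7) p_lift this] show False using False by contradiction
    qed
    then have x: "proj (x, f x) \<notin> W" using fg(9) W by blast
    have "proj (y, f y) \<notin> contact_set (line ` A)"
      using proj_in_contact_set_iff[OF A] contacts_pair_iff[OF A fg(1-3) fy] fg(6) by simp
    \<comment> \<open>\<open>v\<close> is a contact, so it is not the crossing, whose lift is
      therefore unaffected by the sweep.\<close>
    then have "(y, f y) \<noteq> (x0, y0)" using vW proj_p by auto
    then show ?thesis
      by (intro greedy_funsD[OF gr fg(1-6) _ _ x]) (use fg(7,8) False in \<open>simp_all add: lifts_F'\<close>)
  qed
qed

text \<open>On the relevant range \<open>s\<close> is \<open>g\<close> before \<open>x1\<close> and
  \<open>f\<close> after it. A contact and a crossing with \<open>k\<close> on the same side of
  \<open>x1\<close> come from one pair of \<open>A\<close>. On different sides, only a contact after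
  \<open>x1\<close> with a crossing before it has to be excluded.\<close>

lemma flip_pair_greedy:
  assumes gr: "greedy_funs A V F"
    and x1: "x0 < x1" "x1 < x0 + pi" "(x1, f x1) \<in> F - tau ` F"
    and f: "f \<in> A" and g: "g \<in> A" and fg: "f \<noteq> g" and p: "f x0 = y0" "g x0 = y0"
    and eq: "f x1 = g x1" and cr: "\<not> crosses f g x0" "crosses f g x1"
    and k: "k \<in> A" "k \<noteq> f" "k \<noteq> g"
  defines "s \<equiv> swap_on_zone x0 x1 f g"
  assumes xy: "s x = k x" "\<not> crosses s k x" "crosses s k y" "s y = k y"
    "(x, s x) \<in> F' - tau ` F'" "(y, s y) \<in> F' - tau ` F'" "proj (x, s x) \<notin> V"
  shows "x < y"
proof -
  have eq0: "f x0 = g x0" using p by simp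
  note av = third_avoids[OF x1(1,2) A f g fg eq0 eq cr k]
  have kx0: "k x0 \<noteq> y0" using av[OF eq0] p by simp
  have kx1: "k x1 \<noteq> f x1" using av[OF eq] by simp
  \<comment> \<open>\<open>k\<close> avoids the meetings of \<open>f\<close> and \<open>g\<close>,
    so neither \<open>v\<close> nor the vertex at \<open>x1\<close> occurs. The remaining lifts on
    \<open>s\<close> lie strictly within the period after \<open>x0\<close>.\<close>
  have in_range: "(t, s t) \<in> F - tau ` F \<and> x0 < t \<and> t < x0 + pi \<and> t \<noteq> x1 \<and>
      s t = (if t < x1 then g t else f t)"
    if t: "(t, s t) \<in> F' - tau ` F'" "s t = k t" for t
  proof -
    have "\<not> (t = x0 + pi \<and> s t = - y0)" using on_line_after_pi[OF k(1)] kx0 t(2) by auto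
    then have tF: "(t, s t) \<in> F - tau ` F" "(t, s t) \<noteq> (x0, y0)" using lift_F'_cases[OF t(1)] by blast+
    obtain h where h: "h \<in> A" "h x0 = y0" "s t = h t"
      using f g p unfolding s_def swap_on_zone_def by (cases "zone x0 x1 t") auto
    have "t \<noteq> x0" using tF(2) h by auto
    then have "x0 < t" using least_on_line[OF h(1,2), of t] tF h(3) by simp
    moreover have "t < x0 + pi" using window[OF h(1), of x0 t] h tF p_lift by simp
    moreover have "t \<noteq> x1" using kx1 eq t(2) unfolding s_def swap_on_zone_def by (auto split: if_splits)
    ultimately show ?thesis
      using tF(1) zone_period[OF x1(1,2), of t] unfolding s_def swap_on_zone_def by auto
  qed
  have X: "(x, s x) \<in> F - tau ` F" "x0 < x" "x < x0 + pi" "x \<noteq> x1" "s x = (if x < x1 then g x else f x)"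
    using in_range[OF xy(5,1)] by auto
  have Y: "(y, s y) \<in> F - tau ` F" "x0 < y" "y < x0 + pi" "y \<noteq> x1" "s y = (if y < x1 then g y else f y)"
    using in_range[OF xy(6,4)] by auto
  have crs: "crosses s k t \<longleftrightarrow> (if t < x1 then crosses g k t else crosses f k t)"
    if "x0 < t" "t < x0 + pi" "t \<noteq> x1" for t
    using crosses_swap_iff[OF x1(1,2) A f g fg eq0 eq cr k, of t] zone_period[OF x1(1,2), of t] that
    unfolding s_def by auto
  have Xc: "\<not> (if x < x1 then crosses g k x else crosses f k x)" using xy(2) crs[OF X(2-4)] by simp
  have Yc: "if y < x1 then crosses g k y else crosses f k y" using xy(3) crs[OF Y(2-4)] by simp
  consider "x < x1" "y < x1" | "x1 < x" "x1 < y" | "x < x1" "x1 < y" | "x1 < x" "y < x1"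
    using X(4) Y(4) by linarith
  then show ?thesis
  proof cases
    case 1
    show ?thesis
      by (rule greedy_funsD[OF gr g k(1)]) (use 1 k X Y Xc Yc xy in auto)
  next
    case 2
    show ?thesis
      by (rule greedy_funsD[OF gr f k(1)]) (use 2 k X Y Xc Yc xy in auto)
  next
    case 3
    then show ?thesis by simp
  next
    case 4
    \<comment> \<open>\<open>g\<close> crosses \<open>k\<close> before \<open>x1\<close>, hence so
      does \<open>f\<close>, at \<open>c\<close>. But \<open>x\<close> is a contact of
      \<open>f\<close> and \<open>k\<close> after \<open>x1\<close>, and greediness of
      \<open>A\<close> would place it before \<open>c\<close>.\<close>
    obtain c where c: "x0 \<le> c" "c < x0 + pi" "crosses f k c"
      using arr_crosses_in_period[OF A f k(1)] k(2) by metis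
    have side: "x0 < c" "c < x1"
      using third_crosses_same_side[OF x1(1,2) A f g fg eq0 eq cr k c, of y] Y 4 Yc by auto
    have "f c = k c" using arr_crosses_meet[OF A f k(1) c(3)] .
    then have "(c, f c) \<in> verts A" using f k unfolding verts_def by force
    then have "(c, f c) \<in> F - tau ` F" using between[OF f _ x1(3), of x0 c] side p_lift p by simp
    then have "x < c"
      by (intro greedy_funsD[OF gr f k(1)]) (use 4 k X Xc xy c in auto)
    then show ?thesis using 4 side by simp
  qed
qed

text \<open>The exchanged curves now cross at \<open>v\<close>, whose lift has become the last one
  on them. Pairs with one exchanged curve are treated in \<open>flip_pair_greedy\<close>, and
  unchanged pairs avoid \<open>v\<close>, so the sweep does not move their lifts.\<close>

lemma greedy_funs_flip:
  assumes gr: "greedy_funs A V F"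
    and x1: "x0 < x1" "x1 < x0 + pi" "(x1, f x1) \<in> F - tau ` F"
    and f: "f \<in> A" and g: "g \<in> A" and fg: "f \<noteq> g" and p: "f x0 = y0" "g x0 = y0"
    and eq: "f x1 = g x1" and cr: "\<not> crosses f g x0" "crosses f g x1"
  shows "greedy_funs (flip_funs A f g x0 x1) V F'"
  unfolding greedy_funs_def
proof (intro ballI allI impI)
  let ?B = "flip_funs A f g x0 x1"
  let ?f = "swap_on_zone x0 x1 f g" and ?g = "swap_on_zone x0 x1 g f"
  fix a b x y
  assume ab: "a \<in> ?B" "b \<in> ?B" "a \<noteq> b" "a x = b x" "\<not> crosses a b x" "crosses a b y"
    "(x, a x) \<in> F' - tau ` F'" "(y, a y) \<in> F' - tau ` F'" "proj (x, a x) \<notin> V"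
  have eq0: "f x0 = g x0" using p by simp
  have B: "fun_arrangement ?B" by (rule fun_arrangement_flip[OF x1(1,2) A f g fg eq0 eq cr])
  have meet_y: "a y = b y" using arr_crosses_meet[OF B ab(1,2,6)] .
  have cr': "\<not> crosses g f x0" "crosses g f x1" using cr crosses_commute by blast+
  have x1': "(x1, g x1) \<in> F - tau ` F" using x1(3) eq by simp
  have third: "x < y" if s: "s \<in> {?f, ?g}" and k: "k \<in> A" "k \<noteq> f" "k \<noteq> g" and sk: "s = a \<and> k = b \<or> s = b \<and> k = a"
    for s k
  proof -
    have *: "s x = k x" "\<not> crosses s k x" "crosses s k y" "s y = k y"
      "(x, s x) \<in> F' - tau ` F'" "(y, s y) \<in> F' - tau ` F'" "proj (x, s x) \<notin> V"
      using sk ab meet_y crosses_commute[of a b] by auto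
    show ?thesis using s
    proof (elim insertE emptyE)
      assume "s = ?f"
      then show ?thesis
        using flip_pair_greedy[OF gr x1 f g fg p eq cr k] * by blast
    next
      assume "s = ?g"
      then show ?thesis
        using flip_pair_greedy[OF gr x1(1,2) x1' g f fg[symmetric] p(2,1) eq[symmetric] cr' k(1,3,2)] * by blast
    qed
  qed
  consider "a \<in> {?f, ?g}" "b \<in> {?f, ?g}" | "a \<in> {?f, ?g}" "b \<in> A" "b \<noteq> f" "b \<noteq> g"
    | "b \<in> {?f, ?g}" "a \<in> A" "a \<noteq> f" "a \<noteq> g" | "a \<in> A" "a \<noteq> f" "a \<noteq> g" "b \<in> A" "b \<noteq> f" "b \<noteq> g"
    using ab(1,2) unfolding flip_funs_def by blast
  then show "x < y"
  proof cases
    case 1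
    have crs: "crosses a b t \<longleftrightarrow> (\<exists>n::int. t = x0 + of_int n * pi)" for t
      using 1 ab(3) crosses_swaps_iff[OF x1(1,2) A f g fg eq0 eq cr, of t] crosses_commute[of ?f ?g t] by auto
    have xne: "x \<noteq> x0 + of_int n * pi" for n :: int using ab(5) crs by blast
    have xx: "a x = f x" using 1 ab(3,4) by (auto simp: swap_on_zone_def split: if_splits)
    have yy: "a y = f y" using 1 ab(3) meet_y by (auto simp: swap_on_zone_def split: if_splits)
    have "x \<noteq> x0 + pi" using xne[of 1] by simp
    then have xF: "(x, f x) \<in> F - tau ` F" using lift_F'_cases[OF ab(7)] xx by auto
    have "x < x0 + pi" using window[OF f _ xF, of x0] p_lift p by simp
    \<comment> \<open>The crossing is \<open>v\<close>, whose lift for the new cut is at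
      \<open>x0 + pi\<close>; every contact of the pair is an old lift in the window starting at
      \<open>x0\<close>.\<close>
    moreover have "y = x0 + pi"
    proof -
      obtain n :: int where "y = x0 + of_int n * pi" using ab(6) crs by blast
      then have "proj (y, f y) = v"
        using proj_shift[OF arr_antiperiodic[OF A f], of x0 n] p proj_p by simp
      then have pr: "proj (y, a y) = proj (x0 + pi, - y0)" by (simp only: proj_tau_p yy)
      have "(x0 + pi, - y0) \<in> F' - tau ` F'" unfolding lifts_F' by simp
      from cut.lift_unique[OF cut_F' ab(8) this pr] show ?thesis by simp
    qed
    ultimately show ?thesis by simp
  next
    case 2
    then show ?thesis using third[of a b] by blast
  next
    case 3
    then show ?thesis using third[of b a] by blast
  next
    case 4
    have notp: "\<not> (t = x0 + pi \<and> a t = - y0)" for t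
    proof
      assume "t = x0 + pi \<and> a t = - y0"
      then have "a (x0 + pi) = - y0" by auto
      then have "a x0 = y0" using on_line_after_pi[OF 4(1)] by simp
      then show False using third_avoids[OF x1(1,2) A f g fg eq0 eq cr 4(1-3) eq0] p by simp
    qed
    have "(x, a x) \<in> F - tau ` F" "(y, a y) \<in> F - tau ` F"
      using lift_F'_cases[OF ab(7)] lift_F'_cases[OF ab(8)] notp by blast+
    then show ?thesis using greedy_funsD[OF gr 4(1,4) ab(3-6)] ab(9) by blast
  qed
qed

end

theorem theorem12:
  fixes \<Lambda> :: "moebius set set" and S V W :: "moebius set" and v :: moebius
    and F F' :: "(real \<times> real) set"
  assumes "simple_arrangement \<Lambda>" and "S = support \<Lambda>"
    and "cut_filter S F"
    and "minimal_vertex S F v"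
    and "F' = F - {lift_pt F v}"
    and "V \<subseteq> vertices S"
    and "flip_graph_verts S V \<noteq> {}"
    and "W = V \<union> {v}"
  shows "(if v \<in> contact_set (greedy S F V) \<and> v \<notin> V
            then \<exists>w. flip v w (greedy S F V) (greedy S F' V)
            else greedy S F' V = greedy S F V) \<and>
         (if v \<in> contact_set (greedy S F V)
            then greedy S F' W = greedy S F V
            else flip_graph_verts S W = {})"
proof -
  obtain A0 where A0: "\<Lambda> = line ` A0" "fun_arrangement A0" using simple_arrangement_obtain[OF assms(1)] .
  have C0: "cut A0 S F" using A0 assms(2,3) by (simp add: cut_def)
  obtain A where G: "greedy S F V = line ` A" "cut A S F" "V \<subseteq> contact_set (line ` A)" "greedy_funs A V F"
    using greedy_obtain[OF C0 assms(7)] .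
  obtain x0 y0 where p: "lift_pt F v = (x0, y0)" by (cases "lift_pt F v")
  \<comment> \<open>General in \<open>B\<close>, because the hypothetical arrangement constrained by
    \<open>W\<close> needs the same interpretation later.\<close>
  have sw: "sweep B S F v F' x0 y0" if "cut B S F" for B
    using that assms(4,5) p by (simp add: sweep_def sweep_axioms_def)
  interpret sweep A S F v F' x0 y0 by (rule sw[OF G(2)])
  have one: "if v \<in> contact_set (line ` A) \<and> v \<notin> V
      then \<exists>w. flip v w (line ` A) (greedy S F' V) else greedy S F' V = line ` A"
  proof (cases "v \<in> contact_set (line ` A) \<and> v \<notin> V")
    case True
    then have "(x0, y0) \<in> contacts A" using proj_in_contact_set_iff[OF A, of x0 y0] proj_p by simp
    then obtain f g where fg: "f \<in> A" "g \<in> A" "f \<noteq> g" "f x0 = y0" "g x0 = y0" "\<not> crosses f g x0"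
      by (auto simp: contacts_def)
    note fa = arr_antiperiodic[OF A fg(1)] and ga = arr_antiperiodic[OF A fg(2)]
    obtain c where c: "crosses f g c" using arr_crosses_ex[OF A fg(1-3)] by blast
    then have fc: "f c = g c" using arr_crosses_meet[OF A fg(1,2)] by blast
    then have "(c, f c) \<in> verts A" using fg(1-3) unfolding verts_def by force
    then obtain n :: int where n: "(c + of_int n * pi, f (c + of_int n * pi)) \<in> F - tau ` F"
      using lift_ex[OF fg(1)] by blast
    \<comment> \<open>The lift of the crossing of the two curves. It comes after the minimal vertex
      at \<open>x0\<close> and, by \<open>window\<close>, less than a period later, so the flip can
      be performed on \<open>[x0, x1]\<close>.\<close>
    define x1 where "x1 = c + of_int n * pi"
    have x1: "(x1, f x1) \<in> F - tau ` F" "f x1 = g x1" "crosses f g x1"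
      using n c fc crosses_shift[OF fa ga] meet_shift[OF fa ga] unfolding x1_def by simp_all
    have "x1 \<noteq> x0" using x1(3) fg(6) by auto
    then have lt: "x0 < x1" using least_on_line[OF fg(1,4), of x1] x1(1) by blast
    have lt': "x1 < x0 + pi" using window[OF fg(1), of x0 x1] x1(1) p_lift fg(4) by simp
    have eq0: "f x0 = g x0" using fg by simp
    define B where "B = flip_funs A f g x0 x1"
    note fl = flip_funs_flip[OF lt lt' A fg(1-3) eq0 x1(2) fg(6) x1(3), folded B_def]
    have B: "fun_arrangement B"
      unfolding B_def by (rule fun_arrangement_flip[OF lt lt' A fg(1-3) eq0 x1(2) fg(6) x1(3)])
    have v_eq: "proj (x0, f x0) = v" using proj_p fg(4) by simp
    have "V \<subseteq> contact_set (line ` B)" using fl(1) G(3) True v_eq by blast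
    moreover have "cut B S F'" by (rule cut_same_support[OF cut_F' B]) (use fl(2) S in simp)
    moreover have "greedy_funs B V F'"
      unfolding B_def by (rule greedy_funs_flip[OF G(4) lt lt' x1(1) fg(1-5) x1(2) fg(6) x1(3)])
    ultimately have "greedy S F' V = line ` B" by (intro greedy_eqI)
    then show ?thesis using True fl(3) v_eq by auto
  next
    case False
    then have "greedy_funs A V F'" using greedy_funs_keep[OF G(4)] by blast
    then have "greedy S F' V = line ` A" using greedy_eqI[OF cut_F' G(3)] by blast
    then show ?thesis using False by auto
  qed
  have two: "if v \<in> contact_set (line ` A) then greedy S F' W = line ` A else flip_graph_verts S W = {}"
  proof (cases "v \<in> contact_set (line ` A)")
    case True
    \<comment> \<open>Enlarging the constraint set exempts more contacts, so the condition only
      weakens. As \<open>v\<close> is now constrained, the change of its lift does no harm.\<close>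
    have "greedy_funs A W F" using G(4) assms(8) unfolding greedy_funs_def by blast
    then have keep: "greedy_funs A W F'" by (rule greedy_funs_keep) (use assms(8) in simp)
    have "W \<subseteq> contact_set (line ` A)" using G(3) True assms(8) by simp
    then have "greedy S F' W = line ` A" by (rule greedy_eqI[OF cut_F' _ keep])
    then show ?thesis using True by simp
  next
    case False
    have "flip_graph_verts S W = {}"
    proof (rule ccontr)
      assume "flip_graph_verts S W \<noteq> {}"
      then obtain D where "greedy S F' W = line ` D"
        and D: "cut D S F'" "W \<subseteq> contact_set (line ` D)" "greedy_funs D W F'"
        by (rule greedy_obtain[OF cut_F'])
      have CD: "cut D S F" using D(1) F unfolding cut_def by blast
      interpret D: sweep D S F v F' x0 y0 by (rule sw[OF CD])
      have "greedy_funs D V F"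
        by (rule D.greedy_funs_unsweep[OF D(3) _ D(2)]) (use assms(8) in auto)
      moreover have "V \<subseteq> contact_set (line ` D)" using D(2) assms(8) by blast
      \<comment> \<open>Both are greedy for \<open>V\<close> before the sweep, but \<open>v\<close>
        is a contact of \<open>D\<close> and not of \<open>A\<close>.\<close>
      ultimately have "D = A" using greedy_funs_unique[OF CD G(2) _ G(4) _ G(3)] by simp
      then show False using D(2) assms(8) False by blast
    qed
    then show ?thesis using False by simp
  qed
  show ?thesis using one two unfolding G(1) ..
qed

end
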